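(* If $(\mathcal V_1,\mathcal L_1)$, $(\mathcal V_2,\mathcal L_2)$ and $(\mathcal V_3,\mathcal L_3)$ are quantized metric spaces, then \[\mathrm{dist}_{NC}(\mathcal V_1,\mathcal V_3)\le\mathrm{dist}_{NC}(\mathcal V_1,\mathcal V_2)+\mathrm{dist}_{NC}(\mathcal V_2,\mathcal V_3).\]
   Context: A matrix order unit space $(\mathcal V,1)$: complex vector space with conjugate-linear involution, partial orders on each $M_n(\mathcal V)$ via cones with $\gamma^*M_n(\mathcal V)^+\gamma\subseteq M_m(\mathcal V)^+$ ($\gamma\in M_{n,m}$), $\mathcal V^+$ proper with order unit $1$, each $M_n(\mathcal V)^+$ Archimedean; matrix norm $\|v\|_n=\inf\{t:\left[\begin{smallmatrix} t1_n& v\\ v^*& t1_n\end{smallmatrix}\right]\ge0\}$. $CS_n(\mathcal V)$ = unital completely positive maps $\mathcal V\to M_n$ with BW-topology (pointwise convergence); for $a=[a_{ij}]\in M_r(\mathcal V)$, $\ll\varphi,a\gg=[\varphi(a_{ij})]\in M_r(M_n)$. A matrix Lipschitz seminorm is a sequence $\mathcal L=(L_n)$ of seminorms on $M_n(\mathcal V)$ with null space $M_n(\mathbb C1)$, $L_{m+n}(v\oplus w)=\max\{L_m(v),L_n(w)\}$, $L_n(\alpha v\beta)\le\|\alpha\|L_m(v)\|\beta\|$, $L_m(v^* )=L_m(v)$. $D_{L_n}(\varphi,\psi)=\sup\{\|\ll\varphi,a\gg-\ll\psi,a\gg\|:a\in M_r(\mathcal V),L_r(a)\le1,r\in\mathbb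 N\}$; $\mathcal L$ is a matrix Lip-norm if each $D_{L_n}$ induces the BW-topology on $CS_n(\mathcal V)$; a quantized metric space is a pair $(\mathcal V,\mathcal L)$ with $\mathcal L$ a matrix Lip-norm. $\mathcal V_1\oplus\mathcal V_2$ is the direct sum with entrywise involution and order, order unit $(1,1)$, norms $\max\{\|a\|_n,\|b\|_n\}$, coordinate projections $\pi_1,\pi_2$. A unital completely positive surjection $\phi:\mathcal V\to\mathcal W$ and matrix Lipschitz seminorm $\mathcal L$ on $\mathcal V$ give the induced seminorms $L_{\mathcal W,n}(b)=\inf\{L_n(a):\phi_n(a)=b\}$. $\mathcal M(\mathcal L_1,\mathcal L_2)$ is the set of matrix Lip-norms on $\mathcal V_1\oplus\mathcal V_2$ inducing $\mathcal L_1$ via $\pi_1$ and $\mathcal L_2$ via $\pi_2$; $CS_n(\mathcal V_j)$ is identified with $\{\varphi\circ\pi_j\}\subseteq CS_n(\mathcal V_1\oplus\mathcal V_2)$. The quantized Gromov–Hausdorff distance is $\mathrm{dist}_{NC}(\mathcal V_1,\mathcal V_2)=\inf_{\mathcal L\in\mathcal M(\mathcal L_1,\mathcal L_2)}\sup_{n\in\mathbb N}n^{-2}\mathrm{dist}_H^{D_{L_n}}(CS_n(\mathcal V_1),CS_n(\mathcal V_2))$, with $\mathrm{dist}_H^{D}$ the Hausdorff distance for $D$. *)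

theory Defs
  imports "HOL-Analysis.Analysis"
begin

class scaleC =
  fixes scaleC :: "complex \<Rightarrow> 'a \<Rightarrow> 'a"

class complex_vector = scaleC + ab_group_add +
  assumes scaleC_add_right: "scaleC a (x + y) = scaleC a x + scaleC a y"
    and scaleC_add_left: "scaleC (a + b) x = scaleC a x + scaleC b x"
    and scaleC_scaleC: "scaleC a (scaleC b x) = scaleC (a * b) x"
    and scaleC_one: "scaleC 1 x = x"

instantiation prod :: (complex_vector, complex_vector) complex_vector
begin
definition scaleC_prod_def: "scaleC c x = (scaleC c (fst x), scaleC c (snd x))"
instance
  by standard (auto simp: scaleC_prod_def prod_eq_iff scaleC_add_right scaleC_add_left
      scaleC_scaleC scaleC_one)
end

text \<open>A matrix over a type is a function nat => nat => _; an element of M_n(V) is such a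
  function vanishing outside the index square {..<n} x {..<n}. A rectangular complex
  matrix in M_{n,m} is a function nat => nat => complex of which only the entries with
  row index < n and column index < m are used.\<close>

definition qm_mat :: "nat \<Rightarrow> (nat \<Rightarrow> nat \<Rightarrow> 'v::zero) set" where
  "qm_mat n = {A. \<forall>i j. \<not> (i < n \<and> j < n) \<longrightarrow> A i j = 0}"

definition cmat_norm :: "nat \<Rightarrow> nat \<Rightarrow> (nat \<Rightarrow> nat \<Rightarrow> complex) \<Rightarrow> real" where
  "cmat_norm n m \<alpha> = Sup {sqrt (\<Sum>i<n. (cmod (\<Sum>j<m. \<alpha> i j * x j))\<^sup>2) | x.
       (\<Sum>j<m. (cmod (x j))\<^sup>2) \<le> 1}"

definition cpsd :: "nat \<Rightarrow> (nat \<Rightarrow> nat \<Rightarrow> complex) \<Rightarrow> bool" where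
  "cpsd N A \<longleftrightarrow> (\<forall>x. let q = (\<Sum>i<N. \<Sum>j<N. cnj (x i) * A i j * x j)
                        in Im q = 0 \<and> Re q \<ge> 0)"

definition sandw :: "nat \<Rightarrow> nat \<Rightarrow> (nat \<Rightarrow> nat \<Rightarrow> complex) \<Rightarrow> (nat \<Rightarrow> nat \<Rightarrow> 'v::complex_vector)
      \<Rightarrow> (nat \<Rightarrow> nat \<Rightarrow> complex) \<Rightarrow> (nat \<Rightarrow> nat \<Rightarrow> 'v)" where
  "sandw n m \<alpha> v \<beta> = (\<lambda>k l. if k < n \<and> l < n
       then (\<Sum>p<m. \<Sum>q<m. scaleC (\<alpha> k p * \<beta> q l) (v p q)) else 0)"

definition conj_by :: "nat \<Rightarrow> nat \<Rightarrow> (nat \<Rightarrow> nat \<Rightarrow> complex) \<Rightarrow> (nat \<Rightarrow> nat \<Rightarrow> 'v::complex_vector)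
      \<Rightarrow> (nat \<Rightarrow> nat \<Rightarrow> 'v)" where
  "conj_by n m \<gamma> v = sandw m n (\<lambda>k p. cnj (\<gamma> p k)) v \<gamma>"

definition mdsum :: "nat \<Rightarrow> nat \<Rightarrow> (nat \<Rightarrow> nat \<Rightarrow> 'v::zero) \<Rightarrow> (nat \<Rightarrow> nat \<Rightarrow> 'v)
      \<Rightarrow> (nat \<Rightarrow> nat \<Rightarrow> 'v)" where
  "mdsum m n v w = (\<lambda>i j. if i < m \<and> j < m then v i j
      else if m \<le> i \<and> i < m + n \<and> m \<le> j \<and> j < m + n then w (i - m) (j - m) else 0)"

record 'v mou =
  minv :: "'v \<Rightarrow> 'v"
  mpos :: "nat \<Rightarrow> (nat \<Rightarrow> nat \<Rightarrow> 'v) set"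
  munit :: 'v

definition mstar :: "'v mou \<Rightarrow> (nat \<Rightarrow> nat \<Rightarrow> 'v) \<Rightarrow> (nat \<Rightarrow> nat \<Rightarrow> 'v)" where
  "mstar V a = (\<lambda>i j. minv V (a j i))"

definition unit_mat :: "'v mou \<Rightarrow> nat \<Rightarrow> (nat \<Rightarrow> nat \<Rightarrow> 'v::zero)" where
  "unit_mat V n = (\<lambda>i j. if i < n \<and> j = i then munit V else 0)"

definition as_mat1 :: "'v \<Rightarrow> (nat \<Rightarrow> nat \<Rightarrow> 'v::zero)" where
  "as_mat1 x = (\<lambda>i j. if i = 0 \<and> j = 0 then x else 0)"

definition is_mou :: "'v::complex_vector mou \<Rightarrow> bool" where
  "is_mou V \<longleftrightarrow>
     \<comment> \<open>conjugate-linear involution\<close>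
     (\<forall>x y. minv V (x + y) = minv V x + minv V y) \<and>
     (\<forall>c x. minv V (scaleC c x) = scaleC (cnj c) (minv V x)) \<and>
     (\<forall>x. minv V (minv V x) = x) \<and>
     \<comment> \<open>M_n(V)^+ is a cone of self-adjoint elements of M_n(V)\<close>
     (\<forall>n. mpos V n \<subseteq> qm_mat n) \<and>
     (\<forall>n a. a \<in> mpos V n \<longrightarrow> mstar V a = a) \<and>
     (\<forall>n. (\<lambda>i j. 0) \<in> mpos V n) \<and>
     (\<forall>n a b. a \<in> mpos V n \<longrightarrow> b \<in> mpos V n \<longrightarrow> (\<lambda>i j. a i j + b i j) \<in> mpos V n) \<and>
     (\<forall>n a (t::real). a \<in> mpos V n \<longrightarrow> t \<ge> 0 \<longrightarrow>
         (\<lambda>i j. scaleC (complex_of_real t) (a i j)) \<in> mpos V n) \<and>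
     \<comment> \<open>compatibility: gamma^* M_n(V)^+ gamma \<subseteq> M_m(V)^+\<close>
     (\<forall>n m \<gamma> a. a \<in> mpos V n \<longrightarrow> conj_by n m \<gamma> a \<in> mpos V m) \<and>
     \<comment> \<open>V^+ proper\<close>
     (\<forall>x. as_mat1 x \<in> mpos V 1 \<longrightarrow> as_mat1 (- x) \<in> mpos V 1 \<longrightarrow> x = 0) \<and>
     \<comment> \<open>1 is an order unit for V\<close>
     minv V (munit V) = munit V \<and>
     (\<forall>x. minv V x = x \<longrightarrow>
         (\<exists>t::real. as_mat1 (scaleC (complex_of_real t) (munit V) - x) \<in> mpos V 1)) \<and>
     \<comment> \<open>each M_n(V)^+ is Archimedean\<close>
     (\<forall>n a. a \<in> qm_mat n \<longrightarrow>
        (\<forall>\<epsilon>::real. \<epsilon> > 0 \<longrightarrow>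
           (\<lambda>i j. a i j + scaleC (complex_of_real \<epsilon>) (unit_mat V n i j)) \<in> mpos V n)
        \<longrightarrow> a \<in> mpos V n)"

definition mou_dsum :: "'a mou \<Rightarrow> 'b mou \<Rightarrow> ('a \<times> 'b) mou" where
  "mou_dsum V1 V2 = \<lparr> minv = (\<lambda>z. (minv V1 (fst z), minv V2 (snd z))),
      mpos = (\<lambda>n. {A. (\<lambda>i j. fst (A i j)) \<in> mpos V1 n \<and> (\<lambda>i j. snd (A i j)) \<in> mpos V2 n}),
      munit = (munit V1, munit V2) \<rparr>"

text \<open>CS_n(V): unital completely positive maps V -> M_n; M_n is represented by
  nat => nat => complex vanishing outside {..<n} x {..<n}.\<close>

text \<open><<phi, a>> in M_r(M_n) = M_{rn}, for a in M_r(V).\<close>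
definition ampl :: "nat \<Rightarrow> ('v \<Rightarrow> nat \<Rightarrow> nat \<Rightarrow> complex) \<Rightarrow> (nat \<Rightarrow> nat \<Rightarrow> 'v)
     \<Rightarrow> (nat \<Rightarrow> nat \<Rightarrow> complex)" where
  "ampl n \<phi> a = (\<lambda>I J. \<phi> (a (I div n) (J div n)) (I mod n) (J mod n))"

definition CS :: "'v::complex_vector mou \<Rightarrow> nat \<Rightarrow> ('v \<Rightarrow> nat \<Rightarrow> nat \<Rightarrow> complex) set" where
  "CS V n = {\<phi>.
     (\<forall>x i j. \<not> (i < n \<and> j < n) \<longrightarrow> \<phi> x i j = 0) \<and>
     (\<forall>x y i j. \<phi> (x + y) i j = \<phi> x i j + \<phi> y i j) \<and>
     (\<forall>c x i j. \<phi> (scaleC c x) i j = c * \<phi> x i j) \<and>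
     (\<forall>i j. \<phi> (munit V) i j = (if i < n \<and> i = j then 1 else 0)) \<and>
     (\<forall>r a. a \<in> mpos V r \<longrightarrow> cpsd (r * n) (ampl n \<phi> a))}"

definition DL :: "nat \<Rightarrow> (nat \<Rightarrow> (nat \<Rightarrow> nat \<Rightarrow> 'v::complex_vector) \<Rightarrow> real) \<Rightarrow>
     ('v \<Rightarrow> nat \<Rightarrow> nat \<Rightarrow> complex) \<Rightarrow> ('v \<Rightarrow> nat \<Rightarrow> nat \<Rightarrow> complex) \<Rightarrow> ereal" where
  "DL n L \<phi> \<psi> = (SUP ra \<in> {(r, a). a \<in> qm_mat r \<and> L r a \<le> 1}.
      ereal (cmat_norm (fst ra * n) (fst ra * n)
        (\<lambda>I J. ampl n \<phi> (snd ra) I J - ampl n \<psi> (snd ra) I J)))"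

definition matrix_lip_seminorm :: "'v::complex_vector mou \<Rightarrow>
     (nat \<Rightarrow> (nat \<Rightarrow> nat \<Rightarrow> 'v) \<Rightarrow> real) \<Rightarrow> bool" where
  "matrix_lip_seminorm V L \<longleftrightarrow>
     (\<forall>n. \<forall>a \<in> qm_mat n. \<forall>b \<in> qm_mat n. L n (\<lambda>i j. a i j + b i j) \<le> L n a + L n b) \<and>
     (\<forall>n c. \<forall>a \<in> qm_mat n. L n (\<lambda>i j. scaleC c (a i j)) = cmod c * L n a) \<and>
     (\<forall>n. \<forall>a \<in> qm_mat n. L n a = 0 \<longleftrightarrow>
         (\<forall>i<n. \<forall>j<n. \<exists>c. a i j = scaleC c (munit V))) \<and>
     (\<forall>m n. \<forall>v \<in> qm_mat m. \<forall>w \<in> qm_mat n. L (m + n) (mdsum m n v w) = max (L m v) (L n w)) \<and>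
     (\<forall>m n \<alpha> \<beta>. \<forall>v \<in> qm_mat m.
         L n (sandw n m \<alpha> v \<beta>) \<le> cmat_norm n m \<alpha> * L m v * cmat_norm m n \<beta>) \<and>
     (\<forall>m. \<forall>v \<in> qm_mat m. L m (mstar V v) = L m v)"

text \<open>D_{L_n} induces the BW-topology (pointwise convergence = product topology on
  functions V -> M_n, restricted to CS_n(V)).\<close>
definition matrix_lip_norm :: "'v::complex_vector mou \<Rightarrow>
     (nat \<Rightarrow> (nat \<Rightarrow> nat \<Rightarrow> 'v) \<Rightarrow> real) \<Rightarrow> bool" where
  "matrix_lip_norm V L \<longleftrightarrow> matrix_lip_seminorm V L \<and>
     (\<forall>n \<ge> 1. \<forall>U \<subseteq> CS V n.
        openin (top_of_set (CS V n)) U \<longleftrightarrow>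
        (\<forall>\<phi> \<in> U. \<exists>e>0. \<forall>\<psi> \<in> CS V n. DL n L \<phi> \<psi> < ereal e \<longrightarrow> \<psi> \<in> U))"

definition quantized_metric_space :: "'v::complex_vector mou \<Rightarrow>
     (nat \<Rightarrow> (nat \<Rightarrow> nat \<Rightarrow> 'v) \<Rightarrow> real) \<Rightarrow> bool" where
  "quantized_metric_space V L \<longleftrightarrow> is_mou V \<and> matrix_lip_norm V L"

definition hausdorff_dist_ereal :: "('x \<Rightarrow> 'x \<Rightarrow> ereal) \<Rightarrow> 'x set \<Rightarrow> 'x set \<Rightarrow> ereal" where
  "hausdorff_dist_ereal D A B =
     max (SUP a\<in>A. INF b\<in>B. D a b) (SUP b\<in>B. INF a\<in>A. D a b)"

definition Mset :: "'a::complex_vector mou \<Rightarrow> (nat \<Rightarrow> (nat \<Rightarrow> nat \<Rightarrow> 'a) \<Rightarrow> real) \<Rightarrow>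
     'b::complex_vector mou \<Rightarrow> (nat \<Rightarrow> (nat \<Rightarrow> nat \<Rightarrow> 'b) \<Rightarrow> real) \<Rightarrow>
     (nat \<Rightarrow> (nat \<Rightarrow> nat \<Rightarrow> 'a \<times> 'b) \<Rightarrow> real) set" where
  "Mset V1 L1 V2 L2 = {L. matrix_lip_norm (mou_dsum V1 V2) L \<and>
     (\<forall>n. \<forall>b \<in> qm_mat n. L1 n b = Inf {L n a | a. a \<in> qm_mat n \<and> (\<lambda>i j. fst (a i j)) = b}) \<and>
     (\<forall>n. \<forall>b \<in> qm_mat n. L2 n b = Inf {L n a | a. a \<in> qm_mat n \<and> (\<lambda>i j. snd (a i j)) = b})}"

definition dist_NC :: "'a::complex_vector mou \<Rightarrow> (nat \<Rightarrow> (nat \<Rightarrow> nat \<Rightarrow> 'a) \<Rightarrow> real) \<Rightarrow>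
     'b::complex_vector mou \<Rightarrow> (nat \<Rightarrow> (nat \<Rightarrow> nat \<Rightarrow> 'b) \<Rightarrow> real) \<Rightarrow> ereal" where
  "dist_NC V1 L1 V2 L2 = (INF L \<in> Mset V1 L1 V2 L2. SUP n \<in> {1..}.
      ereal (1 / (real n)\<^sup>2) *
      hausdorff_dist_ereal (DL n L) ((\<lambda>\<phi>. \<phi> \<circ> fst) ` CS V1 n) ((\<lambda>\<phi>. \<phi> \<circ> snd) ` CS V2 n))"

end

theory Submission
  imports Defs
begin

text \<open>
  Given seminorms \<open>L\<^sub>1\<^sub>2\<close> and \<open>L\<^sub>2\<^sub>3\<close> admissible for the two distances on the right, put
  \<open>L(x, z) = inf\<^sub>y max (L\<^sub>1\<^sub>2(x, y)) (L\<^sub>2\<^sub>3(y, z))\<close>. Splitting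
  \<open>\<phi>(x) - \<omega>(z) = (\<phi>(x) - \<psi>(y)) + (\<psi>(y) - \<omega>(z))\<close> gives
  \<open>D\<^sub>L(\<phi>, \<omega>) \<le> D\<^bsub>L12\<^esub>(\<phi>, \<psi>) + D\<^bsub>L23\<^esub>(\<psi>, \<omega>)\<close>, hence the triangle inequality for the Hausdorff
  distances, once \<open>L\<close> is known to be a matrix Lip-norm inducing \<open>L\<^sub>1\<close> and \<open>L\<^sub>3\<close>. Its null space is
  right because the distances between states are finite. It induces the BW-topology because a
  difference of unital completely positive maps on \<open>V\<^sub>1 \<oplus> V\<^sub>3\<close> splits into differences of such maps
  on \<open>V\<^sub>1\<close> and \<open>V\<^sub>3\<close>, controlled by \<open>L\<^sub>1, L\<^sub>3 \<le> L\<close>, and a remainder controlled by the distance of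
  one state of \<open>V\<^sub>1\<close> from one state of \<open>V\<^sub>3\<close>.

  The definition of a matrix order unit space admits spaces without states, for instance the
  complex numbers with the negative semidefinite cones. If only some of the spaces have states,
  the right-hand side is infinite. If none has, the Hausdorff distances are \<open>-\<infinity>\<close>, and it remains
  to exhibit one admissible seminorm:
  \<open>max (L\<^sub>1 x) (L\<^sub>3 z)\<close> together with the norm of \<open>f(x) - g(z)\<close> for unital self-adjoint
  functionals \<open>f\<close> and \<open>g\<close>.
\<close>

subsection \<open>Operator norms of complex matrices\<close>

text \<open>Convergence in \<open>DL\<close> always forces entrywise convergence, so being a matrix
  Lip-norm reduces to BW-continuity of \<open>DL n L \<phi>\<close> at \<phi>. The obstacle is that
  a unital completely positive map on V1 + V3 restricts to completely positive maps on the summands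
  that are not unital, about which the hypotheses on L1 and L3 say nothing. Adding a state tensored
  with a positive matrix repairs this, with one scale t for all maps in a BW-neighbourhood. The
  corrections of both summands combine into the error [s(x_pq) - u(z_pq)] tensored with the n x n
  matrix \<Delta>(e, 0). Its first factor is bounded on the Lipschitz ball uniformly in the matrix
  size r, and for this a finite distance at level 1 suffices; its second factor is small in the
  BW-topology. Since n is fixed while r varies, constants may depend crudely on n. The infimum over
  y is not known to be attained, so estimates for the glued seminorm use a y strictly below a
  slightly larger bound and then let the slack go to 0.\<close>

definition vnorm :: "nat \<Rightarrow> (nat \<Rightarrow> complex) \<Rightarrow> real" where
  "vnorm n x = L2_set (\<lambda>i. cmod (x i)) {..<n}"

definition mvec :: "nat \<Rightarrow> (nat \<Rightarrow> nat \<Rightarrow> complex) \<Rightarrow> (nat \<Rightarrow> complex) \<Rightarrow> nat \<Rightarrow> complex" where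
  "mvec m \<alpha> x = (\<lambda>i. \<Sum>j<m. \<alpha> i j * x j)"

lemma vnorm_nonneg [simp]: "0 \<le> vnorm n x"
  by (simp add: vnorm_def)

lemma vnorm_power2: "(vnorm n x)\<^sup>2 = (\<Sum>i<n. (cmod (x i))\<^sup>2)"
  by (simp add: vnorm_def L2_set_def sum_nonneg)

lemma vnorm_add_le: "vnorm n (\<lambda>i. x i + y i) \<le> vnorm n x + vnorm n y"
proof -
  have "vnorm n (\<lambda>i. x i + y i) \<le> L2_set (\<lambda>i. cmod (x i) + cmod (y i)) {..<n}"
    unfolding vnorm_def by (rule L2_set_mono) (auto simp: norm_triangle_ineq)
  also have "\<dots> \<le> vnorm n x + vnorm n y"
    unfolding vnorm_def by (rule L2_set_triangle_ineq)
  finally show ?thesis .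
qed

lemma vnorm_scale: "vnorm n (\<lambda>i. c * x i) = cmod c * vnorm n x"
  by (simp add: vnorm_def norm_mult L2_set_right_distrib)

lemma vnorm_cong: "(\<And>i. i < n \<Longrightarrow> x i = y i) \<Longrightarrow> vnorm n x = vnorm n y"
  unfolding vnorm_def by (rule L2_set_cong) auto

lemma vnorm_zero [simp]: "vnorm n (\<lambda>i. 0) = 0"
  by (simp add: vnorm_def L2_set_def)

lemma norm_le_vnorm: "i < n \<Longrightarrow> cmod (x i) \<le> vnorm n x"
  unfolding vnorm_def by (rule member_le_L2_set) auto

lemma vnorm_sum_le:
  "finite A \<Longrightarrow> vnorm n (\<lambda>i. \<Sum>k\<in>A. x k i) \<le> (\<Sum>k\<in>A. vnorm n (x k))"
proof (induction A rule: finite_induct)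
  case (insert a A)
  have "vnorm n (\<lambda>i. \<Sum>k\<in>insert a A. x k i) = vnorm n (\<lambda>i. x a i + (\<Sum>k\<in>A. x k i))"
    using insert by simp
  also have "\<dots> \<le> vnorm n (x a) + vnorm n (\<lambda>i. \<Sum>k\<in>A. x k i)"
    by (rule vnorm_add_le)
  finally show ?case using insert by simp
qed simp

lemma cinner_bound: "cmod (\<Sum>i<n. cnj (x i) * y i) \<le> vnorm n x * vnorm n y"
proof -
  have "cmod (\<Sum>i<n. cnj (x i) * y i) \<le> (\<Sum>i<n. \<bar>cmod (x i)\<bar> * \<bar>cmod (y i)\<bar>)"
    by (rule order_trans[OF norm_sum]) (simp add: norm_mult)
  also have "\<dots> \<le> vnorm n x * vnorm n y"
    unfolding vnorm_def by (rule L2_set_mult_ineq)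
  finally show ?thesis .
qed

lemma cinner_self: "(\<Sum>i<n. cnj (x i) * x i) = complex_of_real ((vnorm n x)\<^sup>2)"
proof -
  have "cnj z * z = complex_of_real ((cmod z)\<^sup>2)" for z
    by (metis complex_norm_square mult.commute)
  then show ?thesis by (simp add: vnorm_power2)
qed

lemma cmat_norm_alt:
  "cmat_norm n m \<alpha> = Sup {vnorm n (mvec m \<alpha> x) | x. vnorm m x \<le> 1}"
proof -
  have "vnorm m x \<le> 1 \<longleftrightarrow> (\<Sum>j<m. (cmod (x j))\<^sup>2) \<le> 1" for x
    by (simp add: vnorm_def L2_set_def)
  then show ?thesis
    by (simp add: cmat_norm_def vnorm_def mvec_def L2_set_def)
qed

lemma mvec_scale: "mvec m \<alpha> (\<lambda>j. c * x j) = (\<lambda>i. c * mvec m \<alpha> x i)"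
  by (simp add: mvec_def algebra_simps sum_distrib_left)

text \<open>A crude a priori bound by column norms. It makes the supremum in
  \<open>cmat_norm\<close> a genuine least upper bound in the reals.\<close>

lemma vnorm_mvec_bounded:
  "vnorm n (mvec m \<alpha> x) \<le> (\<Sum>j<m. vnorm n (\<lambda>i. \<alpha> i j)) * vnorm m x"
proof -
  have "vnorm n (mvec m \<alpha> x) \<le> (\<Sum>j<m. vnorm n (\<lambda>i. x j * \<alpha> i j))"
    unfolding mvec_def
    using vnorm_sum_le[of "{..<m}" n "\<lambda>j i. x j * \<alpha> i j"] by (simp add: mult.commute)
  also have "\<dots> = (\<Sum>j<m. cmod (x j) * vnorm n (\<lambda>i. \<alpha> i j))"
    by (simp add: vnorm_scale)
  also have "\<dots> \<le> (\<Sum>j<m. vnorm m x * vnorm n (\<lambda>i. \<alpha> i j))"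
    by (intro sum_mono mult_right_mono norm_le_vnorm) auto
  finally show ?thesis by (simp add: sum_distrib_left mult.commute)
qed

lemma cmat_norm_bdd: "bdd_above {vnorm n (mvec m \<alpha> x) | x. vnorm m x \<le> 1}"
proof (rule bdd_aboveI)
  fix y assume "y \<in> {vnorm n (mvec m \<alpha> x) | x. vnorm m x \<le> 1}"
  then obtain x where x: "y = vnorm n (mvec m \<alpha> x)" "vnorm m x \<le> 1" by auto
  have "y \<le> (\<Sum>j<m. vnorm n (\<lambda>i. \<alpha> i j)) * vnorm m x"
    using vnorm_mvec_bounded x by simp
  also have "\<dots> \<le> (\<Sum>j<m. vnorm n (\<lambda>i. \<alpha> i j)) * 1"
    using x by (intro mult_left_mono sum_nonneg) auto
  finally show "y \<le> (\<Sum>j<m. vnorm n (\<lambda>i. \<alpha> i j)) * 1" .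
qed

lemma vnorm_mvec_le: "vnorm n (mvec m \<alpha> x) \<le> cmat_norm n m \<alpha> * vnorm m x"
proof (cases "vnorm m x = 0")
  case True
  then show ?thesis using vnorm_mvec_bounded[of n m \<alpha> x] by simp
next
  case False
  define s where "s = vnorm m x"
  have s: "s > 0" using False by (simp add: s_def less_le)
  define y where "y = (\<lambda>j. complex_of_real (1 / s) * x j)"
  have "vnorm m y = cmod (complex_of_real (1 / s)) * s"
    unfolding y_def vnorm_scale s_def ..
  then have y1: "vnorm m y = 1" using s by (simp add: norm_divide)
  have "vnorm n (mvec m \<alpha> y) \<le> cmat_norm n m \<alpha>"
    unfolding cmat_norm_alt by (rule cSup_upper[OF _ cmat_norm_bdd]) (use y1 in auto)
  also have "vnorm n (mvec m \<alpha> y) = cmod (complex_of_real (1 / s)) * vnorm n (mvec m \<alpha> x)"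
    unfolding y_def mvec_scale vnorm_scale ..
  also have "cmod (complex_of_real (1 / s)) = 1 / s" using s by (simp add: norm_divide)
  finally show ?thesis using s by (simp add: s_def[symmetric] field_simps)
qed

lemma cmat_norm_leI:
  assumes "0 \<le> K" "\<And>x. vnorm n (mvec m \<alpha> x) \<le> K * vnorm m x"
  shows "cmat_norm n m \<alpha> \<le> K"
  unfolding cmat_norm_alt
proof (rule cSup_least)
  show "{vnorm n (mvec m \<alpha> x) | x. vnorm m x \<le> 1} \<noteq> {}"
    by (auto intro: exI[of _ "\<lambda>i. 0"])
next
  fix y assume "y \<in> {vnorm n (mvec m \<alpha> x) | x. vnorm m x \<le> 1}"
  then obtain x where x: "y = vnorm n (mvec m \<alpha> x)" "vnorm m x \<le> 1" by auto
  have "y \<le> K * vnorm m x" using assms x by simp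
  also have "\<dots> \<le> K * 1" using assms x by (intro mult_left_mono) auto
  finally show "y \<le> K" by simp
qed

lemma cmat_norm_nonneg [simp]: "0 \<le> cmat_norm n m \<alpha>"
proof -
  have "0 \<le> vnorm n (mvec m \<alpha> (\<lambda>i. 0))" by simp
  also have "\<dots> \<le> cmat_norm n m \<alpha>"
    unfolding cmat_norm_alt
    by (rule cSup_upper[OF _ cmat_norm_bdd]) (auto intro: exI[of _ "\<lambda>i. 0"])
  finally show ?thesis .
qed

lemma mvec_cong:
  "(\<And>j. j < m \<Longrightarrow> \<alpha> i j * x j = \<beta> i' j * y j) \<Longrightarrow> mvec m \<alpha> x i = mvec m \<beta> y i'"
  by (simp add: mvec_def)

lemma cmat_norm_cong:
  assumes "\<And>i j. i < n \<Longrightarrow> j < m \<Longrightarrow> \<alpha> i j = \<beta> i j"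
  shows "cmat_norm n m \<alpha> = cmat_norm n m \<beta>"
proof -
  have "vnorm n (mvec m \<alpha> x) = vnorm n (mvec m \<beta> x)" for x
    by (intro vnorm_cong mvec_cong) (simp add: assms)
  then show ?thesis by (simp add: cmat_norm_alt)
qed

lemma cmat_norm_triangle:
  "cmat_norm n m (\<lambda>i j. \<alpha> i j + \<beta> i j) \<le> cmat_norm n m \<alpha> + cmat_norm n m \<beta>"
proof (rule cmat_norm_leI)
  fix x
  have "vnorm n (mvec m (\<lambda>i j. \<alpha> i j + \<beta> i j) x)
      = vnorm n (\<lambda>i. mvec m \<alpha> x i + mvec m \<beta> x i)"
    by (simp add: mvec_def algebra_simps sum.distrib)
  also have "\<dots> \<le> vnorm n (mvec m \<alpha> x) + vnorm n (mvec m \<beta> x)"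
    by (rule vnorm_add_le)
  also have "\<dots> \<le> cmat_norm n m \<alpha> * vnorm m x + cmat_norm n m \<beta> * vnorm m x"
    by (intro add_mono vnorm_mvec_le)
  finally show "vnorm n (mvec m (\<lambda>i j. \<alpha> i j + \<beta> i j) x)
      \<le> (cmat_norm n m \<alpha> + cmat_norm n m \<beta>) * vnorm m x"
    by (simp add: algebra_simps)
qed simp

lemma cmat_norm_scale_le: "cmat_norm n m (\<lambda>i j. c * \<alpha> i j) \<le> cmod c * cmat_norm n m \<alpha>"
proof (rule cmat_norm_leI)
  fix x
  have "vnorm n (mvec m (\<lambda>i j. c * \<alpha> i j) x) = vnorm n (\<lambda>i. c * mvec m \<alpha> x i)"
    by (simp add: mvec_def algebra_simps sum_distrib_left)
  also have "\<dots> = cmod c * vnorm n (mvec m \<alpha> x)" by (rule vnorm_scale)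
  also have "\<dots> \<le> cmod c * (cmat_norm n m \<alpha> * vnorm m x)"
    by (intro mult_left_mono vnorm_mvec_le) simp
  finally show "vnorm n (mvec m (\<lambda>i j. c * \<alpha> i j) x) \<le> cmod c * cmat_norm n m \<alpha> * vnorm m x"
    by (simp add: algebra_simps)
qed simp

lemma cmat_norm_scale: "cmat_norm n m (\<lambda>i j. c * \<alpha> i j) = cmod c * cmat_norm n m \<alpha>"
proof (cases "c = 0")
  case True
  then show ?thesis using cmat_norm_scale_le[of n m c \<alpha>] cmat_norm_nonneg[of n m "\<lambda>i j. 0"] by simp
next
  case False
  have "cmat_norm n m \<alpha> = cmat_norm n m (\<lambda>i j. inverse c * (c * \<alpha> i j))"
    using False by (simp add: mult.assoc[symmetric])
  also have "\<dots> \<le> cmod (inverse c) * cmat_norm n m (\<lambda>i j. c * \<alpha> i j)"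
    by (rule cmat_norm_scale_le)
  also have "cmod (inverse c) = inverse (cmod c)" by (rule norm_inverse)
  finally have "cmod c * cmat_norm n m \<alpha> \<le> cmat_norm n m (\<lambda>i j. c * \<alpha> i j)"
    using False by (simp add: field_simps)
  with cmat_norm_scale_le[of n m c \<alpha>] show ?thesis by simp
qed

lemma norm_le_cmat_norm:
  assumes "i < n" "j < m"
  shows "cmod (\<alpha> i j) \<le> cmat_norm n m \<alpha>"
proof -
  define x :: "nat \<Rightarrow> complex" where "x = (\<lambda>k. if k = j then 1 else 0)"
  have "vnorm m x = 1"
    using assms unfolding vnorm_def L2_set_def x_def
    by (simp add: if_distrib[of cmod] if_distrib[of "\<lambda>t. t\<^sup>2"] cong: if_cong)
  moreover have "mvec m \<alpha> x i = \<alpha> i j"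
    using assms by (simp add: mvec_def x_def if_distrib cong: if_cong)
  ultimately show ?thesis
    using norm_le_vnorm[OF assms(1), of "mvec m \<alpha> x"] vnorm_mvec_le[of n m \<alpha> x] by simp
qed

lemma cmat_norm_mult:
  "cmat_norm n l (\<lambda>i k. \<Sum>j<m. \<alpha> i j * \<beta> j k) \<le> cmat_norm n m \<alpha> * cmat_norm m l \<beta>"
proof (rule cmat_norm_leI)
  fix x
  have "mvec l (\<lambda>i k. \<Sum>j<m. \<alpha> i j * \<beta> j k) x = mvec m \<alpha> (mvec l \<beta> x)"
    unfolding mvec_def sum_distrib_left sum_distrib_right mult.assoc
    by (intro ext) (rule sum.swap)
  then have "vnorm n (mvec l (\<lambda>i k. \<Sum>j<m. \<alpha> i j * \<beta> j k) x)
      \<le> cmat_norm n m \<alpha> * vnorm m (mvec l \<beta> x)"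
    by (simp add: vnorm_mvec_le)
  also have "\<dots> \<le> cmat_norm n m \<alpha> * (cmat_norm m l \<beta> * vnorm l x)"
    by (intro mult_left_mono vnorm_mvec_le) simp
  finally show "vnorm n (mvec l (\<lambda>i k. \<Sum>j<m. \<alpha> i j * \<beta> j k) x)
      \<le> cmat_norm n m \<alpha> * cmat_norm m l \<beta> * vnorm l x"
    by (simp add: mult.assoc)
qed simp

text \<open>If y is the adjoint applied to x, then |y|^2 = <\<alpha> y, x> \<le> ||\<alpha>|| |y|
  |x|, and |y| can be cancelled.\<close>

lemma cmat_norm_adjoint_le: "cmat_norm m n (\<lambda>i j. cnj (\<alpha> j i)) \<le> cmat_norm n m \<alpha>"
proof (rule cmat_norm_leI)
  fix x
  define y where "y = mvec n (\<lambda>i j. cnj (\<alpha> j i)) x"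
  have "(\<Sum>i<m. cnj (y i) * y i) = (\<Sum>i<m. \<Sum>j<n. cnj (y i) * (cnj (\<alpha> j i) * x j))"
    by (simp add: y_def mvec_def sum_distrib_left)
  also have "\<dots> = (\<Sum>j<n. \<Sum>i<m. cnj (y i) * (cnj (\<alpha> j i) * x j))"
    by (rule sum.swap)
  also have "\<dots> = (\<Sum>j<n. cnj (mvec m \<alpha> y j) * x j)"
    by (simp add: mvec_def sum_distrib_right sum_distrib_left ac_simps)
  finally have "complex_of_real ((vnorm m y)\<^sup>2) = (\<Sum>j<n. cnj (mvec m \<alpha> y j) * x j)"
    by (simp only: cinner_self)
  then have "(vnorm m y)\<^sup>2 = cmod (\<Sum>j<n. cnj (mvec m \<alpha> y j) * x j)"
    by (metis abs_of_nonneg norm_of_real zero_le_power2)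
  also have "\<dots> \<le> vnorm n (mvec m \<alpha> y) * vnorm n x" by (rule cinner_bound)
  also have "\<dots> \<le> (cmat_norm n m \<alpha> * vnorm m y) * vnorm n x"
    by (intro mult_right_mono vnorm_mvec_le) simp
  finally have *: "vnorm m y * vnorm m y \<le> vnorm m y * (cmat_norm n m \<alpha> * vnorm n x)"
    by (simp add: power2_eq_square ac_simps)
  have "vnorm m y \<le> cmat_norm n m \<alpha> * vnorm n x"
  proof (cases "vnorm m y = 0")
    case False
    then have "vnorm m y > 0" by (simp add: less_le)
    with * show ?thesis by simp
  qed simp
  then show "vnorm m (mvec n (\<lambda>i j. cnj (\<alpha> j i)) x) \<le> cmat_norm n m \<alpha> * vnorm n x"
    by (simp add: y_def)
qed simp

lemma cmat_norm_adjoint: "cmat_norm m n (\<lambda>i j. cnj (\<alpha> j i)) = cmat_norm n m \<alpha>"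
  using cmat_norm_adjoint_le[of m n \<alpha>] cmat_norm_adjoint_le[of n m "\<lambda>i j. cnj (\<alpha> j i)"] by simp

lemma vnorm_split: "(vnorm (m + n) x)\<^sup>2 = (vnorm m x)\<^sup>2 + (vnorm n (\<lambda>i. x (m + i)))\<^sup>2"
proof -
  have "(\<Sum>i<m + n. g i) = (\<Sum>i<m. g i) + (\<Sum>i<n. g (m + i))" for g :: "nat \<Rightarrow> real"
    by (induction n) (simp_all add: algebra_simps)
  then show ?thesis by (simp add: vnorm_power2)
qed

text \<open>The blocks act on complementary coordinates, so squared norms add by
  \<open>vnorm_split\<close>.\<close>

lemma cmat_norm_mdsum_le:
  "cmat_norm (m + n) (m + n) (mdsum m n \<alpha> \<beta>) \<le> max (cmat_norm m m \<alpha>) (cmat_norm n n \<beta>)"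
proof (rule cmat_norm_leI)
  let ?K = "max (cmat_norm m m \<alpha>) (cmat_norm n n \<beta>)"
  show K: "0 \<le> ?K" by (simp add: le_max_iff_disj)
  fix x :: "nat \<Rightarrow> complex"
  let ?y = "\<lambda>i. x (m + i)"
  have split: "(\<Sum>i<m + n. g i) = (\<Sum>i<m. g i) + (\<Sum>i<n. g (m + i))" for g :: "nat \<Rightarrow> complex"
    by (induction n) (simp_all add: algebra_simps)
  have 1: "vnorm m (mvec (m + n) (mdsum m n \<alpha> \<beta>) x) = vnorm m (mvec m \<alpha> x)"
    by (rule vnorm_cong) (simp add: mvec_def split mdsum_def)
  have 2: "vnorm n (\<lambda>i. mvec (m + n) (mdsum m n \<alpha> \<beta>) x (m + i)) = vnorm n (mvec n \<beta> ?y)"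
    by (rule vnorm_cong) (simp add: mvec_def split mdsum_def)
  have "(vnorm m (mvec m \<alpha> x))\<^sup>2 \<le> (?K * vnorm m x)\<^sup>2"
    by (intro power_mono order_trans[OF vnorm_mvec_le] mult_right_mono) auto
  moreover have "(vnorm n (mvec n \<beta> ?y))\<^sup>2 \<le> (?K * vnorm n ?y)\<^sup>2"
    by (intro power_mono order_trans[OF vnorm_mvec_le] mult_right_mono) auto
  ultimately have "(vnorm (m + n) (mvec (m + n) (mdsum m n \<alpha> \<beta>) x))\<^sup>2 \<le> (?K * vnorm (m + n) x)\<^sup>2"
    unfolding vnorm_split 1 2 power_mult_distrib by (simp add: distrib_left)
  then show "vnorm (m + n) (mvec (m + n) (mdsum m n \<alpha> \<beta>) x) \<le> ?K * vnorm (m + n) x"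
    using K by (meson mult_nonneg_nonneg power2_le_imp_le vnorm_nonneg)
qed

section \<open>Matrices indexed by pairs, I = p * n + i\<close>

lemma sum_nat_prod: "(\<Sum>I<r * n. g (I div n) (I mod n)) = (\<Sum>p<r. \<Sum>i<n. g p i)"
  for g :: "nat \<Rightarrow> nat \<Rightarrow> 'b::comm_monoid_add"
proof -
  have "(\<Sum>I<r * n. g (I div n) (I mod n)) = (\<Sum>p<r. \<Sum>I = p * n..<p * n + n. g (I div n) (I mod n))"
    by (rule sum.nat_group[symmetric])
  moreover have "(\<Sum>I = p * n..<p * n + n. g (I div n) (I mod n)) = (\<Sum>i<n. g p i)" for p
  proof (rule sum.reindex_bij_witness[where i = "\<lambda>i. p * n + i" and j = "\<lambda>I. I - p * n"])
    fix I assume "I \<in> {p * n..<p * n + n}"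
    then obtain k where "I = p * n + k" "k < n" by (metis atLeastLessThan_iff le_Suc_ex nat_add_left_cancel_less)
    then show "g p (I - p * n) = g (I div n) (I mod n)" by simp
  qed auto
  ultimately show ?thesis by simp
qed

lemma vnorm_blocks_le: "vnorm (r * n) (\<lambda>I. w (I div n) (I mod n)) \<le> (\<Sum>i<n. vnorm r (\<lambda>p. w p i))"
proof -
  have "(vnorm (r * n) (\<lambda>I. w (I div n) (I mod n)))\<^sup>2 = (\<Sum>p<r. \<Sum>i<n. (cmod (w p i))\<^sup>2)"
    by (simp add: vnorm_power2 sum_nat_prod[where g = "\<lambda>p i. (cmod (w p i))\<^sup>2"])
  also have "\<dots> = (\<Sum>i<n. (vnorm r (\<lambda>p. w p i))\<^sup>2)"
    by (simp add: vnorm_power2) (rule sum.swap)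
  finally have "vnorm (r * n) (\<lambda>I. w (I div n) (I mod n)) = L2_set (\<lambda>i. vnorm r (\<lambda>p. w p i)) {..<n}"
    unfolding L2_set_def by (metis real_sqrt_unique vnorm_nonneg)
  also have "\<dots> \<le> (\<Sum>i<n. vnorm r (\<lambda>p. w p i))"
    by (rule L2_set_le_sum) simp
  finally show ?thesis .
qed

lemma vnorm_block_le:
  assumes "j < n"
  shows "vnorm r (\<lambda>p. x (p * n + j)) \<le> vnorm (r * n) x"
proof -
  have "(vnorm (r * n) x)\<^sup>2 = (\<Sum>I<r * n. (cmod (x ((I div n) * n + I mod n)))\<^sup>2)"
    by (simp add: vnorm_power2)
  also have "\<dots> = (\<Sum>p<r. \<Sum>i<n. (cmod (x (p * n + i)))\<^sup>2)"
    by (rule sum_nat_prod[where g = "\<lambda>p i. (cmod (x (p * n + i)))\<^sup>2"])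
  also have "\<dots> \<ge> (\<Sum>p<r. (cmod (x (p * n + j)))\<^sup>2)"
    using assms by (intro sum_mono member_le_sum) auto
  finally show ?thesis
    by (metis vnorm_power2 power2_le_imp_le vnorm_nonneg)
qed

text \<open>Grouping by the second index turns the action into n^2 copies of F weighted by the
  entries of R. The entry sum is a crude substitute for the norm of R, harmless because n is fixed
  while r ranges over all sizes.\<close>

lemma cmat_norm_kron_le:
  "cmat_norm (r * n) (r * n) (\<lambda>I J. F (I div n) (J div n) * R (I mod n) (J mod n))
    \<le> cmat_norm r r F * (\<Sum>i<n. \<Sum>j<n. cmod (R i j))"
proof (rule cmat_norm_leI)
  fix x :: "nat \<Rightarrow> complex"
  let ?x = "\<lambda>j p. x (p * n + j)"
  define w where "w = (\<lambda>p i. \<Sum>j<n. R i j * mvec r F (?x j) p)"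
  have eq: "mvec (r * n) (\<lambda>I J. F (I div n) (J div n) * R (I mod n) (J mod n)) x
      = (\<lambda>I. w (I div n) (I mod n))"
  proof
    fix I
    have "mvec (r * n) (\<lambda>I J. F (I div n) (J div n) * R (I mod n) (J mod n)) x I
      = (\<Sum>J<r * n. F (I div n) (J div n) * R (I mod n) (J mod n) * x ((J div n) * n + J mod n))"
      by (simp add: mvec_def)
    also have "\<dots> = (\<Sum>q<r. \<Sum>j<n. F (I div n) q * R (I mod n) j * x (q * n + j))"
      by (rule sum_nat_prod[where g = "\<lambda>q j. F (I div n) q * R (I mod n) j * x (q * n + j)"])
    also have "\<dots> = (\<Sum>j<n. \<Sum>q<r. F (I div n) q * R (I mod n) j * x (q * n + j))"
      by (rule sum.swap)
    finally show "mvec (r * n) (\<lambda>I J. F (I div n) (J div n) * R (I mod n) (J mod n)) x I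
      = w (I div n) (I mod n)"
      by (simp add: w_def mvec_def sum_distrib_left ac_simps)
  qed
  have "vnorm r (\<lambda>p. w p i) \<le> (\<Sum>j<n. cmod (R i j)) * (cmat_norm r r F * vnorm (r * n) x)" for i
  proof -
    have "vnorm r (\<lambda>p. w p i) \<le> (\<Sum>j<n. vnorm r (\<lambda>p. R i j * mvec r F (?x j) p))"
      unfolding w_def by (rule vnorm_sum_le) simp
    also have "\<dots> \<le> (\<Sum>j<n. cmod (R i j) * (cmat_norm r r F * vnorm (r * n) x))"
      unfolding vnorm_scale
      by (intro sum_mono mult_left_mono order_trans[OF vnorm_mvec_le] vnorm_block_le) auto
    finally show ?thesis by (simp add: sum_distrib_right)
  qed
  then have "(\<Sum>i<n. vnorm r (\<lambda>p. w p i))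
      \<le> (\<Sum>i<n. (\<Sum>j<n. cmod (R i j)) * (cmat_norm r r F * vnorm (r * n) x))"
    by (intro sum_mono)
  with vnorm_blocks_le[of r n w]
  show "vnorm (r * n) (mvec (r * n) (\<lambda>I J. F (I div n) (J div n) * R (I mod n) (J mod n)) x)
      \<le> cmat_norm r r F * (\<Sum>i<n. \<Sum>j<n. cmod (R i j)) * vnorm (r * n) x"
    unfolding eq by (simp add: sum_distrib_left ac_simps)
qed (simp add: sum_nonneg)

text \<open>Such a matrix reads off the coordinates k, ..., k + n - 1. Compressions to diagonal
  blocks are built from it in \<open>lip_seminormI\<close>.\<close>

lemma cmat_norm_partial_id:
  assumes "\<And>i j. i < n \<Longrightarrow> j < m \<Longrightarrow> \<alpha> i j = (if j = i + k then 1 else 0)" "n + k \<le> m"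
  shows "cmat_norm n m \<alpha> \<le> 1"
proof (rule cmat_norm_leI)
  fix x
  have "vnorm n (mvec m \<alpha> x) = vnorm n (\<lambda>i. x (k + i))"
  proof (rule vnorm_cong)
    fix i assume "i < n"
    then have "mvec m \<alpha> x i = (\<Sum>j<m. if j = i + k then x j else 0)"
      unfolding mvec_def by (intro sum.cong) (auto simp: assms(1))
    with \<open>i < n\<close> assms(2) show "mvec m \<alpha> x i = x (k + i)" by (simp add: add.commute)
  qed
  moreover have "(vnorm n (\<lambda>i. x (k + i)))\<^sup>2 \<le> (vnorm m x)\<^sup>2"
  proof -
    have "m = k + (n + (m - (n + k)))" using assms(2) by simp
    then have "(vnorm m x)\<^sup>2 = (vnorm k x)\<^sup>2 + (vnorm (n + (m - (n + k))) (\<lambda>i. x (k + i)))\<^sup>2"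
      by (metis vnorm_split)
    then show ?thesis by (simp add: vnorm_split)
  qed
  ultimately show "vnorm n (mvec m \<alpha> x) \<le> 1 * vnorm m x"
    using power2_le_imp_le by auto
qed simp

subsection \<open>Positive semidefinite matrices\<close>

definition sform :: "nat \<Rightarrow> (nat \<Rightarrow> nat \<Rightarrow> complex) \<Rightarrow> (nat \<Rightarrow> complex) \<Rightarrow> (nat \<Rightarrow> complex) \<Rightarrow> complex" where
  "sform N A x y = (\<Sum>i<N. \<Sum>j<N. cnj (x i) * A i j * y j)"

lemma cpsd_iff: "cpsd N A \<longleftrightarrow> (\<forall>x. Im (sform N A x x) = 0 \<and> Re (sform N A x x) \<ge> 0)"
  by (simp add: cpsd_def sform_def Let_def)

lemma sform_expand:
  "sform N A (\<lambda>i. x i + c * y i) (\<lambda>i. x i + c * y i)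
    = sform N A x x + c * sform N A x y + cnj c * sform N A y x + cnj c * c * sform N A y y"
proof -
  have "cnj (x i + c * y i) * A i j * (x j + c * y j) = cnj (x i) * A i j * x j
      + c * (cnj (x i) * A i j * y j) + cnj c * (cnj (y i) * A i j * x j)
      + cnj c * c * (cnj (y i) * A i j * y j)" for i j
    by (simp add: algebra_simps)
  then show ?thesis
    by (simp add: sform_def sum.distrib sum_distrib_left)
qed

text \<open>Polarization: realness of the form at x + y settles the imaginary parts, at x + i y the
  real parts.\<close>

lemma cpsd_hermitian:
  assumes "cpsd N A"
  shows "sform N A y x = cnj (sform N A x y)"
proof -
  have r: "Im (sform N A z z) = 0" for z using assms by (auto simp: cpsd_iff)
  have "Im (sform N A x y + sform N A y x) = 0"
    using r[of "\<lambda>i. x i + 1 * y i"] r[of x] r[of y] unfolding sform_expand by simp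
  moreover have "Re (sform N A x y) = Re (sform N A y x)"
    using r[of "\<lambda>i. x i + \<i> * y i"] r[of x] r[of y] unfolding sform_expand by simp
  ultimately show ?thesis by (simp add: complex_eq_iff)
qed

text \<open>The additive form of Cauchy-Schwarz, from positivity at x + u y, where the phase u turns
  the two cross terms into -2 |z|.\<close>

lemma cpsd_cauchy:
  assumes "cpsd N A"
  shows "2 * cmod (sform N A x y) \<le> Re (sform N A x x) + Re (sform N A y y)"
proof (cases "sform N A x y = 0")
  case True
  then show ?thesis using assms by (auto simp: cpsd_iff)
next
  case False
  define z where "z = sform N A x y"
  define u where "u = - cnj z / complex_of_real (cmod z)"
  have z: "z \<noteq> 0" using False z_def by simp
  have zz: "cnj z * z = complex_of_real (cmod z) * complex_of_real (cmod z)"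
    by (metis complex_norm_square mult.commute of_real_mult power2_eq_square)
  have uz: "u * z = - complex_of_real (cmod z)"
    using z by (simp add: u_def zz)
  have "cnj u * u = (z * cnj z) / (complex_of_real (cmod z) * complex_of_real (cmod z))"
    by (simp add: u_def)
  then have uu: "cnj u * u = 1" using z zz by (simp add: mult.commute)
  have "cnj u * cnj z = cnj (u * z)" by simp
  then have uz': "cnj u * cnj z = - complex_of_real (cmod z)" by (simp only: uz) simp
  have "0 \<le> Re (sform N A (\<lambda>i. x i + u * y i) (\<lambda>i. x i + u * y i))"
    using assms by (auto simp: cpsd_iff)
  also have "\<dots> = Re (sform N A x x + u * z + cnj u * cnj z + cnj u * u * sform N A y y)"
    unfolding sform_expand cpsd_hermitian[OF assms, of y x] z_def ..
  also have "\<dots> = Re (sform N A x x) - 2 * cmod z + Re (sform N A y y)"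
    unfolding uz uz' uu by simp
  finally show ?thesis by (simp add: z_def)
qed

lemma cpsd_add: "cpsd N A \<Longrightarrow> cpsd N B \<Longrightarrow> cpsd N (\<lambda>i j. A i j + B i j)"
proof -
  have "sform N (\<lambda>i j. A i j + B i j) x x = sform N A x x + sform N B x x" for x
    by (simp add: sform_def algebra_simps sum.distrib)
  then show "cpsd N A \<Longrightarrow> cpsd N B \<Longrightarrow> cpsd N (\<lambda>i j. A i j + B i j)"
    by (simp add: cpsd_iff)
qed

lemma cpsd_scale: "cpsd N A \<Longrightarrow> 0 \<le> t \<Longrightarrow> cpsd N (\<lambda>i j. A i j * complex_of_real t)"
proof -
  have "sform N (\<lambda>i j. A i j * complex_of_real t) x x = complex_of_real t * sform N A x x" for x
    by (simp add: sform_def sum_distrib_left ac_simps)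
  then show "cpsd N A \<Longrightarrow> 0 \<le> t \<Longrightarrow> cpsd N (\<lambda>i j. A i j * complex_of_real t)"
    by (simp add: cpsd_iff)
qed

lemma cpsd_cong: "(\<And>i j. i < N \<Longrightarrow> j < N \<Longrightarrow> A i j = B i j) \<Longrightarrow> cpsd N A = cpsd N B"
  by (simp add: cpsd_def)

lemma sform_unit:
  assumes "i < N" "j < N"
  shows "sform N A (\<lambda>k. if k = i then 1 else 0) (\<lambda>k. if k = j then 1 else 0) = A i j"
  using assms by (simp add: sform_def if_distrib[of cnj] if_distrib[of "\<lambda>z. z * _"]
      if_distrib[of "\<lambda>z. _ * z"] cong: if_cong)

text \<open>Writing \<open>F \<otimes> (1 - R)\<close> as a form in the vectors \<open>\<xi>\<^sub>i\<close> of entries with second index \<open>i\<close>,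
  the off-diagonal values \<open>F(\<xi>\<^sub>i, \<xi>\<^sub>j)\<close> are dominated by the diagonal ones, so the
  smallness of the entries of \<open>R\<close> suffices and no square root of \<open>1 - R\<close> is needed.\<close>

lemma cpsd_kron:
  assumes F: "cpsd r F"
    and herm: "\<And>i j. i < n \<Longrightarrow> j < n \<Longrightarrow> R j i = cnj (R i j)"
    and small: "\<And>i j. i < n \<Longrightarrow> j < n \<Longrightarrow> real n * cmod (R i j) \<le> 1"
  shows "cpsd (r * n) (\<lambda>I J. F (I div n) (J div n) *
    ((if I mod n = J mod n then 1 else 0) - R (I mod n) (J mod n)))"
  unfolding cpsd_iff
proof (intro allI)
  fix x :: "nat \<Rightarrow> complex"
  define \<xi> where "\<xi> = (\<lambda>i p. x (p * n + i))"
  define G where "G = (\<lambda>i j. sform r F (\<xi> i) (\<xi> j))"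
  define \<delta> :: "nat \<Rightarrow> nat \<Rightarrow> complex" where "\<delta> = (\<lambda>i j. if i = j then 1 else 0)"
  let ?q = "sform (r * n) (\<lambda>I J. F (I div n) (J div n) *
    ((if I mod n = J mod n then 1 else 0) - R (I mod n) (J mod n))) x x"
  have "?q = (\<Sum>I<r * n. \<Sum>J<r * n. cnj (x ((I div n) * n + I mod n)) *
      (F (I div n) (J div n) * (\<delta> (I mod n) (J mod n) - R (I mod n) (J mod n))) *
      x ((J div n) * n + J mod n))"
    by (simp add: sform_def \<delta>_def)
  also have "\<dots> = (\<Sum>I<r * n. \<Sum>q<r. \<Sum>j<n. cnj (x ((I div n) * n + I mod n)) *
      (F (I div n) q * (\<delta> (I mod n) j - R (I mod n) j)) * x (q * n + j))"
  proof (rule sum.cong[OF refl])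
    fix I
    show "(\<Sum>J<r * n. cnj (x ((I div n) * n + I mod n)) *
      (F (I div n) (J div n) * (\<delta> (I mod n) (J mod n) - R (I mod n) (J mod n))) *
      x ((J div n) * n + J mod n)) = (\<Sum>q<r. \<Sum>j<n. cnj (x ((I div n) * n + I mod n)) *
      (F (I div n) q * (\<delta> (I mod n) j - R (I mod n) j)) * x (q * n + j))"
      by (rule sum_nat_prod[where g = "\<lambda>q j. cnj (x ((I div n) * n + I mod n)) *
        (F (I div n) q * (\<delta> (I mod n) j - R (I mod n) j)) * x (q * n + j)"])
  qed
  also have "\<dots> = (\<Sum>p<r. \<Sum>i<n. \<Sum>q<r. \<Sum>j<n. cnj (\<xi> i p) *
      (F p q * (\<delta> i j - R i j)) * \<xi> j q)"
    unfolding \<xi>_def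
    by (rule sum_nat_prod[where g = "\<lambda>p i. \<Sum>q<r. \<Sum>j<n. cnj (x (p * n + i)) *
      (F p q * (\<delta> i j - R i j)) * x (q * n + j)"])
  also have "\<dots> = (\<Sum>i<n. \<Sum>p<r. \<Sum>q<r. \<Sum>j<n. cnj (\<xi> i p) *
      (F p q * (\<delta> i j - R i j)) * \<xi> j q)"
    by (rule sum.swap)
  also have "\<dots> = (\<Sum>i<n. \<Sum>p<r. \<Sum>j<n. \<Sum>q<r. cnj (\<xi> i p) *
      (F p q * (\<delta> i j - R i j)) * \<xi> j q)"
    by (rule sum.cong[OF refl], rule sum.cong[OF refl], rule sum.swap)
  also have "\<dots> = (\<Sum>i<n. \<Sum>j<n. \<Sum>p<r. \<Sum>q<r. cnj (\<xi> i p) *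
      (F p q * (\<delta> i j - R i j)) * \<xi> j q)"
    by (rule sum.cong[OF refl], rule sum.swap)
  also have "\<dots> = (\<Sum>i<n. \<Sum>j<n. (\<delta> i j - R i j) * G i j)"
    by (simp add: G_def sform_def sum_distrib_left ac_simps)
  also have "\<dots> = (\<Sum>i<n. \<Sum>j<n. \<delta> i j * G i j) - (\<Sum>i<n. \<Sum>j<n. R i j * G i j)"
    by (simp add: algebra_simps sum_subtractf)
  also have "(\<Sum>i<n. \<Sum>j<n. \<delta> i j * G i j) = (\<Sum>i<n. G i i)"
    by (simp add: \<delta>_def if_distrib[of "\<lambda>z. z * _"] cong: if_cong)
  finally have q: "?q = (\<Sum>i<n. G i i) - (\<Sum>i<n. \<Sum>j<n. R i j * G i j)" .
  have GI: "Im (G i i) = 0" and GR: "0 \<le> Re (G i i)" for i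
    using F by (auto simp: G_def cpsd_iff)
  have Gh: "G j i = cnj (G i j)" for i j
    unfolding G_def by (rule cpsd_hermitian[OF F])
  have "cnj (\<Sum>i<n. \<Sum>j<n. R i j * G i j) = (\<Sum>i<n. \<Sum>j<n. R j i * G j i)"
    unfolding cnj_sum complex_cnj_mult
    by (intro sum.cong refl) (simp only: lessThan_iff herm[symmetric] Gh[symmetric])
  also have "\<dots> = (\<Sum>i<n. \<Sum>j<n. R i j * G i j)" by (rule sum.swap)
  finally have "(\<Sum>i<n. \<Sum>j<n. R i j * G i j) \<in> \<real>" by (simp only: Reals_cnj_iff)
  then have "Im (\<Sum>i<n. \<Sum>j<n. R i j * G i j) = 0" by (simp only: complex_is_Real_iff)
  moreover have "Im (\<Sum>i<n. G i i) = 0" by (simp add: Im_sum GI)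
  ultimately have "Im ?q = 0" unfolding q minus_complex.simps by (simp only: diff_0_right)
  moreover have "Re (\<Sum>i<n. \<Sum>j<n. R i j * G i j) \<le> (\<Sum>i<n. Re (G i i))"
  proof (cases "n = 0")
    case False
    have "Re (\<Sum>i<n. \<Sum>j<n. R i j * G i j) \<le> (\<Sum>i<n. \<Sum>j<n. cmod (R i j * G i j))"
      unfolding Re_sum by (intro sum_mono complex_Re_le_cmod)
    \<comment> \<open>The bound |R_ij| \<le> 1/n fits exactly: with |G_ij| \<le> (G_ii + G_jj)/2 the
      double sum comes out as the sum of the G_ii.\<close>
    also have "\<dots> \<le> (\<Sum>i<n. \<Sum>j<n. (Re (G i i) + Re (G j j)) / (2 * real n))"
    proof (intro sum_mono)
      fix i j assume "i \<in> {..<n}" "j \<in> {..<n}"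
      then have "cmod (R i j) \<le> 1 / real n" using small False by (simp add: field_simps)
      moreover have "cmod (G i j) \<le> (Re (G i i) + Re (G j j)) / 2"
        using cpsd_cauchy[OF F, of "\<xi> i" "\<xi> j"] by (simp add: G_def)
      ultimately have "cmod (R i j) * cmod (G i j) \<le> 1 / real n * ((Re (G i i) + Re (G j j)) / 2)"
        by (intro mult_mono) auto
      then show "cmod (R i j * G i j) \<le> (Re (G i i) + Re (G j j)) / (2 * real n)"
        by (simp add: norm_mult field_simps)
    qed
    also have "\<dots> = (\<Sum>i<n. Re (G i i))"
    proof -
      have "(\<Sum>j<n. (Re (G i i) + Re (G j j)) / (2 * real n))
          = Re (G i i) / 2 + (\<Sum>j<n. Re (G j j)) / (2 * real n)" for i
        using False by (simp add: add_divide_distrib sum.distrib sum_divide_distrib)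
      then show ?thesis
        using False by (simp add: sum.distrib sum_divide_distrib[symmetric])
    qed
    finally show ?thesis .
  qed simp
  then have "Re ?q \<ge> 0" unfolding q minus_complex.simps Re_sum[of "\<lambda>i. G i i"] by (simp only: diff_ge_0_iff_ge)
  ultimately show "Im ?q = 0 \<and> 0 \<le> Re ?q" by simp
qed

subsection \<open>Linear maps, states and unital completely positive maps\<close>

definition mlin :: "('v::complex_vector \<Rightarrow> nat \<Rightarrow> nat \<Rightarrow> complex) \<Rightarrow> bool" where
  "mlin \<phi> \<longleftrightarrow> (\<forall>x y i j. \<phi> (x + y) i j = \<phi> x i j + \<phi> y i j) \<and>
     (\<forall>c x i j. \<phi> (scaleC c x) i j = c * \<phi> x i j)"

definition is_state :: "'v::complex_vector mou \<Rightarrow> ('v \<Rightarrow> complex) \<Rightarrow> bool" where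
  "is_state V h \<longleftrightarrow> (\<forall>x y. h (x + y) = h x + h y) \<and> (\<forall>c x. h (scaleC c x) = c * h x) \<and>
     h (munit V) = 1 \<and> (\<forall>x. as_mat1 x \<in> mpos V 1 \<longrightarrow> Im (h x) = 0 \<and> 0 \<le> Re (h x))"

text \<open>The map h tensor (1 - R). With R = 0 it is h tensor 1, the basic element of
  \<open>CS V n\<close> supplied by a state; other R give the correction that makes a map
  unital.\<close>

definition state_tensor :: "nat \<Rightarrow> ('v \<Rightarrow> complex) \<Rightarrow> (nat \<Rightarrow> nat \<Rightarrow> complex) \<Rightarrow> 'v \<Rightarrow> nat \<Rightarrow> nat \<Rightarrow> complex" where
  "state_tensor n h R = (\<lambda>x i j. if i < n \<and> j < n then h x * ((if i = j then 1 else 0) - R i j) else 0)"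

lemma scaleC_zero_left [simp]: "scaleC 0 (x :: 'v::complex_vector) = 0"
  using scaleC_add_left[of 0 0 x] by simp

lemma scaleC_zero_right [simp]: "scaleC c (0 :: 'v::complex_vector) = 0"
  using scaleC_add_right[of c "0::'v" 0] by simp

lemma scaleC_minus_one: "scaleC (- 1) (x :: 'v::complex_vector) = - x"
  using scaleC_add_left[of 1 "- 1" x] by (simp add: scaleC_one eq_neg_iff_add_eq_0 add.commute)

lemma mlin_lincomb: "mlin \<phi> \<Longrightarrow> mlin \<psi> \<Longrightarrow> mlin (\<lambda>x i j. \<phi> x i j * c + \<psi> x i j)"
  by (simp add: mlin_def algebra_simps)

lemma CS_mlin: "\<phi> \<in> CS V n \<Longrightarrow> mlin \<phi>"
  unfolding CS_def mlin_def by blast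

lemma CS_support: "\<phi> \<in> CS V n \<Longrightarrow> \<not> (i < n \<and> j < n) \<Longrightarrow> \<phi> x i j = 0"
  unfolding CS_def by blast

lemma CS_unit: "\<phi> \<in> CS V n \<Longrightarrow> \<phi> (munit V) i j = (if i < n \<and> i = j then 1 else 0)"
  unfolding CS_def by blast

lemma CS_pos: "\<phi> \<in> CS V n \<Longrightarrow> a \<in> mpos V r \<Longrightarrow> cpsd (r * n) (ampl n \<phi> a)"
  unfolding CS_def by blast

lemma CS_I:
  assumes "mlin \<phi>" "\<And>x i j. \<not> (i < n \<and> j < n) \<Longrightarrow> \<phi> x i j = 0"
    "\<And>i j. \<phi> (munit V) i j = (if i < n \<and> i = j then 1 else 0)"
    "\<And>r a. a \<in> mpos V r \<Longrightarrow> cpsd (r * n) (ampl n \<phi> a)"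
  shows "\<phi> \<in> CS V n"
  using assms unfolding CS_def mlin_def by blast

lemma state_add: "is_state V h \<Longrightarrow> h (x + y) = h x + h y"
  and state_scale: "is_state V h \<Longrightarrow> h (scaleC c x) = c * h x"
  and state_unit: "is_state V h \<Longrightarrow> h (munit V) = 1"
  and state_pos: "is_state V h \<Longrightarrow> as_mat1 x \<in> mpos V 1 \<Longrightarrow> Im (h x) = 0 \<and> 0 \<le> Re (h x)"
  unfolding is_state_def by blast+

lemma state_sum:
  assumes "is_state V h"
  shows "finite A \<Longrightarrow> h (\<Sum>i\<in>A. f i) = (\<Sum>i\<in>A. h (f i))"
proof (induction A rule: finite_induct)
  case empty
  then show ?case
    using assms unfolding is_state_def by (metis scaleC_zero_left mult_zero_left sum.empty)
next
  case (insert a A)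
  then show ?case using assms unfolding is_state_def by simp
qed

lemma is_mou_facts:
  assumes "is_mou V"
  shows "\<forall>x y. minv V (x + y) = minv V x + minv V y"
    "\<forall>c x. minv V (scaleC c x) = scaleC (cnj c) (minv V x)"
    "\<forall>x. minv V (minv V x) = x"
    "\<forall>n a. a \<in> mpos V n \<longrightarrow> mstar V a = a"
    "\<forall>n. (\<lambda>i j. 0) \<in> mpos V n"
    "\<forall>n a b. a \<in> mpos V n \<longrightarrow> b \<in> mpos V n \<longrightarrow> (\<lambda>i j. a i j + b i j) \<in> mpos V n"
    "\<forall>n a (t::real). a \<in> mpos V n \<longrightarrow> t \<ge> 0 \<longrightarrow>
         (\<lambda>i j. scaleC (complex_of_real t) (a i j)) \<in> mpos V n"
    "\<forall>n m \<gamma> a. a \<in> mpos V n \<longrightarrow> conj_by n m \<gamma> a \<in> mpos V m"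
    "\<forall>x. as_mat1 x \<in> mpos V 1 \<longrightarrow> as_mat1 (- x) \<in> mpos V 1 \<longrightarrow> x = 0"
    "minv V (munit V) = munit V"
    "\<forall>x. minv V x = x \<longrightarrow>
         (\<exists>t::real. as_mat1 (scaleC (complex_of_real t) (munit V) - x) \<in> mpos V 1)"
  using assms unfolding is_mou_def by - (elim conjE, assumption)+

lemma mou_inv_add:
  "is_mou V \<Longrightarrow> minv V (x + y) = minv V x + minv V y"
  using is_mou_facts(1) by blast

lemma mou_inv_scale:
  "is_mou V \<Longrightarrow> minv V (scaleC c x) = scaleC (cnj c) (minv V x)"
  using is_mou_facts(2) by blast

lemma mou_inv_inv:
  "is_mou V \<Longrightarrow> minv V (minv V x) = x"
  using is_mou_facts(3) by blast

lemma mou_self_adjoint: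
  "is_mou V \<Longrightarrow> a \<in> mpos V n \<Longrightarrow> mstar V a = a"
  using is_mou_facts(4) by blast

lemma mou_zero:
  "is_mou V \<Longrightarrow> (\<lambda>i j. 0) \<in> mpos V n"
  using is_mou_facts(5) by blast

lemma mou_add:
  "is_mou V \<Longrightarrow> a \<in> mpos V n \<Longrightarrow> b \<in> mpos V n \<Longrightarrow> (\<lambda>i j. a i j + b i j) \<in> mpos V n"
  using is_mou_facts(6) by blast

lemma mou_scale:
  "is_mou V \<Longrightarrow> a \<in> mpos V n \<Longrightarrow> 0 \<le> t \<Longrightarrow>
    (\<lambda>i j. scaleC (complex_of_real t) (a i j)) \<in> mpos V n"
  using is_mou_facts(7) by blast

lemma mou_pos_conj:
  "is_mou V \<Longrightarrow> a \<in> mpos V n \<Longrightarrow> conj_by n m \<gamma> a \<in> mpos V m"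
  using is_mou_facts(8) by blast

lemma mou_proper:
  "is_mou V \<Longrightarrow> as_mat1 x \<in> mpos V 1 \<Longrightarrow> as_mat1 (- x) \<in> mpos V 1 \<Longrightarrow> x = 0"
  using is_mou_facts(9) by blast

lemma mou_inv_unit:
  "is_mou V \<Longrightarrow> minv V (munit V) = munit V"
  using is_mou_facts(10) by blast

lemma mou_order_unit:
  "is_mou V \<Longrightarrow> minv V x = x \<Longrightarrow>
    \<exists>t. as_mat1 (scaleC (complex_of_real t) (munit V) - x) \<in> mpos V 1"
  using is_mou_facts(11) by blast

lemma mou_add1:
  assumes "is_mou V" "as_mat1 x \<in> mpos V 1" "as_mat1 y \<in> mpos V 1"
  shows "as_mat1 (x + y) \<in> mpos V 1"
proof -
  have "(\<lambda>i j. as_mat1 x i j + as_mat1 y i j) = as_mat1 (x + y)"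
    by (auto simp: as_mat1_def fun_eq_iff)
  with mou_add[OF assms] show ?thesis by simp
qed

lemma mou_scale1:
  assumes "is_mou V" "as_mat1 x \<in> mpos V 1" "0 \<le> t"
  shows "as_mat1 (scaleC (complex_of_real t) x) \<in> mpos V 1"
proof -
  have "(\<lambda>i j. scaleC (complex_of_real t) (as_mat1 x i j)) = as_mat1 (scaleC (complex_of_real t) x)"
    by (auto simp: as_mat1_def fun_eq_iff)
  with mou_scale[OF assms] show ?thesis by simp
qed

lemma mou_zero1: "is_mou V \<Longrightarrow> as_mat1 0 \<in> mpos V 1"
  using mou_zero[of V 1] by (simp add: as_mat1_def)

lemma conj_by_column:
  "conj_by r 1 (\<lambda>p k. \<xi> p) a = as_mat1 (\<Sum>p<r. \<Sum>q<r. scaleC (cnj (\<xi> p) * \<xi> q) (a p q))"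
  by (auto simp: conj_by_def sandw_def as_mat1_def fun_eq_iff)

text \<open>Positivity on V alone makes a functional completely positive: compressing a by the
  column \<xi> gives a positive element of V whose value under h is the quadratic form at
  \<xi>.\<close>

lemma state_cpsd:
  assumes "is_mou V" "is_state V h" "a \<in> mpos V r"
  shows "cpsd r (\<lambda>p q. h (a p q))"
  unfolding cpsd_iff
proof (intro allI)
  fix \<xi>
  let ?s = "\<Sum>p<r. \<Sum>q<r. scaleC (cnj (\<xi> p) * \<xi> q) (a p q)"
  have "as_mat1 ?s \<in> mpos V 1"
    using mou_pos_conj[OF assms(1,3), of 1 "\<lambda>p k. \<xi> p"] by (simp only: conj_by_column)
  then have "Im (h ?s) = 0 \<and> 0 \<le> Re (h ?s)" by (rule state_pos[OF assms(2)])
  moreover have "h ?s = sform r (\<lambda>p q. h (a p q)) \<xi> \<xi>"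
    unfolding sform_def
    by (simp add: state_sum[OF assms(2)] state_scale[OF assms(2)] ac_simps)
  ultimately show "Im (sform r (\<lambda>p q. h (a p q)) \<xi> \<xi>) = 0 \<and> 0 \<le> Re (sform r (\<lambda>p q. h (a p q)) \<xi> \<xi>)"
    by (simp only:)
qed

lemma state_tensor_mlin: "is_state V h \<Longrightarrow> mlin (state_tensor n h R)"
  by (auto simp: mlin_def state_tensor_def is_state_def algebra_simps)

lemma state_tensor_cpsd:
  assumes "is_mou V" "is_state V h" "a \<in> mpos V r"
    and herm: "\<And>i j. i < n \<Longrightarrow> j < n \<Longrightarrow> R j i = cnj (R i j)"
    and small: "\<And>i j. i < n \<Longrightarrow> j < n \<Longrightarrow> real n * cmod (R i j) \<le> 1"
  shows "cpsd (r * n) (ampl n (state_tensor n h R) a)"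
proof (cases "n = 0")
  case False
  then have "ampl n (state_tensor n h R) a = (\<lambda>I J. h (a (I div n) (J div n)) *
      ((if I mod n = J mod n then 1 else 0) - R (I mod n) (J mod n)))"
    by (auto simp: ampl_def state_tensor_def fun_eq_iff)
  with cpsd_kron[OF state_cpsd[OF assms(1-3)] herm small] show ?thesis by simp
qed (simp add: cpsd_def)

lemma state_tensor_CS:
  assumes "is_mou V" "is_state V h"
  shows "state_tensor n h (\<lambda>i j. 0) \<in> CS V n"
proof (rule CS_I)
  show "state_tensor n h (\<lambda>i j. 0) (munit V) i j = (if i < n \<and> i = j then 1 else 0)" for i j
    using assms(2) by (auto simp: state_tensor_def is_state_def)
  show "cpsd (r * n) (ampl n (state_tensor n h (\<lambda>i j. 0)) a)" if "a \<in> mpos V r" for r a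
    by (rule state_tensor_cpsd[OF assms that]) auto
qed (use assms in \<open>auto simp: state_tensor_mlin\<close>, auto simp: state_tensor_def)

lemma cpsd_as_mat1:
  assumes "cpsd (1 * n) (ampl n \<phi> (as_mat1 x))"
  shows "cpsd n (\<phi> x)"
proof -
  have "ampl n \<phi> (as_mat1 x) I J = \<phi> x I J" if "I < n" "J < n" for I J
    using that by (simp add: ampl_def as_mat1_def)
  with assms show ?thesis using cpsd_cong[of n "ampl n \<phi> (as_mat1 x)" "\<phi> x"] by simp
qed

lemma cpsd_entry00: "cpsd n A \<Longrightarrow> 1 \<le> n \<Longrightarrow> Im (A 0 0) = 0 \<and> 0 \<le> Re (A 0 0)"
  using sform_unit[of 0 n 0 A] unfolding cpsd_iff by (metis less_eq_Suc_le One_nat_def)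

lemma CS_state:
  assumes "\<phi> \<in> CS V n" "1 \<le> n"
  shows "is_state V (\<lambda>x. \<phi> x 0 0)"
  using CS_mlin[OF assms(1)] CS_unit[OF assms(1), of 0 0] assms(2)
    cpsd_entry00[OF cpsd_as_mat1[OF CS_pos[OF assms(1)]] assms(2)]
  by (auto simp: is_state_def mlin_def)

text \<open>Corner entries of unital completely positive maps are states, and a state h gives h
  tensor 1. Hence emptiness of the state spaces does not depend on the level n \<ge> 1.\<close>

lemma CS_nonempty_iff:
  assumes "is_mou V" "1 \<le> n"
  shows "CS V n \<noteq> {} \<longleftrightarrow> (\<exists>h. is_state V h)"
  using CS_state[OF _ assms(2)] state_tensor_CS[OF assms(1)] by blast

text \<open>The axioms only ask for a real multiple of the unit above each self-adjoint element, so
  the unit may be negative, or all cones may be zero (and then the space is one-dimensional).\<close>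

lemma mou_unit_cases:
  assumes V: "is_mou V"
  obtains "as_mat1 (munit V) \<in> mpos V 1" | "as_mat1 (- munit V) \<in> mpos V 1"
    | "\<And>x. as_mat1 x \<in> mpos V 1 \<Longrightarrow> x = 0" "\<And>x. \<exists>c. x = scaleC c (munit V)" "munit V \<noteq> 0"
proof (cases "as_mat1 (munit V) \<in> mpos V 1 \<or> as_mat1 (- munit V) \<in> mpos V 1")
  case True
  then show thesis using that(1,2) by blast
next
  case False
  let ?e = "munit V"
  \<comment> \<open>Dividing by |t| would put the unit or its negative into the cone.\<close>
  have t0: "t = 0" if t: "as_mat1 (scaleC (complex_of_real t) ?e) \<in> mpos V 1" for t
  proof (rule ccontr)
    assume "t \<noteq> 0"
    have "as_mat1 (scaleC (complex_of_real (1 / \<bar>t\<bar>)) (scaleC (complex_of_real t) ?e)) \<in> mpos V 1"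
      by (rule mou_scale1[OF V t]) simp
    then have "as_mat1 (scaleC (complex_of_real (t / \<bar>t\<bar>)) ?e) \<in> mpos V 1"
      by (simp add: scaleC_scaleC)
    moreover have "complex_of_real (t / \<bar>t\<bar>) = 1 \<or> complex_of_real (t / \<bar>t\<bar>) = - 1"
      using \<open>t \<noteq> 0\<close> by (auto simp: abs_if)
    ultimately show False
      using False by (metis scaleC_one scaleC_minus_one)
  qed
  \<comment> \<open>Adding x to the positive element t 1 - x makes t 1 positive, hence t = 0; then x
    and -x are both positive.\<close>
  have P0: "x = 0" if x: "as_mat1 x \<in> mpos V 1" for x
  proof -
    have "mstar V (as_mat1 x) 0 0 = as_mat1 x 0 0" using mou_self_adjoint[OF V x] by simp
    then have "minv V x = x" by (simp add: mstar_def as_mat1_def)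
    then obtain t where t: "as_mat1 (scaleC (complex_of_real t) ?e - x) \<in> mpos V 1"
      using mou_order_unit[OF V] by blast
    then have "as_mat1 (scaleC (complex_of_real t) ?e) \<in> mpos V 1"
      using mou_add1[OF V t x] by simp
    then have "t = 0" by (rule t0)
    with t have "as_mat1 (- x) \<in> mpos V 1" by simp
    with x show ?thesis by (rule mou_proper[OF V])
  qed
  have sa: "\<exists>t. x = scaleC (complex_of_real t) ?e" if "minv V x = x" for x
    using mou_order_unit[OF V that] P0 by fastforce
  \<comment> \<open>The real and imaginary parts of x are self-adjoint, hence real multiples of the
    unit.\<close>
  have span: "\<exists>c. x = scaleC c ?e" for x
  proof -
    have "minv V (x + minv V x) = x + minv V x"
      using V by (simp add: mou_inv_add mou_inv_inv add.commute)
    then obtain t where t: "x + minv V x = scaleC (complex_of_real t) ?e" using sa by blast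
    have "minv V (scaleC \<i> x + scaleC (- \<i>) (minv V x)) = scaleC \<i> x + scaleC (- \<i>) (minv V x)"
      using V by (simp add: mou_inv_add mou_inv_inv mou_inv_scale add.commute)
    then obtain t' where t': "scaleC \<i> x + scaleC (- \<i>) (minv V x) = scaleC (complex_of_real t') ?e"
      using sa by blast
    have "scaleC (1/2) (x + minv V x) + scaleC (- \<i> / 2) (scaleC \<i> x + scaleC (- \<i>) (minv V x))
        = scaleC (1/2 + 1/2) x + scaleC (1/2 + - (1/2)) (minv V x)"
      unfolding scaleC_add_right scaleC_scaleC scaleC_add_left by (simp add: algebra_simps)
    also have "\<dots> = x" by (simp add: scaleC_one)
    finally have "x = scaleC (complex_of_real t / 2 - \<i> * complex_of_real t' / 2) ?e"
      unfolding t t' by (simp add: scaleC_scaleC scaleC_add_left[symmetric])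
    then show ?thesis by blast
  qed
  have "?e \<noteq> 0" using False mou_zero1[OF V] by auto
  with P0 span show thesis by (rule that(3))
qed

text \<open>A positive -1 would contradict h(1) = 1. This leaves a positive unit, or zero cones on a
  space spanned by the unit.\<close>

lemma state_unit_cases:
  assumes "is_mou V" "is_state V h"
  obtains "as_mat1 (munit V) \<in> mpos V 1" | "\<And>x. x = scaleC (h x) (munit V)"
  using assms(1)
proof (cases rule: mou_unit_cases)
  case 2
  have "h (- munit V) = - 1"
    using assms(2) unfolding is_state_def by (metis scaleC_minus_one mult_minus1)
  with 2 assms(2) show ?thesis by (force simp: is_state_def)
next
  case 3
  have "x = scaleC (h x) (munit V)" for x
    using 3(2)[of x] assms(2) by (auto simp: is_state_def)
  then show ?thesis by (rule that(2))
qed (rule that(1))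

text \<open>At the unit the two terms add up to the identity matrix. Complete positivity rests on
  \<open>cpsd_kron\<close>, which needs \<sigma>(1) to be hermitian; this holds if 1 is positive.
  Otherwise the space is spanned by 1, \<sigma> equals h tensor \<sigma>(1), and the sum collapses
  to h tensor 1.\<close>

lemma state_perturb_CS:
  assumes V: "is_mou V" and h: "is_state V h" and "mlin \<sigma>"
    and supp: "\<And>x i j. \<not> (i < n \<and> j < n) \<Longrightarrow> \<sigma> x i j = 0"
    and pos: "\<And>r a. a \<in> mpos V r \<Longrightarrow> cpsd (r * n) (ampl n \<sigma> a)"
    and t: "0 < t" "\<And>i j. i < n \<Longrightarrow> j < n \<Longrightarrow> real n * cmod (\<sigma> (munit V) i j) \<le> t"
  shows "(\<lambda>x i j. \<sigma> x i j * complex_of_real (1 / t)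
    + state_tensor n h (\<lambda>i j. \<sigma> (munit V) i j * complex_of_real (1 / t)) x i j) \<in> CS V n"
    (is "?\<Psi> \<in> _")
  using V h
proof (cases rule: state_unit_cases)
  case 1
  let ?R = "\<lambda>i j. \<sigma> (munit V) i j * complex_of_real (1 / t)"
  have herm: "\<sigma> (munit V) j i = cnj (\<sigma> (munit V) i j)" if "i < n" "j < n" for i j
    using cpsd_hermitian[OF cpsd_as_mat1[OF pos[OF 1]],
        of "\<lambda>k. if k = j then 1 else 0" "\<lambda>k. if k = i then 1 else 0"] that
    by (simp only: sform_unit)
  show ?thesis
  proof (rule CS_I)
    show "mlin ?\<Psi>" by (rule mlin_lincomb[OF \<open>mlin \<sigma>\<close> state_tensor_mlin[OF h]])
    show "?\<Psi> x i j = 0" if "\<not> (i < n \<and> j < n)" for x i j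
      using that by (simp only: supp[OF that]) (auto simp: state_tensor_def)
    have "h (munit V) = 1" using h by (simp add: is_state_def)
    then show "?\<Psi> (munit V) i j = (if i < n \<and> i = j then 1 else 0)" for i j
      using supp[of i j] by (auto simp: state_tensor_def)
  next
    fix r a assume a: "a \<in> mpos V r"
    have "cpsd (r * n) (\<lambda>I J. ampl n \<sigma> a I J * complex_of_real (1 / t) + ampl n (state_tensor n h ?R) a I J)"
    proof (intro cpsd_add cpsd_scale pos a state_tensor_cpsd[OF V h])
      show "real n * cmod (?R i j) \<le> 1" if "i < n" "j < n" for i j
        using t(1) t(2)[OF that] by (simp add: norm_mult norm_divide field_simps)
      show "?R j i = cnj (?R i j)" if "i < n" "j < n" for i j
        using herm[OF that] by simp
    qed (use t in auto)
    then show "cpsd (r * n) (ampl n ?\<Psi> a)" by (simp add: ampl_def)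
  qed
next
  case 2
  have \<sigma>: "\<sigma> x i j = h x * \<sigma> (munit V) i j" for x i j
  proof -
    have "\<sigma> (scaleC (h x) (munit V)) i j = h x * \<sigma> (munit V) i j"
      using \<open>mlin \<sigma>\<close> unfolding mlin_def by blast
    then show ?thesis by (simp only: 2[of x, symmetric])
  qed
  have "?\<Psi> x i j = state_tensor n h (\<lambda>i j. 0) x i j" for x i j
    using \<sigma>[of x i j] supp[of i j x] by (cases "i < n \<and> j < n") (auto simp: state_tensor_def algebra_simps)
  then have "?\<Psi> = state_tensor n h (\<lambda>i j. 0)" by (intro ext)
  then show ?thesis using state_tensor_CS[OF V h] by simp
qed

subsection \<open>Matrix Lip-norms\<close>

lemma qm_mat_add: "a \<in> qm_mat n \<Longrightarrow> b \<in> qm_mat n \<Longrightarrow> (\<lambda>i j. a i j + b i j) \<in> qm_mat n"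
  for a b :: "nat \<Rightarrow> nat \<Rightarrow> 'v::complex_vector"
  by (simp add: qm_mat_def)

lemma qm_mat_scale: "a \<in> qm_mat n \<Longrightarrow> (\<lambda>i j. scaleC c (a i j)) \<in> qm_mat n"
  for a :: "nat \<Rightarrow> nat \<Rightarrow> 'v::complex_vector"
  by (simp add: qm_mat_def)

lemma qm_mat_zero: "(\<lambda>i j. 0) \<in> qm_mat n"
  by (simp add: qm_mat_def)

lemma qm_mat_sandw: "sandw n m \<alpha> v \<beta> \<in> qm_mat n"
  by (simp add: qm_mat_def sandw_def)

lemma qm_mat_mdsum: "mdsum m n v w \<in> qm_mat (m + n)"
  by (auto simp: qm_mat_def mdsum_def)

lemma qm_mat_as_mat1: "as_mat1 x \<in> qm_mat 1"
  by (simp add: qm_mat_def as_mat1_def)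

lemma lip_seminorm_facts:
  assumes "matrix_lip_seminorm V L"
  shows "\<forall>n. \<forall>a \<in> qm_mat n. \<forall>b \<in> qm_mat n. L n (\<lambda>i j. a i j + b i j) \<le> L n a + L n b"
    "\<forall>n c. \<forall>a \<in> qm_mat n. L n (\<lambda>i j. scaleC c (a i j)) = cmod c * L n a"
    "\<forall>n. \<forall>a \<in> qm_mat n. L n a = 0 \<longleftrightarrow>
         (\<forall>i<n. \<forall>j<n. \<exists>c. a i j = scaleC c (munit V))"
    "\<forall>m n. \<forall>v \<in> qm_mat m. \<forall>w \<in> qm_mat n. L (m + n) (mdsum m n v w) = max (L m v) (L n w)"
    "\<forall>m n \<alpha> \<beta>. \<forall>v \<in> qm_mat m.
         L n (sandw n m \<alpha> v \<beta>) \<le> cmat_norm n m \<alpha> * L m v * cmat_norm m n \<beta>"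
    "\<forall>m. \<forall>v \<in> qm_mat m. L m (mstar V v) = L m v"
  using assms unfolding matrix_lip_seminorm_def by - (elim conjE, assumption)+

lemma lip_add:
  "matrix_lip_seminorm V L \<Longrightarrow> a \<in> qm_mat n \<Longrightarrow> b \<in> qm_mat n \<Longrightarrow>
    L n (\<lambda>i j. a i j + b i j) \<le> L n a + L n b"
  using lip_seminorm_facts(1) by blast

lemma lip_scale:
  "matrix_lip_seminorm V L \<Longrightarrow> a \<in> qm_mat n \<Longrightarrow> L n (\<lambda>i j. scaleC c (a i j)) = cmod c * L n a"
  using lip_seminorm_facts(2) by blast

lemma lip_null:
  "matrix_lip_seminorm V L \<Longrightarrow> a \<in> qm_mat n \<Longrightarrow>
    L n a = 0 \<longleftrightarrow> (\<forall>i<n. \<forall>j<n. \<exists>c. a i j = scaleC c (munit V))"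
  using lip_seminorm_facts(3) by blast

lemma lip_mdsum:
  "matrix_lip_seminorm V L \<Longrightarrow> v \<in> qm_mat m \<Longrightarrow> w \<in> qm_mat n \<Longrightarrow>
    L (m + n) (mdsum m n v w) = max (L m v) (L n w)"
  using lip_seminorm_facts(4) by blast

lemma lip_sandw:
  "matrix_lip_seminorm V L \<Longrightarrow> v \<in> qm_mat m \<Longrightarrow>
    L n (sandw n m \<alpha> v \<beta>) \<le> cmat_norm n m \<alpha> * L m v * cmat_norm m n \<beta>"
  using lip_seminorm_facts(5) by blast

lemma lip_star: "matrix_lip_seminorm V L \<Longrightarrow> v \<in> qm_mat m \<Longrightarrow> L m (mstar V v) = L m v"
  using lip_seminorm_facts(6) by blast

lemma lip_nonneg:
  assumes "matrix_lip_seminorm V L" "a \<in> qm_mat n"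
  shows "0 \<le> L n a"
proof -
  have z: "L n (\<lambda>i j. 0) = 0"
    using lip_scale[OF assms, of 0] by simp
  have "L n (\<lambda>i j. a i j + scaleC (- 1) (a i j)) \<le> L n a + L n (\<lambda>i j. scaleC (- 1) (a i j))"
    by (rule lip_add[OF assms qm_mat_scale[OF assms(2)]])
  moreover have "L n (\<lambda>i j. scaleC (- 1) (a i j)) = L n a"
    using lip_scale[OF assms, of "- 1"] by simp
  moreover have "(\<lambda>i j. a i j + scaleC (- 1) (a i j)) = (\<lambda>i j. 0)"
    by (simp add: scaleC_minus_one)
  ultimately show ?thesis using z by simp
qed

section \<open>The distances \<open>DL\<close> and what they control\<close>

definition mdiff :: "('v \<Rightarrow> nat \<Rightarrow> nat \<Rightarrow> complex) \<Rightarrow> ('v \<Rightarrow> nat \<Rightarrow> nat \<Rightarrow> complex) \<Rightarrow>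
    'v \<Rightarrow> nat \<Rightarrow> nat \<Rightarrow> complex" where
  "mdiff \<phi> \<psi> = (\<lambda>x i j. \<phi> x i j - \<psi> x i j)"

lemma DL_alt:
  "DL n L \<phi> \<psi> = (SUP ra \<in> {(r, a). a \<in> qm_mat r \<and> L r a \<le> 1}.
      ereal (cmat_norm (fst ra * n) (fst ra * n) (ampl n (mdiff \<phi> \<psi>) (snd ra))))"
  by (simp add: DL_def mdiff_def ampl_def)

lemma DL_leI:
  assumes "\<And>r a. a \<in> qm_mat r \<Longrightarrow> L r a \<le> 1 \<Longrightarrow>
      ereal (cmat_norm (r * n) (r * n) (ampl n (mdiff \<phi> \<psi>) a)) \<le> d"
  shows "DL n L \<phi> \<psi> \<le> d"
  unfolding DL_alt by (rule SUP_least) (auto intro: assms)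

lemma DL_ge:
  assumes "a \<in> qm_mat r" "L r a \<le> 1"
  shows "ereal (cmat_norm (r * n) (r * n) (ampl n (mdiff \<phi> \<psi>) a)) \<le> DL n L \<phi> \<psi>"
  unfolding DL_alt
  using SUP_upper[of "(r, a)" "{(r, a). a \<in> qm_mat r \<and> L r a \<le> 1}"
      "\<lambda>ra. ereal (cmat_norm (fst ra * n) (fst ra * n) (ampl n (mdiff \<phi> \<psi>) (snd ra)))"] assms
  by simp

lemma DL_nonneg:
  assumes "matrix_lip_seminorm V L"
  shows "0 \<le> DL n L \<phi> \<psi>"
proof -
  \<comment> \<open>Over an empty index set the supremum in \<open>ereal\<close> would be minus
    infinity; the 0 x 0 matrix rules this out.\<close>
  have "L 0 (\<lambda>i j. 0) \<le> 1"
    using lip_scale[OF assms qm_mat_zero, of 0 0] by simp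
  from DL_ge[of "\<lambda>i j. 0" 0 L n \<phi> \<psi>, OF qm_mat_zero this] show ?thesis
    by (rule order_trans[rotated]) simp
qed

lemma DL_refl: "DL n L \<phi> \<phi> \<le> 0"
proof (rule DL_leI)
  fix r a
  have "cmat_norm (r * n) (r * n) (ampl n (mdiff \<phi> \<phi>) a)
    = cmat_norm (r * n) (r * n) (\<lambda>i j. 0 * ampl n \<phi> a i j)"
    by (rule cmat_norm_cong) (simp add: ampl_def mdiff_def)
  then show "ereal (cmat_norm (r * n) (r * n) (ampl n (mdiff \<phi> \<phi>) a)) \<le> 0"
    unfolding cmat_norm_scale by simp
qed

lemma DL_triangle: "DL n L \<phi> \<omega> \<le> DL n L \<phi> \<psi> + DL n L \<psi> \<omega>"
proof (rule DL_leI)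
  fix r a assume a: "a \<in> qm_mat r" "L r a \<le> 1"
  have "ampl n (mdiff \<phi> \<omega>) a = (\<lambda>I J. ampl n (mdiff \<phi> \<psi>) a I J + ampl n (mdiff \<psi> \<omega>) a I J)"
    by (simp add: ampl_def mdiff_def)
  then have "ereal (cmat_norm (r * n) (r * n) (ampl n (mdiff \<phi> \<omega>) a))
    \<le> ereal (cmat_norm (r * n) (r * n) (ampl n (mdiff \<phi> \<psi>) a))
      + ereal (cmat_norm (r * n) (r * n) (ampl n (mdiff \<psi> \<omega>) a))"
    using cmat_norm_triangle[of "r * n" "r * n" "ampl n (mdiff \<phi> \<psi>) a" "ampl n (mdiff \<psi> \<omega>) a"]
    by simp
  also have "\<dots> \<le> DL n L \<phi> \<psi> + DL n L \<psi> \<omega>"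
    by (intro add_mono DL_ge a)
  finally show "ereal (cmat_norm (r * n) (r * n) (ampl n (mdiff \<phi> \<omega>) a))
    \<le> DL n L \<phi> \<psi> + DL n L \<psi> \<omega>" .
qed

lemma mdiff_mlin: "mlin \<phi> \<Longrightarrow> mlin \<psi> \<Longrightarrow> mlin (mdiff \<phi> \<psi>)"
  by (simp add: mlin_def mdiff_def algebra_simps)

lemma ampl_scale:
  assumes "mlin \<phi>"
  shows "ampl n \<phi> (\<lambda>i j. scaleC c (a i j)) = (\<lambda>I J. c * ampl n \<phi> a I J)"
  using assms by (simp add: ampl_def mlin_def)

text \<open>Rescaling by 1 / s moves a into the unit ball. The number s is kept apart from
  \<open>L r a\<close> so that elements of seminorm 0 are covered.\<close>

lemma DL_bound:
  assumes L: "matrix_lip_seminorm V L" and lin: "mlin \<phi>" "mlin \<psi>"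
    and a: "a \<in> qm_mat r" "L r a \<le> s" "0 < s" and d: "DL n L \<phi> \<psi> \<le> ereal d"
  shows "cmat_norm (r * n) (r * n) (ampl n (mdiff \<phi> \<psi>) a) \<le> s * d"
proof -
  define c where "c = complex_of_real (1 / s)"
  have c: "cmod c = 1 / s" unfolding c_def norm_of_real using a(3) by simp
  let ?b = "\<lambda>i j. scaleC c (a i j)"
  have "L r ?b = 1 / s * L r a" using lip_scale[OF L a(1), of c] c by simp
  also have "\<dots> \<le> 1" using a(2,3) by simp
  finally have "ereal (cmat_norm (r * n) (r * n) (ampl n (mdiff \<phi> \<psi>) ?b)) \<le> ereal d"
    using order_trans[OF DL_ge[OF qm_mat_scale[OF a(1)]] d] by blast
  then have "1 / s * cmat_norm (r * n) (r * n) (ampl n (mdiff \<phi> \<psi>) a) \<le> d"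
    by (simp only: ampl_scale[OF mdiff_mlin[OF lin]] cmat_norm_scale c ereal_less_eq)
  then show ?thesis using a(3) by (simp add: field_simps)
qed

lemma ampl_as_mat1:
  assumes "i < n" "j < n"
  shows "ampl n \<phi> (as_mat1 x) i j = \<phi> x i j"
  using assms by (simp add: ampl_def as_mat1_def)

text \<open>This is why the \<open>DL\<close>-topology refines the BW-topology. The summand 1 keeps
  the scale positive where L vanishes.\<close>

lemma DL_entry_bound:
  assumes L: "matrix_lip_seminorm V L" and lin: "mlin \<phi>" "mlin \<psi>"
    and d: "DL n L \<phi> \<psi> \<le> ereal d" and ij: "i < n" "j < n"
  shows "cmod (\<phi> x i j - \<psi> x i j) \<le> (1 + L 1 (as_mat1 x)) * d"
proof -
  have "cmod (ampl n (mdiff \<phi> \<psi>) (as_mat1 x) i j)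
      \<le> cmat_norm (1 * n) (1 * n) (ampl n (mdiff \<phi> \<psi>) (as_mat1 x))"
    by (rule norm_le_cmat_norm) (use ij in auto)
  also have "\<dots> \<le> (1 + L 1 (as_mat1 x)) * d"
    using lip_nonneg[OF L qm_mat_as_mat1, of x]
    by (intro DL_bound[OF L lin qm_mat_as_mat1 _ _ d]) auto
  finally show ?thesis by (simp add: ampl_as_mat1[OF ij] mdiff_def)
qed

section \<open>The BW-topology against the topology of \<open>DL\<close>\<close>

lemma continuous_on_eval3:
  fixes f :: "'t::topological_space \<Rightarrow> 'v \<Rightarrow> nat \<Rightarrow> nat \<Rightarrow> complex"
  assumes "continuous_on S f"
  shows "continuous_on S (\<lambda>t. f t x i j)"
  by (rule continuous_on_product_then_coordinatewise[OF continuous_on_product_then_coordinatewise[OF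
        continuous_on_product_then_coordinatewise[OF assms]]])

lemma eventually_nhds_compose:
  assumes "continuous_on UNIV f" "eventually P (nhds (f x))"
  shows "eventually (\<lambda>y. P (f y)) (nhds x)"
proof -
  from assms(2) obtain S where S: "open S" "f x \<in> S" "\<And>y. y \<in> S \<Longrightarrow> P y"
    unfolding eventually_nhds by blast
  have "open (f -` S)" using assms(1) S(1) by (simp add: open_vimage)
  with S show ?thesis unfolding eventually_nhds by (intro exI[of _ "f -` S"]) auto
qed

lemma eventually_entry_close:
  fixes \<phi> :: "'v \<Rightarrow> nat \<Rightarrow> nat \<Rightarrow> complex"
  assumes "0 < e"
  shows "eventually (\<lambda>\<psi>. cmod (\<phi> x i j - \<psi> x i j) < e) (nhds \<phi>)"
proof -
  have "continuous_on UNIV (\<lambda>\<psi> :: 'v \<Rightarrow> nat \<Rightarrow> nat \<Rightarrow> complex. \<psi> x i j)"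
    by (rule continuous_on_eval3[OF continuous_on_id])
  moreover have "eventually (\<lambda>z. cmod (\<phi> x i j - z) < e) (nhds (\<phi> x i j))"
    unfolding eventually_nhds_metric using assms by (auto simp: dist_norm norm_minus_commute)
  ultimately show ?thesis
    by (rule eventually_nhds_compose[of "\<lambda>\<psi>. \<psi> x i j" "\<lambda>z. cmod (\<phi> x i j - z) < e"])
qed

lemma tendsto_coordinatewise:
  fixes f :: "'t \<Rightarrow> 'i \<Rightarrow> 'b::topological_space"
  assumes "\<And>i. ((\<lambda>k. f k i) \<longlongrightarrow> l i) F"
  shows "(f \<longlongrightarrow> l) F"
proof -
  have "limitin (product_topology (\<lambda>i. euclidean) UNIV) f l F"
    unfolding limitin_componentwise using assms by (simp add: PiE_UNIV_domain)
  then show ?thesis by (simp add: euclidean_product_topology)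
qed

lemma eventually_in_open_of_pointwise:
  fixes T :: "('v \<Rightarrow> nat \<Rightarrow> nat \<Rightarrow> complex) set"
  assumes "open T" "\<phi> \<in> T"
    and conv: "\<And>x i j. (\<lambda>k. \<psi> k x i j) \<longlonglongrightarrow> \<phi> x i j"
  shows "eventually (\<lambda>k. \<psi> k \<in> T) sequentially"
proof -
  have "(\<lambda>k. \<psi> k) \<longlonglongrightarrow> \<phi>"
    by (rule tendsto_coordinatewise, rule tendsto_coordinatewise, rule tendsto_coordinatewise, rule conv)
  with assms(1,2) show ?thesis by (simp add: tendsto_def)
qed

lemma tendsto_inverse_bound:
  fixes f :: "nat \<Rightarrow> complex"
  assumes "\<And>k. cmod (f k - l) \<le> C * inverse (real (Suc k))"
  shows "f \<longlonglongrightarrow> l"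
proof -
  have "(\<lambda>k. C * inverse (real (Suc k))) \<longlonglongrightarrow> C * 0"
    by (rule tendsto_mult_left, rule LIMSEQ_inverse_real_of_nat)
  then have "(\<lambda>k. C * inverse (real (Suc k))) \<longlonglongrightarrow> 0" by simp
  with always_eventually[OF allI[OF assms]] have "(\<lambda>k. f k - l) \<longlonglongrightarrow> 0"
    by (rule Lim_null_comparison)
  then show ?thesis by (simp only: LIM_zero_iff)
qed

lemma lip_norm_topology:
  assumes "matrix_lip_norm V L" "1 \<le> n" "U \<subseteq> CS V n"
  shows "openin (top_of_set (CS V n)) U \<longleftrightarrow>
    (\<forall>\<phi> \<in> U. \<exists>e>0. \<forall>\<psi> \<in> CS V n. DL n L \<phi> \<psi> < ereal e \<longrightarrow> \<psi> \<in> U)"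
proof -
  have "\<forall>n\<ge>1. \<forall>U\<subseteq>CS V n. openin (top_of_set (CS V n)) U \<longleftrightarrow>
    (\<forall>\<phi> \<in> U. \<exists>e>0. \<forall>\<psi> \<in> CS V n. DL n L \<phi> \<psi> < ereal e \<longrightarrow> \<psi> \<in> U)"
    using assms(1) unfolding matrix_lip_norm_def by (rule conjunct2)
  then show ?thesis using assms(2,3) by (elim allE impE)
qed

text \<open>BW-open sets are open for \<open>DL\<close> already by \<open>DL_entry_bound\<close>.
  What a matrix Lip-norm adds to a seminorm is that \<open>DL\<close>-balls around \<phi> are
  BW-neighbourhoods of \<phi>.\<close>

lemma lip_norm_iff:
  "matrix_lip_norm V L \<longleftrightarrow> matrix_lip_seminorm V L \<and>
    (\<forall>n\<ge>1. \<forall>\<phi>\<in>CS V n. \<forall>e>0. eventually (\<lambda>\<psi>. \<psi> \<in> CS V n \<longrightarrow> DL n L \<phi> \<psi> < ereal e) (nhds \<phi>))"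
  (is "_ \<longleftrightarrow> _ \<and> ?C")
proof safe
  assume A: "matrix_lip_norm V L"
  then show L: "matrix_lip_seminorm V L" by (simp add: matrix_lip_norm_def)
  fix n :: nat and \<phi> and e :: real
  assume n: "1 \<le> n" and \<phi>: "\<phi> \<in> CS V n" and e: "0 < e"
  let ?U = "{\<psi> \<in> CS V n. DL n L \<phi> \<psi> < ereal e}"
  \<comment> \<open>By the triangle inequality the ball is open for \<open>DL\<close>, so the
    hypothesis makes it BW-open.\<close>
  have "\<exists>d>0. \<forall>\<omega>\<in>CS V n. DL n L \<psi> \<omega> < ereal d \<longrightarrow> \<omega> \<in> ?U" if \<psi>: "\<psi> \<in> ?U" for \<psi>
  proof -
    from \<psi> DL_nonneg[OF L, of n \<phi> \<psi>] obtain d where d: "DL n L \<phi> \<psi> = ereal d" "d < e"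
      by (cases "DL n L \<phi> \<psi>") auto
    show ?thesis
    proof (intro exI[of _ "e - d"] conjI ballI impI)
      fix \<omega> assume \<omega>: "\<omega> \<in> CS V n" "DL n L \<psi> \<omega> < ereal (e - d)"
      have "DL n L \<phi> \<omega> \<le> ereal d + DL n L \<psi> \<omega>" using DL_triangle[of n L \<phi> \<omega> \<psi>] d by simp
      also have "\<dots> < ereal d + ereal (e - d)"
        using \<omega> DL_nonneg[OF L, of n \<psi> \<omega>] by (cases "DL n L \<psi> \<omega>") auto
      finally show "\<omega> \<in> ?U" using \<omega> by simp
    qed (use d in simp)
  qed
  then have "openin (top_of_set (CS V n)) ?U"
    by (subst lip_norm_topology[OF A n]) (blast, intro ballI)
  then obtain T where T: "open T" "?U = CS V n \<inter> T" unfolding openin_open by blast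
  have "\<phi> \<in> ?U" using \<phi> e DL_refl[of n L \<phi>] by (simp add: le_less_trans)
  with T show "eventually (\<lambda>\<psi>. \<psi> \<in> CS V n \<longrightarrow> DL n L \<phi> \<psi> < ereal e) (nhds \<phi>)"
    unfolding eventually_nhds by (intro exI[of _ T]) blast
next
  assume L: "matrix_lip_seminorm V L" and C: ?C
  show "matrix_lip_norm V L"
    unfolding matrix_lip_norm_def
  proof (intro conjI L allI impI iffI ballI)
    fix n :: nat and U \<phi>
    assume n: "1 \<le> n" and U: "U \<subseteq> CS V n" "openin (top_of_set (CS V n)) U" "\<phi> \<in> U"
    obtain T where T: "open T" "U = CS V n \<inter> T" using U(2) unfolding openin_open by blast
    show "\<exists>e>0. \<forall>\<psi>\<in>CS V n. DL n L \<phi> \<psi> < ereal e \<longrightarrow> \<psi> \<in> U"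
    \<comment> \<open>The entry bounds are not uniform in x, but a sequence with distances below 1 /
      (k + 1) converges at each x separately, which is convergence in the product topology.\<close>
    proof (rule ccontr)
      assume no: "\<not> ?thesis"
      have "\<exists>\<psi>. \<psi> \<in> CS V n \<and> DL n L \<phi> \<psi> < ereal (inverse (real (Suc k))) \<and> \<psi> \<notin> U" for k
      proof -
        have "0 < inverse (real (Suc k))" by simp
        with no show ?thesis by blast
      qed
      then obtain \<psi> where \<psi>: "\<And>k. \<psi> k \<in> CS V n"
        "\<And>k. DL n L \<phi> (\<psi> k) < ereal (inverse (real (Suc k)))" "\<And>k. \<psi> k \<notin> U" by metis
      have \<phi>: "\<phi> \<in> CS V n" using U by blast
      have "(\<lambda>k. \<psi> k x i j) \<longlonglongrightarrow> \<phi> x i j" for x i j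
      proof (cases "i < n \<and> j < n")
        case True
        show ?thesis
        proof (rule tendsto_inverse_bound)
          fix k
          have "cmod (\<phi> x i j - \<psi> k x i j) \<le> (1 + L 1 (as_mat1 x)) * inverse (real (Suc k))"
            using True
            by (intro DL_entry_bound[OF L CS_mlin[OF \<phi>] CS_mlin[OF \<psi>(1)] less_imp_le[OF \<psi>(2)]]) auto
          then show "cmod (\<psi> k x i j - \<phi> x i j) \<le> (1 + L 1 (as_mat1 x)) * inverse (real (Suc k))"
            by (simp only: norm_minus_commute)
        qed
      next
        case False
        then show ?thesis using CS_support[OF \<phi>] CS_support[OF \<psi>(1)] by simp
      qed
      then have "eventually (\<lambda>k. \<psi> k \<in> T) sequentially"
        using U T by (intro eventually_in_open_of_pointwise[of T \<phi>]) auto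
      then obtain k where "\<psi> k \<in> T" by (auto simp: eventually_sequentially)
      with \<psi> T show False by blast
    qed
  next
    fix n :: nat and U
    assume n: "1 \<le> n" and U: "U \<subseteq> CS V n"
      and D: "\<forall>\<phi>\<in>U. \<exists>e>0. \<forall>\<psi>\<in>CS V n. DL n L \<phi> \<psi> < ereal e \<longrightarrow> \<psi> \<in> U"
    show "openin (top_of_set (CS V n)) U"
    proof (subst openin_subopen, intro ballI)
      fix \<phi> assume "\<phi> \<in> U"
      with D obtain e where e: "e > 0" "\<And>\<psi>. \<psi> \<in> CS V n \<Longrightarrow> DL n L \<phi> \<psi> < ereal e \<Longrightarrow> \<psi> \<in> U" by blast
      have "eventually (\<lambda>\<psi>. \<psi> \<in> CS V n \<longrightarrow> DL n L \<phi> \<psi> < ereal e) (nhds \<phi>)"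
        using C[rule_format, OF n _ e(1)] U \<open>\<phi> \<in> U\<close> by blast
      then obtain S where "open S" "\<phi> \<in> S" "\<And>\<psi>. \<psi> \<in> S \<Longrightarrow> \<psi> \<in> CS V n \<Longrightarrow> DL n L \<phi> \<psi> < ereal e"
        unfolding eventually_nhds by blast
      with e U \<open>\<phi> \<in> U\<close> show "\<exists>T. openin (top_of_set (CS V n)) T \<and> \<phi> \<in> T \<and> T \<subseteq> U"
        by (intro exI[of _ "CS V n \<inter> S"]) (auto simp: openin_open)
    qed
  qed
qed

lemma lip_norm_seminorm: "matrix_lip_norm V L \<Longrightarrow> matrix_lip_seminorm V L"
  by (simp add: matrix_lip_norm_def)

lemma lip_norm_continuous:
  assumes "matrix_lip_norm V L" "1 \<le> n" "\<phi> \<in> CS V n" "0 < e"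
  shows "eventually (\<lambda>\<psi>. \<psi> \<in> CS V n \<longrightarrow> DL n L \<phi> \<psi> < ereal e) (nhds \<phi>)"
  by (rule lip_norm_iff[THEN iffD1, THEN conjunct2, rule_format, OF assms])

lemma CS_convex:
  assumes "\<phi> \<in> CS V n" "\<psi> \<in> CS V n" "0 \<le> t" "t \<le> 1"
  shows "(\<lambda>x i j. \<phi> x i j * complex_of_real (1 - t) + \<psi> x i j * complex_of_real t) \<in> CS V n"
    (is "?\<omega> \<in> _")
proof (rule CS_I)
  show "mlin ?\<omega>"
    using CS_mlin[OF assms(1)] CS_mlin[OF assms(2)] by (simp add: mlin_def algebra_simps)
  show "?\<omega> x i j = 0" if "\<not> (i < n \<and> j < n)" for x i j
    using CS_support[OF assms(1) that] CS_support[OF assms(2) that] by simp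
  show "?\<omega> (munit V) i j = (if i < n \<and> i = j then 1 else 0)" for i j
    unfolding CS_unit[OF assms(1)] CS_unit[OF assms(2)] by simp
  fix r a assume a: "a \<in> mpos V r"
  have "cpsd (r * n) (\<lambda>I J. ampl n \<phi> a I J * complex_of_real (1 - t) + ampl n \<psi> a I J * complex_of_real t)"
    using assms(3,4) by (intro cpsd_add cpsd_scale CS_pos[OF assms(1) a] CS_pos[OF assms(2) a]) auto
  then show "cpsd (r * n) (ampl n ?\<omega> a)" by (simp add: ampl_def)
qed

text \<open>Close to \<open>\<phi>\<close> on the segment towards \<open>\<psi>\<close> the distance from \<open>\<phi>\<close> is finite, and it
  scales linearly along the segment.\<close>

lemma DL_finite:
  assumes A: "matrix_lip_norm V L" and n: "1 \<le> n" and \<phi>: "\<phi> \<in> CS V n" and \<psi>: "\<psi> \<in> CS V n"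
  obtains d where "DL n L \<phi> \<psi> = ereal d" "0 \<le> d"
proof -
  have L: "matrix_lip_seminorm V L" using A by (rule lip_norm_seminorm)
  define g where "g = (\<lambda>t x i j. \<phi> x i j * complex_of_real (1 - t) + \<psi> x i j * complex_of_real t)"
  have "continuous_on UNIV g"
    unfolding g_def
    by (rule continuous_on_coordinatewise_then_product)+ (intro continuous_on_add continuous_on_mult
        continuous_on_const continuous_on_of_real continuous_on_diff continuous_on_id)
  moreover have g0: "g 0 = \<phi>" by (simp add: g_def)
  moreover have "eventually (\<lambda>\<omega>. \<omega> \<in> CS V n \<longrightarrow> DL n L \<phi> \<omega> < ereal 1) (nhds \<phi>)"
    by (rule lip_norm_continuous[OF A n \<phi> zero_less_one])
  ultimately have "eventually (\<lambda>t. g t \<in> CS V n \<longrightarrow> DL n L \<phi> (g t) < ereal 1) (nhds 0)"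
    using eventually_nhds_compose[of g "\<lambda>\<omega>. \<omega> \<in> CS V n \<longrightarrow> DL n L \<phi> \<omega> < ereal 1" 0] by simp
  then obtain e where e: "e > 0" "\<And>t. \<bar>t\<bar> < e \<Longrightarrow> g t \<in> CS V n \<Longrightarrow> DL n L \<phi> (g t) < ereal 1"
    unfolding eventually_nhds_metric by (auto simp: dist_real_def)
  \<comment> \<open>Inside the radius e, and at most 1 so that the convex combination stays in
    \<open>CS V n\<close>.\<close>
  define t where "t = min (e / 2) 1"
  have t: "0 < t" "t \<le> 1" "\<bar>t\<bar> < e" using e(1) by (auto simp: t_def min_def)
  have "g t \<in> CS V n" unfolding g_def using t by (intro CS_convex \<phi> \<psi>) auto
  then have lt: "DL n L \<phi> (g t) < ereal 1" using e t by blast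
  have "DL n L \<phi> \<psi> \<le> ereal (1 / t)"
  proof (rule DL_leI)
    fix r a assume a: "a \<in> qm_mat r" "L r a \<le> 1"
    have "ampl n (mdiff \<phi> (g t)) a = (\<lambda>I J. complex_of_real t * ampl n (mdiff \<phi> \<psi>) a I J)"
      by (simp add: ampl_def mdiff_def g_def fun_eq_iff algebra_simps)
    then have "ereal (t * cmat_norm (r * n) (r * n) (ampl n (mdiff \<phi> \<psi>) a)) \<le> DL n L \<phi> (g t)"
      using DL_ge[of a r L n \<phi> "g t"] a t by (simp add: cmat_norm_scale)
    with lt have "ereal (t * cmat_norm (r * n) (r * n) (ampl n (mdiff \<phi> \<psi>) a)) \<le> ereal 1"
      by (meson order.trans less_imp_le)
    then show "ereal (cmat_norm (r * n) (r * n) (ampl n (mdiff \<phi> \<psi>) a)) \<le> ereal (1 / t)"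
      using t by (simp add: field_simps)
  qed
  with DL_nonneg[OF L, of n \<phi> \<psi>] show thesis
    using that by (cases "DL n L \<phi> \<psi>") auto
qed

subsection \<open>Matrix Lip-norms on direct sums\<close>

text \<open>A completely positive map \<open>\<sigma>\<close> that need not be unital is scaled down and then made unital by
  adding \<open>h \<otimes> (1 - \<sigma>(e) / t)\<close> for a state \<open>h\<close>; for large \<open>t\<close> this stays completely positive.\<close>

definition pert :: "nat \<Rightarrow> ('v \<Rightarrow> complex) \<Rightarrow> real \<Rightarrow> 'v \<Rightarrow> ('v \<Rightarrow> nat \<Rightarrow> nat \<Rightarrow> complex) \<Rightarrow>
    'v \<Rightarrow> nat \<Rightarrow> nat \<Rightarrow> complex" where
  "pert n h t e \<sigma> = (\<lambda>x i j. \<sigma> x i j * complex_of_real (1 / t)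
     + state_tensor n h (\<lambda>i j. \<sigma> e i j * complex_of_real (1 / t)) x i j)"

lemma mlin_pert: "is_state V h \<Longrightarrow> mlin \<sigma> \<Longrightarrow> mlin (pert n h t e \<sigma>)"
  unfolding pert_def by (rule mlin_lincomb[OF _ state_tensor_mlin])

lemma pert_eq:
  assumes "0 < t" "i < n" "j < n"
  shows "complex_of_real t * pert n h t e \<sigma> x i j
    = \<sigma> x i j + h x * ((if i = j then complex_of_real t else 0) - \<sigma> e i j)"
  using assms by (simp add: pert_def state_tensor_def field_simps)

lemma continuous_on_pert:
  fixes g :: "'v \<Rightarrow> 'w"
  shows "continuous_on UNIV (\<lambda>\<phi> :: 'w \<Rightarrow> nat \<Rightarrow> nat \<Rightarrow> complex. pert n h t e (\<lambda>x. \<phi> (g x)))"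
proof (rule continuous_on_coordinatewise_then_product)+
  fix x i j
  have ev: "continuous_on UNIV (\<lambda>\<phi> :: 'w \<Rightarrow> nat \<Rightarrow> nat \<Rightarrow> complex. \<phi> y i j)" for y
    by (rule continuous_on_eval3[OF continuous_on_id])
  show "continuous_on UNIV (\<lambda>\<phi> :: 'w \<Rightarrow> nat \<Rightarrow> nat \<Rightarrow> complex. pert n h t e (\<lambda>x. \<phi> (g x)) x i j)"
  proof (cases "i < n \<and> j < n")
    case True
    then show ?thesis unfolding pert_def state_tensor_def if_P[OF True]
      by (intro continuous_on_add continuous_on_mult continuous_on_diff continuous_on_const ev)
  next
    case False
    then show ?thesis unfolding pert_def state_tensor_def if_not_P[OF False]
      by (intro continuous_on_add continuous_on_mult continuous_on_const ev)
  qed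
qed

text \<open>The summand 1 in the bound on t leaves room for every \<psi> whose entries at the unit
  are within 1 of those of \<phi>, so one t repairs \<phi> and its neighbours alike. BW-continuity
  of \<open>pert\<close> then carries the continuity of \<open>DL\<close> on V over to \<psi>. In
  the applications g embeds a summand.\<close>

lemma eventually_pert_close:
  fixes W :: "'w::complex_vector mou" and V :: "'v::complex_vector mou" and g :: "'v \<Rightarrow> 'w"
  assumes V: "is_mou V" and h: "is_state V h" and L: "matrix_lip_norm V L" and n: "1 \<le> n"
    and \<phi>: "\<phi> \<in> CS W n"
    and lin: "\<And>\<psi>. \<psi> \<in> CS W n \<Longrightarrow> mlin (\<lambda>x. \<psi> (g x))"
    and pos: "\<And>\<psi> r a. \<psi> \<in> CS W n \<Longrightarrow> a \<in> mpos V r \<Longrightarrow> cpsd (r * n) (ampl n (\<lambda>x. \<psi> (g x)) a)"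
    and t: "\<And>i j. i < n \<Longrightarrow> j < n \<Longrightarrow> real n * (cmod (\<phi> (g (munit V)) i j) + 1) \<le> t"
    and t0: "0 < t" and e: "0 < e"
  shows "eventually (\<lambda>\<psi>. \<psi> \<in> CS W n \<longrightarrow>
    DL n L (pert n h t (munit V) (\<lambda>x. \<phi> (g x))) (pert n h t (munit V) (\<lambda>x. \<psi> (g x))) < ereal e)
    (nhds \<phi>)"
proof -
  let ?P = "\<lambda>\<psi>. pert n h t (munit V) (\<lambda>x. \<psi> (g x))"
  have PCS: "?P \<psi> \<in> CS V n" if \<psi>: "\<psi> \<in> CS W n"
    and close: "\<forall>i\<in>{..<n}. \<forall>j\<in>{..<n}. cmod (\<phi> (g (munit V)) i j - \<psi> (g (munit V)) i j) < 1" for \<psi>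
    unfolding pert_def
  proof (rule state_perturb_CS[OF V h lin[OF \<psi>] _ pos[OF \<psi>] t0])
    show "\<psi> (g x) i j = 0" if "\<not> (i < n \<and> j < n)" for x i j
      using \<psi> that by (rule CS_support)
    fix i j assume ij: "i < n" "j < n"
    have "cmod (\<psi> (g (munit V)) i j) \<le> cmod (\<phi> (g (munit V)) i j)
        + cmod (\<phi> (g (munit V)) i j - \<psi> (g (munit V)) i j)"
      using norm_triangle_sub[of "\<psi> (g (munit V)) i j" "\<phi> (g (munit V)) i j"]
      by (simp add: norm_minus_commute)
    also have "\<dots> \<le> cmod (\<phi> (g (munit V)) i j) + 1"
      using close[THEN bspec, THEN bspec, of i j] ij by simp
    finally have "real n * cmod (\<psi> (g (munit V)) i j) \<le> real n * (cmod (\<phi> (g (munit V)) i j) + 1)"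
      by (rule mult_left_mono) simp
    then show "real n * cmod (\<psi> (g (munit V)) i j) \<le> t" using t[OF ij] by linarith
  qed
  have "?P \<phi> \<in> CS V n" by (rule PCS[OF \<phi>]) simp
  then have "eventually (\<lambda>\<psi>. \<psi> \<in> CS V n \<longrightarrow> DL n L (?P \<phi>) \<psi> < ereal e) (nhds (?P \<phi>))"
    by (rule lip_norm_continuous[OF L n _ e])
  then have 1: "eventually (\<lambda>\<psi>. ?P \<psi> \<in> CS V n \<longrightarrow> DL n L (?P \<phi>) (?P \<psi>) < ereal e) (nhds \<phi>)"
    by (rule eventually_nhds_compose[OF continuous_on_pert])
  have 2: "eventually (\<lambda>\<psi>. \<forall>i\<in>{..<n}. \<forall>j\<in>{..<n}.
      cmod (\<phi> (g (munit V)) i j - \<psi> (g (munit V)) i j) < 1) (nhds \<phi>)"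
    by (intro eventually_ball_finite ballI finite_lessThan eventually_entry_close) simp
  from 1 2 show ?thesis
    by eventually_elim (use PCS in blast)
qed

section \<open>Unital completely positive maps on a direct sum\<close>

lemma dsum_simps [simp]:
  "munit (mou_dsum V W) = (munit V, munit W)"
  "minv (mou_dsum V W) z = (minv V (fst z), minv W (snd z))"
  "a \<in> mpos (mou_dsum V W) n \<longleftrightarrow> (\<lambda>i j. fst (a i j)) \<in> mpos V n \<and> (\<lambda>i j. snd (a i j)) \<in> mpos W n"
  by (simp_all add: mou_dsum_def)

lemma scaleC_pair: "scaleC c (x, y) = (scaleC c x, scaleC c y)"
  by (simp add: scaleC_prod_def)

lemma mlin_pair_fst: "mlin \<phi> \<Longrightarrow> mlin (\<lambda>x. \<phi> (x, 0))"
  unfolding mlin_def by (metis add_Pair add.right_neutral scaleC_pair scaleC_zero_right)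

lemma mlin_pair_snd: "mlin \<phi> \<Longrightarrow> mlin (\<lambda>x. \<phi> (0, x))"
  unfolding mlin_def by (metis add_Pair add.right_neutral scaleC_pair scaleC_zero_right)

lemma mlin_pair_split:
  assumes "mlin \<phi>"
  shows "\<phi> (x, y) i j = \<phi> (x, 0) i j + \<phi> (0, y) i j"
proof -
  have "\<phi> ((x, 0) + (0, y)) i j = \<phi> (x, 0) i j + \<phi> (0, y) i j"
    using assms unfolding mlin_def by blast
  then show ?thesis by simp
qed

lemma mlin_fst: "mlin \<phi> \<Longrightarrow> mlin (\<phi> \<circ> fst)"
  by (simp add: mlin_def scaleC_prod_def)

lemma mlin_snd: "mlin \<phi> \<Longrightarrow> mlin (\<phi> \<circ> snd)"
  by (simp add: mlin_def scaleC_prod_def)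

lemma CS_pair_fst_pos:
  assumes "is_mou W" "\<phi> \<in> CS (mou_dsum V W) n" "a \<in> mpos V r"
  shows "cpsd (r * n) (ampl n (\<lambda>x. \<phi> (x, 0)) a)"
proof -
  have "(\<lambda>i j. (a i j, 0)) \<in> mpos (mou_dsum V W) r"
    using assms(3) mou_zero[OF assms(1)] by simp
  from CS_pos[OF assms(2) this] show ?thesis by (simp add: ampl_def)
qed

lemma CS_pair_snd_pos:
  assumes "is_mou V" "\<phi> \<in> CS (mou_dsum V W) n" "a \<in> mpos W r"
  shows "cpsd (r * n) (ampl n (\<lambda>x. \<phi> (0, x)) a)"
proof -
  have "(\<lambda>i j. (0, a i j)) \<in> mpos (mou_dsum V W) r"
    using assms(3) mou_zero[OF assms(1)] by simp
  from CS_pos[OF assms(2) this] show ?thesis by (simp add: ampl_def)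
qed

lemma CS_fst: "\<phi> \<in> CS V n \<Longrightarrow> \<phi> \<circ> fst \<in> CS (mou_dsum V W) n"
proof (rule CS_I)
  assume \<phi>: "\<phi> \<in> CS V n"
  show "mlin (\<phi> \<circ> fst)" using CS_mlin[OF \<phi>] by (rule mlin_fst)
  show "(\<phi> \<circ> fst) x i j = 0" if "\<not> (i < n \<and> j < n)" for x i j
    using CS_support[OF \<phi> that] by simp
  show "(\<phi> \<circ> fst) (munit (mou_dsum V W)) i j = (if i < n \<and> i = j then 1 else 0)" for i j
    using CS_unit[OF \<phi>] by simp
  fix r a assume "a \<in> mpos (mou_dsum V W) r"
  then show "cpsd (r * n) (ampl n (\<phi> \<circ> fst) a)"
    using CS_pos[OF \<phi>, of "\<lambda>i j. fst (a i j)" r] by (simp add: ampl_def)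
qed

lemma CS_snd: "\<phi> \<in> CS W n \<Longrightarrow> \<phi> \<circ> snd \<in> CS (mou_dsum V W) n"
proof (rule CS_I)
  assume \<phi>: "\<phi> \<in> CS W n"
  show "mlin (\<phi> \<circ> snd)" using CS_mlin[OF \<phi>] by (rule mlin_snd)
  show "(\<phi> \<circ> snd) x i j = 0" if "\<not> (i < n \<and> j < n)" for x i j
    using CS_support[OF \<phi> that] by simp
  show "(\<phi> \<circ> snd) (munit (mou_dsum V W)) i j = (if i < n \<and> i = j then 1 else 0)" for i j
    using CS_unit[OF \<phi>] by simp
  fix r a assume "a \<in> mpos (mou_dsum V W) r"
  then show "cpsd (r * n) (ampl n (\<phi> \<circ> snd) a)"
    using CS_pos[OF \<phi>, of "\<lambda>i j. snd (a i j)" r] by (simp add: ampl_def)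
qed

text \<open>Writing \<open>\<Delta>\<close> for a difference of two unital maps on the direct sum and \<open>e\<close> for the unit of
  the first summand,
  \<open>\<Delta>(x, z) = (\<Delta>(x, 0) - s(x) \<Delta>(e, 0)) + (\<Delta>(0, z) - u(z) \<Delta>(0, f)) + (s(x) - u(z)) \<Delta>(e, 0)\<close>,
  because \<open>\<Delta>(0, f) = - \<Delta>(e, 0)\<close> for the unit \<open>f\<close> of the second summand. The first two terms
  are multiples of differences of unital completely positive maps on the summands.\<close>

lemma dsum_diff_decomp:
  assumes \<phi>: "\<phi> \<in> CS (mou_dsum V W) n" and \<psi>: "\<psi> \<in> CS (mou_dsum V W) n"
    and t: "0 < t" and ij: "i < n" "j < n"
  shows "\<phi> (x, z) i j - \<psi> (x, z) i j =
    complex_of_real t * mdiff (pert n s t (munit V) (\<lambda>x. \<phi> (x, 0)))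
        (pert n s t (munit V) (\<lambda>x. \<psi> (x, 0))) x i j
    + complex_of_real t * mdiff (pert n u t (munit W) (\<lambda>x. \<phi> (0, x)))
        (pert n u t (munit W) (\<lambda>x. \<psi> (0, x))) z i j
    + (s x - u z) * (\<phi> (munit V, 0) i j - \<psi> (munit V, 0) i j)"
proof -
  have u: "\<phi> (0, munit W) i j = (if i = j then 1 else 0) - \<phi> (munit V, 0) i j"
    if \<phi>: "\<phi> \<in> CS (mou_dsum V W) n" for \<phi>
    using CS_unit[OF \<phi>, of i j] mlin_pair_split[OF CS_mlin[OF \<phi>], of "munit V" "munit W" i j] ij
    by (simp add: algebra_simps)
  show ?thesis
    unfolding mlin_pair_split[OF CS_mlin[OF \<phi>], of x z] mlin_pair_split[OF CS_mlin[OF \<psi>], of x z]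
      mdiff_def right_diff_distrib[of "complex_of_real t"] pert_eq[OF t ij] u[OF \<phi>] u[OF \<psi>]
    by (simp add: algebra_simps)
qed

lemma sum_norm_le_const:
  assumes "\<And>i j. i < n \<Longrightarrow> j < n \<Longrightarrow> cmod (R i j) \<le> \<eta>"
  shows "(\<Sum>i<n. \<Sum>j<n. cmod (R i j)) \<le> (real n)\<^sup>2 * \<eta>"
proof -
  have "(\<Sum>i<n. \<Sum>j<n. cmod (R i j)) \<le> (\<Sum>i<n. \<Sum>j<n. \<eta>)"
    by (intro sum_mono assms) auto
  then show ?thesis by (simp add: power2_eq_square mult.assoc)
qed

text \<open>Each of the three terms of \<open>dsum_diff_decomp\<close> is pushed below e / 4: two by
  closeness of the repaired restrictions, measured by LV and LW and hence by L, the third by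
  \<open>fin\<close> together with small entries of \<phi>(e, 0) - \<psi>(e, 0).\<close>

lemma lip_norm_dsum:
  fixes V :: "'a::complex_vector mou" and W :: "'b::complex_vector mou"
  assumes V: "is_mou V" and W: "is_mou W"
    and LV: "matrix_lip_norm V LV" and LW: "matrix_lip_norm W LW"
    and L: "matrix_lip_seminorm (mou_dsum V W) L"
    and leV: "\<And>r a. a \<in> qm_mat r \<Longrightarrow> LV r (\<lambda>i j. fst (a i j)) \<le> L r a"
    and leW: "\<And>r a. a \<in> qm_mat r \<Longrightarrow> LW r (\<lambda>i j. snd (a i j)) \<le> L r a"
    and s: "is_state V s" and u: "is_state W u"
    and fin: "DL 1 L (state_tensor 1 s (\<lambda>i j. 0) \<circ> fst) (state_tensor 1 u (\<lambda>i j. 0) \<circ> snd) \<le> ereal C"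
  shows "matrix_lip_norm (mou_dsum V W) L"
  unfolding lip_norm_iff
proof (intro conjI L allI impI ballI)
  fix n :: nat and \<phi> and e :: real
  assume n: "1 \<le> n" and \<phi>: "\<phi> \<in> CS (mou_dsum V W) n" and e: "0 < e"
  \<comment> \<open>B bounds the entries of \<phi> at both units, so a single t serves both
    summands. K will bound n^2 times the norm of [s(x) - u(z)], and the + 1 keeps it positive.
    Dividing e / 4 by K and by t gives \<eta> and \<epsilon>.\<close>
  define B where "B = (\<Sum>i<n. \<Sum>j<n. cmod (\<phi> (munit V, 0) i j) + cmod (\<phi> (0, munit W) i j))"
  define t where "t = real n * (B + 1)"
  define K where "K = (real n)\<^sup>2 * (\<bar>C\<bar> + 1)"
  define \<eta> where "\<eta> = e / (4 * K)"
  have B: "cmod (\<phi> (munit V, 0) i j) + cmod (\<phi> (0, munit W) i j) \<le> B" if "i < n" "j < n" for i j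
  proof -
    have "cmod (\<phi> (munit V, 0) i j) + cmod (\<phi> (0, munit W) i j)
        \<le> (\<Sum>j<n. cmod (\<phi> (munit V, 0) i j) + cmod (\<phi> (0, munit W) i j))"
      using that by (intro member_le_sum) auto
    also have "\<dots> \<le> B" unfolding B_def
      using that by (intro member_le_sum[of i "{..<n}"
          "\<lambda>i. \<Sum>j<n. cmod (\<phi> (munit V, 0) i j) + cmod (\<phi> (0, munit W) i j)"] sum_nonneg) auto
    finally show ?thesis .
  qed
  have B0: "0 \<le> B" unfolding B_def by (intro sum_nonneg) auto
  have t: "0 < t" using n B0 by (simp add: t_def)
  have K: "0 < K" unfolding K_def using n by (intro mult_pos_pos) auto
  have \<eta>: "0 < \<eta>" unfolding \<eta>_def using e K by (intro divide_pos_pos) auto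
  define \<epsilon> where "\<epsilon> = e / (4 * t)"
  have \<epsilon>: "0 < \<epsilon>" using e t by (simp add: \<epsilon>_def)
  let ?P = "\<lambda>\<psi>. pert n s t (munit V) (\<lambda>x. \<psi> (x, 0))"
  let ?Q = "\<lambda>\<psi>. pert n u t (munit W) (\<lambda>x. \<psi> (0, x))"
  have 1: "eventually (\<lambda>\<psi>. \<psi> \<in> CS (mou_dsum V W) n \<longrightarrow> DL n LV (?P \<phi>) (?P \<psi>) < ereal \<epsilon>) (nhds \<phi>)"
  proof (rule eventually_pert_close[where g = "\<lambda>x. (x, 0)", OF V s LV n \<phi> _ _ _ t \<epsilon>])
    fix i j assume "i < n" "j < n"
    from B[OF this] show "real n * (cmod (\<phi> (munit V, 0) i j) + 1) \<le> t"
      unfolding t_def by (intro mult_left_mono) (auto intro: order_trans[rotated])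
  qed (auto intro: mlin_pair_fst CS_mlin CS_pair_fst_pos[OF W])
  have 2: "eventually (\<lambda>\<psi>. \<psi> \<in> CS (mou_dsum V W) n \<longrightarrow> DL n LW (?Q \<phi>) (?Q \<psi>) < ereal \<epsilon>) (nhds \<phi>)"
  proof (rule eventually_pert_close[where g = "\<lambda>x. (0, x)", OF W u LW n \<phi> _ _ _ t \<epsilon>])
    fix i j assume "i < n" "j < n"
    from B[OF this] show "real n * (cmod (\<phi> (0, munit W) i j) + 1) \<le> t"
      unfolding t_def by (intro mult_left_mono) (auto intro: order_trans[rotated])
  qed (auto intro: mlin_pair_snd CS_mlin CS_pair_snd_pos[OF V])
  have 3: "eventually (\<lambda>\<psi>. \<forall>i\<in>{..<n}. \<forall>j\<in>{..<n}.
      cmod (\<phi> (munit V, 0) i j - \<psi> (munit V, 0) i j) < \<eta>) (nhds \<phi>)"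
    by (intro eventually_ball_finite ballI finite_lessThan eventually_entry_close \<eta>)
  show "eventually (\<lambda>\<psi>. \<psi> \<in> CS (mou_dsum V W) n \<longrightarrow> DL n L \<phi> \<psi> < ereal e) (nhds \<phi>)"
    using 1 2 3
  proof (eventually_elim, intro impI)
    fix \<psi>
    assume P: "\<psi> \<in> CS (mou_dsum V W) n \<longrightarrow> DL n LV (?P \<phi>) (?P \<psi>) < ereal \<epsilon>"
      and Q: "\<psi> \<in> CS (mou_dsum V W) n \<longrightarrow> DL n LW (?Q \<phi>) (?Q \<psi>) < ereal \<epsilon>"
      and R: "\<forall>i\<in>{..<n}. \<forall>j\<in>{..<n}. cmod (\<phi> (munit V, 0) i j - \<psi> (munit V, 0) i j) < \<eta>"
      and \<psi>: "\<psi> \<in> CS (mou_dsum V W) n"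
    have P: "DL n LV (?P \<phi>) (?P \<psi>) \<le> ereal \<epsilon>" and Q: "DL n LW (?Q \<phi>) (?Q \<psi>) \<le> ereal \<epsilon>"
      using P Q \<psi> by auto
    have linP: "mlin (?P \<omega>)" and linQ: "mlin (?Q \<omega>)" if "\<omega> \<in> CS (mou_dsum V W) n" for \<omega>
      by (rule mlin_pert[OF s mlin_pair_fst[OF CS_mlin[OF that]]],
          rule mlin_pert[OF u mlin_pair_snd[OF CS_mlin[OF that]]])
    have "DL n L \<phi> \<psi> \<le> ereal (3 * e / 4)"
    proof (rule DL_leI)
      fix r a assume a: "a \<in> qm_mat r" "L r a \<le> 1"
      let ?x = "\<lambda>i j. fst (a i j)" and ?z = "\<lambda>i j. snd (a i j)"
      let ?N = "cmat_norm (r * n) (r * n)"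
      define F where "F = (\<lambda>p q. s (?x p q) - u (?z p q))"
      define R' where "R' = (\<lambda>i j. \<phi> (munit V, 0) i j - \<psi> (munit V, 0) i j)"
      let ?A = "\<lambda>I J. complex_of_real t * ampl n (mdiff (?P \<phi>) (?P \<psi>)) ?x I J"
      let ?B = "\<lambda>I J. complex_of_real t * ampl n (mdiff (?Q \<phi>) (?Q \<psi>)) ?z I J"
      let ?K = "\<lambda>I J. F (I div n) (J div n) * R' (I mod n) (J mod n)"
      have xz: "?x \<in> qm_mat r" "?z \<in> qm_mat r" using a(1) by (auto simp: qm_mat_def)
      have "ampl n (mdiff \<phi> \<psi>) a I J = (?A I J + ?B I J) + ?K I J" for I J
        using dsum_diff_decomp[OF \<phi> \<psi> t, of "I mod n" "J mod n"
            "?x (I div n) (J div n)" "?z (I div n) (J div n)" s u] n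
        by (simp add: ampl_def F_def R'_def mdiff_def[of \<phi>])
      then have "?N (ampl n (mdiff \<phi> \<psi>) a) = ?N (\<lambda>I J. (?A I J + ?B I J) + ?K I J)"
        by presburger
      also have "\<dots> \<le> (?N ?A + ?N ?B) + ?N ?K"
        by (rule order_trans[OF cmat_norm_triangle add_right_mono[OF cmat_norm_triangle]])
      also have "?N ?A \<le> e / 4"
      proof -
        have "?N (ampl n (mdiff (?P \<phi>) (?P \<psi>)) ?x) \<le> 1 * \<epsilon>"
          using leV[OF a(1)] a(2)
          by (intro DL_bound[OF lip_norm_seminorm[OF LV] linP[OF \<phi>] linP[OF \<psi>] xz(1) _ _ P]) auto
        then have "t * ?N (ampl n (mdiff (?P \<phi>) (?P \<psi>)) ?x) \<le> t * \<epsilon>"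
          using t by simp
        then show ?thesis using t by (simp add: cmat_norm_scale \<epsilon>_def)
      qed
      also have "?N ?B \<le> e / 4"
      proof -
        have "?N (ampl n (mdiff (?Q \<phi>) (?Q \<psi>)) ?z) \<le> 1 * \<epsilon>"
          using leW[OF a(1)] a(2)
          by (intro DL_bound[OF lip_norm_seminorm[OF LW] linQ[OF \<phi>] linQ[OF \<psi>] xz(2) _ _ Q]) auto
        then have "t * ?N (ampl n (mdiff (?Q \<phi>) (?Q \<psi>)) ?z) \<le> t * \<epsilon>"
          using t by simp
        then show ?thesis using t by (simp add: cmat_norm_scale \<epsilon>_def)
      qed
      also have "?N ?K \<le> e / 4"
      proof -
        \<comment> \<open>At level 1 the amplified difference of the two states is the matrix F
          itself, so \<open>fin\<close> bounds its norm for every r.\<close>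
        have "cmat_norm (r * 1) (r * 1)
            (ampl 1 (mdiff (state_tensor 1 s (\<lambda>i j. 0) \<circ> fst) (state_tensor 1 u (\<lambda>i j. 0) \<circ> snd)) a) \<le> 1 * C"
          using a by (intro DL_bound[OF L _ _ a(1) _ _ fin] mlin_fst mlin_snd state_tensor_mlin[OF s] state_tensor_mlin[OF u]) auto
        moreover have "ampl 1 (mdiff (state_tensor 1 s (\<lambda>i j. 0) \<circ> fst) (state_tensor 1 u (\<lambda>i j. 0) \<circ> snd)) a = F"
          by (simp add: ampl_def mdiff_def state_tensor_def F_def fun_eq_iff)
        ultimately have F: "cmat_norm r r F \<le> \<bar>C\<bar> + 1" by simp
        have R': "(\<Sum>i<n. \<Sum>j<n. cmod (R' i j)) \<le> (real n)\<^sup>2 * \<eta>"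
          using R unfolding R'_def by (intro sum_norm_le_const) (auto intro: less_imp_le)
        have "?N ?K \<le> cmat_norm r r F * (\<Sum>i<n. \<Sum>j<n. cmod (R' i j))"
          by (rule cmat_norm_kron_le)
        also have "\<dots> \<le> (\<bar>C\<bar> + 1) * ((real n)\<^sup>2 * \<eta>)"
          by (intro mult_mono F R' sum_nonneg) auto
        also have "\<dots> = K * \<eta>" by (simp add: K_def)
        also have "\<dots> = e / 4" unfolding \<eta>_def using K by simp
        finally show ?thesis .
      qed
      finally show "ereal (?N (ampl n (mdiff \<phi> \<psi>) a)) \<le> ereal (3 * e / 4)"
        by simp
    qed
    also have "\<dots> < ereal e" using e by simp
    finally show "DL n L \<phi> \<psi> < ereal e" .
  qed
qed

subsection \<open>Gluing matrix Lipschitz seminorms along a common summand\<close>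

lemma sandw_block:
  assumes "n + k \<le> N"
  shows "sandw n N (\<lambda>i j. if j = i + k then 1 else 0) x (\<lambda>i j. if i = j + k then 1 else 0)
    = (\<lambda>i j. if i < n \<and> j < n then x (i + k) (j + k) else 0)"
proof (intro ext)
  fix i j
  have *: "scaleC ((if p = a then 1 else 0) * (if q = b then 1 else 0)) y
      = (if p = a then if q = b then y else 0 else 0)" for p q a b :: nat and y :: 'a
    by (simp add: scaleC_one)
  show "sandw n N (\<lambda>i j. if j = i + k then 1 else 0) x (\<lambda>i j. if i = j + k then 1 else 0) i j
    = (if i < n \<and> j < n then x (i + k) (j + k) else 0)"
  proof (cases "i < n \<and> j < n")
    case True
    then have "i + k < N" "j + k < N" using assms by auto
    then have "(\<Sum>q<N. if p = i + k then if q = j + k then x p q else 0 else 0)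
        = (if p = i + k then x p (j + k) else 0)" for p
      by simp
    with True \<open>i + k < N\<close> show ?thesis by (simp add: sandw_def *)
  qed (auto simp: sandw_def)
qed

text \<open>Inequalities suffice. The reverse ones come from scaling back by the inverse of c, from
  compressing the sum to its two diagonal blocks by contractions, and from applying the involution
  twice.\<close>

lemma lip_seminormI:
  fixes V :: "'v::complex_vector mou"
  assumes inv: "\<And>x. minv V (minv V x) = x" "minv V 0 = 0"
    and nonneg: "\<And>n a. a \<in> qm_mat n \<Longrightarrow> 0 \<le> L n a"
    and add: "\<And>n a b. a \<in> qm_mat n \<Longrightarrow> b \<in> qm_mat n \<Longrightarrow> L n (\<lambda>i j. a i j + b i j) \<le> L n a + L n b"
    and scale: "\<And>n c a. a \<in> qm_mat n \<Longrightarrow> L n (\<lambda>i j. scaleC c (a i j)) \<le> cmod c * L n a"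
    and null: "\<And>n a. a \<in> qm_mat n \<Longrightarrow>
      L n a = 0 \<longleftrightarrow> (\<forall>i<n. \<forall>j<n. \<exists>c. a i j = scaleC c (munit V))"
    and mdsum: "\<And>m n v w. v \<in> qm_mat m \<Longrightarrow> w \<in> qm_mat n \<Longrightarrow>
      L (m + n) (mdsum m n v w) \<le> max (L m v) (L n w)"
    and sandw: "\<And>m n \<alpha> \<beta> v. v \<in> qm_mat m \<Longrightarrow>
      L n (sandw n m \<alpha> v \<beta>) \<le> cmat_norm n m \<alpha> * L m v * cmat_norm m n \<beta>"
    and star: "\<And>m v. v \<in> qm_mat m \<Longrightarrow> L m (mstar V v) \<le> L m v"
  shows "matrix_lip_seminorm V L"
  unfolding matrix_lip_seminorm_def
proof (intro conjI allI ballI add null sandw)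
  fix n c and a :: "nat \<Rightarrow> nat \<Rightarrow> 'v" assume a: "a \<in> qm_mat n"
  show "L n (\<lambda>i j. scaleC c (a i j)) = cmod c * L n a"
  proof (cases "c = 0")
    case True
    then show ?thesis using scale[OF a, of c] nonneg[OF qm_mat_scale[OF a], of c] by simp
  next
    case False
    have "L n (\<lambda>i j. scaleC (inverse c) (scaleC c (a i j))) \<le> cmod (inverse c) * L n (\<lambda>i j. scaleC c (a i j))"
      by (rule scale[OF qm_mat_scale[OF a]])
    then have "L n a \<le> inverse (cmod c) * L n (\<lambda>i j. scaleC c (a i j))"
      using False by (simp add: scaleC_scaleC scaleC_one norm_inverse)
    then have "cmod c * L n a \<le> cmod c * (inverse (cmod c) * L n (\<lambda>i j. scaleC c (a i j)))"
      by (rule mult_left_mono) simp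
    also have "\<dots> = L n (\<lambda>i j. scaleC c (a i j))" using False by simp
    finally show ?thesis using scale[OF a, of c] by (rule antisym[rotated])
  qed
next
  fix m n and v w :: "nat \<Rightarrow> nat \<Rightarrow> 'v" assume v: "v \<in> qm_mat m" and w: "w \<in> qm_mat n"
  let ?x = "mdsum m n v w"
  have block: "L d (\<lambda>i j. if i < d \<and> j < d then ?x (i + k) (j + k) else 0) \<le> L (m + n) ?x"
    if "d + k \<le> m + n" for d k
  proof -
    let ?\<alpha> = "\<lambda>i j. if j = i + k then 1 else 0 :: complex"
    let ?\<beta> = "\<lambda>i j. if i = j + k then 1 else 0 :: complex"
    have \<alpha>: "cmat_norm d (m + n) ?\<alpha> \<le> 1"
      using that by (intro cmat_norm_partial_id[of _ _ _ k]) auto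
    have "cmat_norm (m + n) d ?\<beta> = cmat_norm d (m + n) (\<lambda>i j. cnj (?\<beta> j i))"
      by (rule cmat_norm_adjoint[symmetric])
    also have "\<dots> \<le> 1" using that by (intro cmat_norm_partial_id[of _ _ _ k]) auto
    finally have \<beta>: "cmat_norm (m + n) d ?\<beta> \<le> 1" .
    have "L d (sandw d (m + n) ?\<alpha> ?x ?\<beta>)
        \<le> cmat_norm d (m + n) ?\<alpha> * L (m + n) ?x * cmat_norm (m + n) d ?\<beta>"
      by (rule sandw[OF qm_mat_mdsum])
    also have "\<dots> \<le> (1 * L (m + n) ?x) * 1"
      using nonneg[OF qm_mat_mdsum[of m n v w]] \<alpha> \<beta>
      by (intro mult_mono) auto
    finally show ?thesis by (simp add: sandw_block[OF that])
  qed
  have "(\<lambda>i j. if i < m \<and> j < m then ?x (i + 0) (j + 0) else 0) = v"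
    using v by (auto simp: mdsum_def qm_mat_def fun_eq_iff)
  then have "L m v \<le> L (m + n) ?x" using block[of m 0] by simp
  moreover have "(\<lambda>i j. if i < n \<and> j < n then ?x (i + m) (j + m) else 0) = w"
    using w by (auto simp: mdsum_def qm_mat_def fun_eq_iff)
  then have "L n w \<le> L (m + n) ?x" using block[of n m] by simp
  ultimately show "L (m + n) ?x = max (L m v) (L n w)"
    using mdsum[OF v w] by linarith
next
  fix m and v :: "nat \<Rightarrow> nat \<Rightarrow> 'v" assume v: "v \<in> qm_mat m"
  have "mstar V v \<in> qm_mat m" using v inv(2) by (auto simp: qm_mat_def mstar_def)
  then have "L m (mstar V (mstar V v)) \<le> L m (mstar V v)" by (rule star)
  moreover have "mstar V (mstar V v) = v" by (simp add: mstar_def inv)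
  ultimately show "L m (mstar V v) = L m v" using star[OF v] by simp
qed

lemma mou_inv_zero: "is_mou V \<Longrightarrow> minv V 0 = 0"
  using mou_inv_add[of V 0 0] by simp

section \<open>Matrices over a direct sum as pairs of matrices\<close>

definition mpair :: "(nat \<Rightarrow> nat \<Rightarrow> 'a) \<Rightarrow> (nat \<Rightarrow> nat \<Rightarrow> 'b) \<Rightarrow> nat \<Rightarrow> nat \<Rightarrow> 'a \<times> 'b" where
  "mpair x y = (\<lambda>i j. (x i j, y i j))"

abbreviation mfst :: "(nat \<Rightarrow> nat \<Rightarrow> 'a \<times> 'b) \<Rightarrow> nat \<Rightarrow> nat \<Rightarrow> 'a" where
  "mfst a \<equiv> \<lambda>i j. fst (a i j)"

abbreviation msnd :: "(nat \<Rightarrow> nat \<Rightarrow> 'a \<times> 'b) \<Rightarrow> nat \<Rightarrow> nat \<Rightarrow> 'b" where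
  "msnd a \<equiv> \<lambda>i j. snd (a i j)"

lemma mpair_simps [simp]: "mfst (mpair x y) = x" "msnd (mpair x y) = y" "mpair (mfst a) (msnd a) = a"
  by (simp_all add: mpair_def)

lemma qm_mat_mpair: "mpair x y \<in> qm_mat n \<longleftrightarrow> x \<in> qm_mat n \<and> y \<in> qm_mat n"
  by (auto simp: qm_mat_def mpair_def zero_prod_def)

lemma qm_mat_mfst: "a \<in> qm_mat n \<Longrightarrow> mfst a \<in> qm_mat n"
  and qm_mat_msnd: "a \<in> qm_mat n \<Longrightarrow> msnd a \<in> qm_mat n"
  by (auto simp: qm_mat_def)

lemma mpair_add: "mpair (\<lambda>i j. x i j + x' i j) (\<lambda>i j. y i j + y' i j) = (\<lambda>i j. mpair x y i j + mpair x' y' i j)"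
  by (simp add: mpair_def)

lemma mpair_scale: "mpair (\<lambda>i j. scaleC c (x i j)) (\<lambda>i j. scaleC c (y i j)) = (\<lambda>i j. scaleC c (mpair x y i j))"
  by (simp add: mpair_def scaleC_pair)

lemma mfst_sandw: "mfst (sandw n m \<alpha> a \<beta>) = sandw n m \<alpha> (mfst a) \<beta>"
  and msnd_sandw: "msnd (sandw n m \<alpha> a \<beta>) = sandw n m \<alpha> (msnd a) \<beta>"
  by (auto simp: sandw_def fst_sum snd_sum scaleC_prod_def fun_eq_iff)

lemma mpair_sandw: "mpair (sandw n m \<alpha> x \<beta>) (sandw n m \<alpha> y \<beta>) = sandw n m \<alpha> (mpair x y) \<beta>"
  using mfst_sandw[of n m \<alpha> "mpair x y" \<beta>] msnd_sandw[of n m \<alpha> "mpair x y" \<beta>]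
  by (metis mpair_simps)

lemma mfst_mdsum: "mfst (mdsum m n a b) = mdsum m n (mfst a) (mfst b)"
  and msnd_mdsum: "msnd (mdsum m n a b) = mdsum m n (msnd a) (msnd b)"
  by (auto simp: mdsum_def fun_eq_iff)

lemma mpair_mdsum: "mpair (mdsum m n x x') (mdsum m n y y') = mdsum m n (mpair x y) (mpair x' y')"
  using mfst_mdsum[of m n "mpair x y" "mpair x' y'"] msnd_mdsum[of m n "mpair x y" "mpair x' y'"]
  by (metis mpair_simps)

lemma mpair_mstar: "mpair (mstar V x) (mstar W y) = mstar (mou_dsum V W) (mpair x y)"
  by (simp add: mpair_def mstar_def)

definition glue :: "(nat \<Rightarrow> (nat \<Rightarrow> nat \<Rightarrow> 'a \<times> 'b::complex_vector) \<Rightarrow> real) \<Rightarrow>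
    (nat \<Rightarrow> (nat \<Rightarrow> nat \<Rightarrow> 'b \<times> 'c) \<Rightarrow> real) \<Rightarrow> nat \<Rightarrow> (nat \<Rightarrow> nat \<Rightarrow> 'a \<times> 'c) \<Rightarrow> real" where
  "glue L M n a = Inf {max (L n (mpair (mfst a) y)) (M n (mpair y (msnd a))) | y. y \<in> qm_mat n}"

text \<open>Turns a strict bound at an infimum g into a bound at some u above g, so that a
  near-optimal y can be chosen below u. The k + 1 in the denominator covers k = 0.\<close>

lemma ex_gt_mult_le:
  fixes k g s :: real
  assumes "0 \<le> k" "k * g < s"
  obtains u where "g < u" "k * u \<le> s"
proof
  define e where "e = (s - k * g) / (k + 1)"
  have e: "0 < e" using assms by (simp add: e_def)
  then show "g < g + e" by simp
  have "k * e \<le> (k + 1) * e" using e by simp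
  also have "\<dots> = s - k * g" using assms by (simp add: e_def)
  finally show "k * (g + e) \<le> s" by (simp add: algebra_simps)
qed

locale glue_pair =
  fixes V1 :: "'a::complex_vector mou" and V2 :: "'b::complex_vector mou"
    and V3 :: "'c::complex_vector mou" and L12 L23
  assumes V: "is_mou V1" "is_mou V2" "is_mou V3"
    and L12: "matrix_lip_seminorm (mou_dsum V1 V2) L12"
    and L23: "matrix_lip_seminorm (mou_dsum V2 V3) L23"
begin

abbreviation "L13 \<equiv> glue L12 L23"

lemma values_nonneg:
  assumes "a \<in> qm_mat n" "y \<in> qm_mat n"
  shows "0 \<le> L12 n (mpair (mfst a) y)" "0 \<le> L23 n (mpair y (msnd a))"
  using assms by (auto intro!: lip_nonneg[OF L12] lip_nonneg[OF L23] simp: qm_mat_mpair qm_mat_mfst qm_mat_msnd)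

lemma L13_ge:
  assumes "\<And>y. y \<in> qm_mat n \<Longrightarrow> s \<le> max (L12 n (mpair (mfst a) y)) (L23 n (mpair y (msnd a)))"
  shows "s \<le> L13 n a"
  unfolding glue_def
  by (rule cInf_greatest) (use assms qm_mat_zero in blast)+

lemma L13_nonneg: "a \<in> qm_mat n \<Longrightarrow> 0 \<le> L13 n a"
  using values_nonneg by (intro L13_ge) (auto simp: le_max_iff_disj)

lemma L13_le:
  assumes "a \<in> qm_mat n" "y \<in> qm_mat n" "L12 n (mpair (mfst a) y) \<le> s" "L23 n (mpair y (msnd a)) \<le> s"
  shows "L13 n a \<le> s"
proof -
  have "L13 n a \<le> max (L12 n (mpair (mfst a) y)) (L23 n (mpair y (msnd a)))"
    unfolding glue_def
  proof (rule cInf_lower)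
    show "bdd_below {max (L12 n (mpair (mfst a) y)) (L23 n (mpair y (msnd a))) | y. y \<in> qm_mat n}"
      using values_nonneg[OF assms(1)] by (intro bdd_belowI[of _ 0]) (auto simp: le_max_iff_disj)
  qed (use assms in blast)
  with assms show ?thesis by simp
qed

lemma L13_less:
  assumes "L13 n a < s"
  obtains y where "y \<in> qm_mat n" "L12 n (mpair (mfst a) y) < s" "L23 n (mpair y (msnd a)) < s"
proof -
  have "{max (L12 n (mpair (mfst a) y)) (L23 n (mpair y (msnd a))) | y. y \<in> qm_mat n} \<noteq> {}"
    using qm_mat_zero by blast
  from cInf_lessD[OF this assms[unfolded glue_def]] that show thesis by auto
qed

lemma L13_add:
  assumes a: "a \<in> qm_mat n" and b: "b \<in> qm_mat n"
  shows "L13 n (\<lambda>i j. a i j + b i j) \<le> L13 n a + L13 n b"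
proof (rule field_le_epsilon)
  fix e :: real assume e: "0 < e"
  obtain y where y: "y \<in> qm_mat n" "L12 n (mpair (mfst a) y) < L13 n a + e / 2"
    "L23 n (mpair y (msnd a)) < L13 n a + e / 2"
    using L13_less[of n a "L13 n a + e / 2"] e by auto
  obtain z where z: "z \<in> qm_mat n" "L12 n (mpair (mfst b) z) < L13 n b + e / 2"
    "L23 n (mpair z (msnd b)) < L13 n b + e / 2"
    using L13_less[of n b "L13 n b + e / 2"] e by auto
  note m = qm_mat_mpair qm_mat_mfst qm_mat_msnd a b y(1) z(1)
  show "L13 n (\<lambda>i j. a i j + b i j) \<le> L13 n a + L13 n b + e"
  proof (rule L13_le[OF qm_mat_add[OF a b] qm_mat_add[OF y(1) z(1)]])
    have "L12 n (\<lambda>i j. mpair (mfst a) y i j + mpair (mfst b) z i j)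
        \<le> L12 n (mpair (mfst a) y) + L12 n (mpair (mfst b) z)"
      by (rule lip_add[OF L12]) (simp_all add: m)
    then show "L12 n (mpair (mfst (\<lambda>i j. a i j + b i j)) (\<lambda>i j. y i j + z i j)) \<le> L13 n a + L13 n b + e"
      using y(2) z(2) by (simp add: mpair_add)
    have "L23 n (\<lambda>i j. mpair y (msnd a) i j + mpair z (msnd b) i j)
        \<le> L23 n (mpair y (msnd a)) + L23 n (mpair z (msnd b))"
      by (rule lip_add[OF L23]) (simp_all add: m)
    then show "L23 n (mpair (\<lambda>i j. y i j + z i j) (msnd (\<lambda>i j. a i j + b i j))) \<le> L13 n a + L13 n b + e"
      using y(3) z(3) by (simp add: mpair_add)
  qed
qed

lemma L13_scale:
  assumes a: "a \<in> qm_mat n"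
  shows "L13 n (\<lambda>i j. scaleC c (a i j)) \<le> cmod c * L13 n a"
proof (rule dense_ge)
  fix s assume "cmod c * L13 n a < s"
  then obtain u where u: "L13 n a < u" "cmod c * u \<le> s" by (rule ex_gt_mult_le[rotated]) simp_all
  obtain y where y: "y \<in> qm_mat n" "L12 n (mpair (mfst a) y) < u" "L23 n (mpair y (msnd a)) < u"
    using L13_less[OF u(1)] by blast
  note m = qm_mat_mpair qm_mat_mfst qm_mat_msnd a y(1)
  have le: "cmod c * v \<le> s" if "v < u" for v
    using mult_left_mono[of v u "cmod c"] that u(2) by simp
  show "L13 n (\<lambda>i j. scaleC c (a i j)) \<le> s"
  proof (rule L13_le[OF qm_mat_scale[OF a] qm_mat_scale[OF y(1)]])
    show "L12 n (mpair (mfst (\<lambda>i j. scaleC c (a i j))) (\<lambda>i j. scaleC c (y i j))) \<le> s"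
      using lip_scale[OF L12, of "mpair (mfst a) y" n c] le[OF y(2)]
      by (simp add: scaleC_prod_def mpair_scale m)
    show "L23 n (mpair (\<lambda>i j. scaleC c (y i j)) (msnd (\<lambda>i j. scaleC c (a i j)))) \<le> s"
      using lip_scale[OF L23, of "mpair y (msnd a)" n c] le[OF y(3)]
      by (simp add: scaleC_prod_def mpair_scale m)
  qed
qed

lemma L13_sandw:
  assumes a: "a \<in> qm_mat m"
  shows "L13 n (sandw n m \<alpha> a \<beta>) \<le> cmat_norm n m \<alpha> * L13 m a * cmat_norm m n \<beta>"
proof (rule dense_ge)
  fix s assume "cmat_norm n m \<alpha> * L13 m a * cmat_norm m n \<beta> < s"
  then have "(cmat_norm n m \<alpha> * cmat_norm m n \<beta>) * L13 m a < s" by (simp add: ac_simps)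
  then obtain u where u: "L13 m a < u" "(cmat_norm n m \<alpha> * cmat_norm m n \<beta>) * u \<le> s"
    by (rule ex_gt_mult_le[rotated]) simp_all
  obtain y where y: "y \<in> qm_mat m" "L12 m (mpair (mfst a) y) < u" "L23 m (mpair y (msnd a)) < u"
    using L13_less[OF u(1)] by blast
  note m = qm_mat_mpair qm_mat_mfst qm_mat_msnd a y(1)
  have le: "cmat_norm n m \<alpha> * v * cmat_norm m n \<beta> \<le> s" if "v < u" for v
    using mult_left_mono[of v u "cmat_norm n m \<alpha> * cmat_norm m n \<beta>"] that u(2) by (simp add: ac_simps)
  show "L13 n (sandw n m \<alpha> a \<beta>) \<le> s"
  proof (rule L13_le[OF qm_mat_sandw qm_mat_sandw[of n m \<alpha> y \<beta>]])
    have "L12 n (sandw n m \<alpha> (mpair (mfst a) y) \<beta>)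
        \<le> cmat_norm n m \<alpha> * L12 m (mpair (mfst a) y) * cmat_norm m n \<beta>"
      by (rule lip_sandw[OF L12]) (simp add: m)
    then show "L12 n (mpair (mfst (sandw n m \<alpha> a \<beta>)) (sandw n m \<alpha> y \<beta>)) \<le> s"
      using le[OF y(2)] by (simp add: mfst_sandw mpair_sandw)
    have "L23 n (sandw n m \<alpha> (mpair y (msnd a)) \<beta>)
        \<le> cmat_norm n m \<alpha> * L23 m (mpair y (msnd a)) * cmat_norm m n \<beta>"
      by (rule lip_sandw[OF L23]) (simp add: m)
    then show "L23 n (mpair (sandw n m \<alpha> y \<beta>) (msnd (sandw n m \<alpha> a \<beta>))) \<le> s"
      using le[OF y(3)] by (simp add: msnd_sandw mpair_sandw)
  qed
qed

lemma L13_mdsum: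
  assumes a: "a \<in> qm_mat m" and b: "b \<in> qm_mat n"
  shows "L13 (m + n) (mdsum m n a b) \<le> max (L13 m a) (L13 n b)"
proof (rule dense_ge)
  fix s assume s: "max (L13 m a) (L13 n b) < s"
  obtain y where y: "y \<in> qm_mat m" "L12 m (mpair (mfst a) y) < s" "L23 m (mpair y (msnd a)) < s"
    using L13_less[of m a s] s by auto
  obtain z where z: "z \<in> qm_mat n" "L12 n (mpair (mfst b) z) < s" "L23 n (mpair z (msnd b)) < s"
    using L13_less[of n b s] s by auto
  note m = qm_mat_mpair qm_mat_mfst qm_mat_msnd a b y(1) z(1)
  show "L13 (m + n) (mdsum m n a b) \<le> s"
  proof (rule L13_le[OF qm_mat_mdsum qm_mat_mdsum[of m n y z]])
    show "L12 (m + n) (mpair (mfst (mdsum m n a b)) (mdsum m n y z)) \<le> s"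
      using lip_mdsum[OF L12, of "mpair (mfst a) y" m "mpair (mfst b) z" n] y z
      by (simp add: mfst_mdsum mpair_mdsum m)
    show "L23 (m + n) (mpair (mdsum m n y z) (msnd (mdsum m n a b))) \<le> s"
      using lip_mdsum[OF L23, of "mpair y (msnd a)" m "mpair z (msnd b)" n] y z
      by (simp add: msnd_mdsum mpair_mdsum m)
  qed
qed

lemma L13_star:
  assumes a: "a \<in> qm_mat n"
  shows "L13 n (mstar (mou_dsum V1 V3) a) \<le> L13 n a"
proof (rule dense_ge)
  fix s assume s: "L13 n a < s"
  obtain y where y: "y \<in> qm_mat n" "L12 n (mpair (mfst a) y) < s" "L23 n (mpair y (msnd a)) < s"
    using L13_less[of n a s] s by auto
  note m = qm_mat_mpair qm_mat_mfst qm_mat_msnd a y(1)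
  have star: "mfst (mstar (mou_dsum V1 V3) a) = mstar V1 (mfst a)"
    "msnd (mstar (mou_dsum V1 V3) a) = mstar V3 (msnd a)"
    by (simp_all add: mstar_def)
  have "mstar (mou_dsum V1 V3) a \<in> qm_mat n" "mstar V2 y \<in> qm_mat n"
    using a y(1) V by (auto simp: qm_mat_def mstar_def mou_inv_zero zero_prod_def)
  then show "L13 n (mstar (mou_dsum V1 V3) a) \<le> s"
  proof (rule L13_le)
    show "L12 n (mpair (mfst (mstar (mou_dsum V1 V3) a)) (mstar V2 y)) \<le> s"
      unfolding star mpair_mstar using lip_star[OF L12, of "mpair (mfst a) y" n] y(2) by (simp add: m)
    show "L23 n (mpair (mstar V2 y) (msnd (mstar (mou_dsum V1 V3) a))) \<le> s"
      unfolding star mpair_mstar using lip_star[OF L23, of "mpair y (msnd a)" n] y(3) by (simp add: m)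
  qed
qed

text \<open>The same scalar matrix over V2 serves as y and makes both seminorms vanish.\<close>

lemma L13_scalar:
  assumes a: "a \<in> qm_mat n" and sc: "\<forall>i<n. \<forall>j<n. \<exists>c. a i j = scaleC c (munit V1, munit V3)"
  shows "L13 n a = 0"
proof -
  obtain c where c: "\<And>i j. i < n \<Longrightarrow> j < n \<Longrightarrow> a i j = scaleC (c i j) (munit V1, munit V3)"
    using sc by metis
  define y where "y = (\<lambda>i j. if i < n \<and> j < n then scaleC (c i j) (munit V2) else 0)"
  have y: "y \<in> qm_mat n" by (auto simp: qm_mat_def y_def)
  note m = qm_mat_mpair qm_mat_mfst qm_mat_msnd a y
  have "\<forall>i<n. \<forall>j<n. \<exists>c. mpair (mfst a) y i j = scaleC c (munit V1, munit V2)"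
    using c by (auto simp: mpair_def y_def scaleC_prod_def)
  then have 1: "L12 n (mpair (mfst a) y) = 0"
    using lip_null[OF L12, of "mpair (mfst a) y" n] by (simp add: m)
  have "\<forall>i<n. \<forall>j<n. \<exists>c. mpair y (msnd a) i j = scaleC c (munit V2, munit V3)"
    using c by (auto simp: mpair_def y_def scaleC_prod_def)
  then have 2: "L23 n (mpair y (msnd a)) = 0"
    using lip_null[OF L23, of "mpair y (msnd a)" n] by (simp add: m)
  show ?thesis
    using L13_le[OF a y, of 0] L13_nonneg[OF a] 1 2 by simp
qed

text \<open>The half of the null space condition left as a hypothesis is proved in
  \<open>glue_in_Mset\<close>, from finite distances between states.\<close>

lemma L13_seminorm:
  assumes "\<And>n a. a \<in> qm_mat n \<Longrightarrow> L13 n a = 0 \<Longrightarrow>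
    \<forall>i<n. \<forall>j<n. \<exists>c. a i j = scaleC c (munit V1, munit V3)"
  shows "matrix_lip_seminorm (mou_dsum V1 V3) L13"
proof (rule lip_seminormI)
  show "minv (mou_dsum V1 V3) (minv (mou_dsum V1 V3) x) = x" for x
    using V by (simp add: mou_inv_inv)
  show "minv (mou_dsum V1 V3) 0 = 0"
    using V by (simp add: mou_inv_zero zero_prod_def)
  show "L13 n a = 0 \<longleftrightarrow> (\<forall>i<n. \<forall>j<n. \<exists>c. a i j = scaleC c (munit (mou_dsum V1 V3)))"
    if "a \<in> qm_mat n" for n a
    using assms[OF that] L13_scalar[OF that] by auto
qed (rule L13_nonneg L13_add L13_scale L13_mdsum L13_sandw L13_star; assumption)+

text \<open>Inserting \<psi>(y) splits the difference into one term for each seminorm; the strict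
  bound on a provides a y that is good for both.\<close>

lemma L13_bound:
  assumes lin: "mlin \<phi>" "mlin \<psi>" "mlin \<omega>"
    and d1: "DL n L12 (\<phi> \<circ> fst) (\<psi> \<circ> snd) \<le> ereal d1"
    and d2: "DL n L23 (\<psi> \<circ> fst) (\<omega> \<circ> snd) \<le> ereal d2"
    and a: "a \<in> qm_mat r" "L13 r a < s" "0 < s"
  shows "cmat_norm (r * n) (r * n) (ampl n (mdiff (\<phi> \<circ> fst) (\<omega> \<circ> snd)) a) \<le> s * (d1 + d2)"
proof -
  obtain y where y: "y \<in> qm_mat r" "L12 r (mpair (mfst a) y) < s" "L23 r (mpair y (msnd a)) < s"
    using L13_less[OF a(2)] by blast
  note m = qm_mat_mpair qm_mat_mfst qm_mat_msnd a(1) y(1)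
  have "ampl n (mdiff (\<phi> \<circ> fst) (\<omega> \<circ> snd)) a = (\<lambda>I J.
      ampl n (mdiff (\<phi> \<circ> fst) (\<psi> \<circ> snd)) (mpair (mfst a) y) I J
      + ampl n (mdiff (\<psi> \<circ> fst) (\<omega> \<circ> snd)) (mpair y (msnd a)) I J)"
    by (simp add: ampl_def mdiff_def mpair_def)
  then have "cmat_norm (r * n) (r * n) (ampl n (mdiff (\<phi> \<circ> fst) (\<omega> \<circ> snd)) a)
    \<le> cmat_norm (r * n) (r * n) (ampl n (mdiff (\<phi> \<circ> fst) (\<psi> \<circ> snd)) (mpair (mfst a) y))
      + cmat_norm (r * n) (r * n) (ampl n (mdiff (\<psi> \<circ> fst) (\<omega> \<circ> snd)) (mpair y (msnd a)))"
    by (simp add: cmat_norm_triangle)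
  also have "\<dots> \<le> s * d1 + s * d2"
  proof (rule add_mono)
    show "cmat_norm (r * n) (r * n) (ampl n (mdiff (\<phi> \<circ> fst) (\<psi> \<circ> snd)) (mpair (mfst a) y)) \<le> s * d1"
      using y(2) by (intro DL_bound[OF L12 mlin_fst[OF lin(1)] mlin_snd[OF lin(2)] _ _ a(3) d1]) (simp_all add: m)
    show "cmat_norm (r * n) (r * n) (ampl n (mdiff (\<psi> \<circ> fst) (\<omega> \<circ> snd)) (mpair y (msnd a))) \<le> s * d2"
      using y(3) by (intro DL_bound[OF L23 mlin_fst[OF lin(2)] mlin_snd[OF lin(3)] _ _ a(3) d2]) (simp_all add: m)
  qed
  finally show ?thesis by (simp add: distrib_left)
qed

lemma DL_L13_le:
  assumes lin: "mlin \<phi>" "mlin \<psi>" "mlin \<omega>"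
  shows "DL n L13 (\<phi> \<circ> fst) (\<omega> \<circ> snd)
    \<le> DL n L12 (\<phi> \<circ> fst) (\<psi> \<circ> snd) + DL n L23 (\<psi> \<circ> fst) (\<omega> \<circ> snd)"
proof (cases "DL n L12 (\<phi> \<circ> fst) (\<psi> \<circ> snd) = \<infinity> \<or> DL n L23 (\<psi> \<circ> fst) (\<omega> \<circ> snd) = \<infinity>")
  case False
  obtain d1 where d1: "DL n L12 (\<phi> \<circ> fst) (\<psi> \<circ> snd) = ereal d1" "0 \<le> d1"
    using False DL_nonneg[OF L12, of n "\<phi> \<circ> fst" "\<psi> \<circ> snd"]
    by (cases "DL n L12 (\<phi> \<circ> fst) (\<psi> \<circ> snd)") auto
  obtain d2 where d2: "DL n L23 (\<psi> \<circ> fst) (\<omega> \<circ> snd) = ereal d2" "0 \<le> d2"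
    using False DL_nonneg[OF L23, of n "\<psi> \<circ> fst" "\<omega> \<circ> snd"]
    by (cases "DL n L23 (\<psi> \<circ> fst) (\<omega> \<circ> snd)") auto
  have "DL n L13 (\<phi> \<circ> fst) (\<omega> \<circ> snd) \<le> ereal (d1 + d2)"
  proof (rule DL_leI)
    fix r and a :: "nat \<Rightarrow> nat \<Rightarrow> 'a \<times> 'c" assume a: "a \<in> qm_mat r" "L13 r a \<le> 1"
    have "cmat_norm (r * n) (r * n) (ampl n (mdiff (\<phi> \<circ> fst) (\<omega> \<circ> snd)) a) \<le> d1 + d2"
    proof (rule dense_ge)
      fix s assume "d1 + d2 < s"
      \<comment> \<open>A level slightly above 1 meets the strict hypothesis of
        \<open>L13_bound\<close> also when a has seminorm exactly 1.\<close>
      then obtain u where u: "1 < u" "(d1 + d2) * u \<le> s"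
        using ex_gt_mult_le[of "d1 + d2" 1 s] d1 d2 by auto
      have "cmat_norm (r * n) (r * n) (ampl n (mdiff (\<phi> \<circ> fst) (\<omega> \<circ> snd)) a) \<le> u * (d1 + d2)"
        using d1 d2 u a by (intro L13_bound[OF lin]) auto
      with u(2) show "cmat_norm (r * n) (r * n) (ampl n (mdiff (\<phi> \<circ> fst) (\<omega> \<circ> snd)) a) \<le> s"
        by (simp add: mult.commute)
    qed
    then show "ereal (cmat_norm (r * n) (r * n) (ampl n (mdiff (\<phi> \<circ> fst) (\<omega> \<circ> snd)) a)) \<le> ereal (d1 + d2)"
      by simp
  qed
  then show ?thesis by (simp add: d1 d2)
qed auto

end

section \<open>Admissible seminorms and their lifts\<close>

lemma Mset_lip_norm: "L \<in> Mset V1 L1 V2 L2 \<Longrightarrow> matrix_lip_norm (mou_dsum V1 V2) L"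
  by (simp add: Mset_def)

lemma Mset_le_fst:
  assumes L: "L \<in> Mset V1 L1 V2 L2" and a: "a \<in> qm_mat n"
  shows "L1 n (mfst a) \<le> L n a"
proof -
  have "L1 n (mfst a) = Inf {L n b | b. b \<in> qm_mat n \<and> mfst b = mfst a}"
    using L qm_mat_mfst[OF a] unfolding Mset_def by blast
  also have "\<dots> \<le> L n a"
  proof (rule cInf_lower)
    show "bdd_below {L n b | b. b \<in> qm_mat n \<and> mfst b = mfst a}"
      using lip_nonneg[OF lip_norm_seminorm[OF Mset_lip_norm[OF L]]] by (intro bdd_belowI[of _ 0]) auto
  qed (use a in blast)
  finally show ?thesis .
qed

lemma Mset_le_snd:
  assumes L: "L \<in> Mset V1 L1 V2 L2" and a: "a \<in> qm_mat n"
  shows "L2 n (msnd a) \<le> L n a"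
proof -
  have "L2 n (msnd a) = Inf {L n b | b. b \<in> qm_mat n \<and> msnd b = msnd a}"
    using L qm_mat_msnd[OF a] unfolding Mset_def by blast
  also have "\<dots> \<le> L n a"
  proof (rule cInf_lower)
    show "bdd_below {L n b | b. b \<in> qm_mat n \<and> msnd b = msnd a}"
      using lip_nonneg[OF lip_norm_seminorm[OF Mset_lip_norm[OF L]]] by (intro bdd_belowI[of _ 0]) auto
  qed (use a in blast)
  finally show ?thesis .
qed

lemma Mset_lift_fst:
  assumes L: "L \<in> Mset V1 L1 V2 L2" and x: "x \<in> qm_mat n" and s: "L1 n x < s"
  obtains y where "y \<in> qm_mat n" "L n (mpair x y) < s"
proof -
  have "L1 n x = Inf {L n b | b. b \<in> qm_mat n \<and> mfst b = x}"
    using L x unfolding Mset_def by blast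
  moreover have "mpair x (\<lambda>i j. 0) \<in> qm_mat n" using x qm_mat_zero by (simp add: qm_mat_mpair)
  then have "{L n b | b. b \<in> qm_mat n \<and> mfst b = x} \<noteq> {}" using mpair_simps(1) by blast
  ultimately obtain b where "b \<in> qm_mat n" "mfst b = x" "L n b < s"
    using cInf_lessD[of "{L n b | b. b \<in> qm_mat n \<and> mfst b = x}" s] s by auto
  then show thesis using that[of "msnd b"] mpair_simps(3)[of b] qm_mat_msnd by metis
qed

lemma Mset_lift_snd:
  assumes L: "L \<in> Mset V1 L1 V2 L2" and y: "y \<in> qm_mat n" and s: "L2 n y < s"
  obtains x where "x \<in> qm_mat n" "L n (mpair x y) < s"
proof -
  have "L2 n y = Inf {L n b | b. b \<in> qm_mat n \<and> msnd b = y}"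
    using L y unfolding Mset_def by blast
  moreover have "mpair (\<lambda>i j. 0) y \<in> qm_mat n" using y qm_mat_zero by (simp add: qm_mat_mpair)
  then have "{L n b | b. b \<in> qm_mat n \<and> msnd b = y} \<noteq> {}" using mpair_simps(2) by blast
  ultimately obtain b where "b \<in> qm_mat n" "msnd b = y" "L n b < s"
    using cInf_lessD[of "{L n b | b. b \<in> qm_mat n \<and> msnd b = y}" s] s by auto
  then show thesis using that[of "mfst b"] mpair_simps(3)[of b] qm_mat_mfst by metis
qed

text \<open>The quotient conditions restated without infima: L dominates L1 and L2, and every strict
  bound on an element is met by some lift.\<close>

lemma MsetI:
  assumes L: "matrix_lip_norm (mou_dsum V1 V2) L"
    and le: "\<And>n a. a \<in> qm_mat n \<Longrightarrow> L1 n (mfst a) \<le> L n a" "\<And>n a. a \<in> qm_mat n \<Longrightarrow> L2 n (msnd a) \<le> L n a"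
    and lift1: "\<And>n x s. x \<in> qm_mat n \<Longrightarrow> L1 n x < s \<Longrightarrow> \<exists>y\<in>qm_mat n. L n (mpair x y) \<le> s"
    and lift2: "\<And>n y s. y \<in> qm_mat n \<Longrightarrow> L2 n y < s \<Longrightarrow> \<exists>x\<in>qm_mat n. L n (mpair x y) \<le> s"
  shows "L \<in> Mset V1 L1 V2 L2"
proof -
  have bdd: "bdd_below {L n a | a. a \<in> qm_mat n \<and> P a}" for n P
    using lip_nonneg[OF lip_norm_seminorm[OF L]] by (intro bdd_belowI[of _ 0]) auto
  have "L1 n x = Inf {L n a | a. a \<in> qm_mat n \<and> mfst a = x}" if x: "x \<in> qm_mat n" for n x
  proof (rule antisym)
    have "mpair x (\<lambda>i j. 0) \<in> qm_mat n" using x qm_mat_zero by (simp add: qm_mat_mpair)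
    then have "{L n b | b. b \<in> qm_mat n \<and> mfst b = x} \<noteq> {}" using mpair_simps(1) by blast
    then show "L1 n x \<le> Inf {L n a | a. a \<in> qm_mat n \<and> mfst a = x}"
      by (rule cInf_greatest) (use le(1) in auto)
    show "Inf {L n a | a. a \<in> qm_mat n \<and> mfst a = x} \<le> L1 n x"
    proof (rule dense_ge)
      fix s assume "L1 n x < s"
      then obtain y where y: "y \<in> qm_mat n" "L n (mpair x y) \<le> s" using lift1[OF x] by blast
      have "Inf {L n a | a. a \<in> qm_mat n \<and> mfst a = x} \<le> L n (mpair x y)"
        using x y(1) by (intro cInf_lower bdd CollectI exI[of _ "mpair x y"]) (simp add: qm_mat_mpair)
      with y(2) show "Inf {L n a | a. a \<in> qm_mat n \<and> mfst a = x} \<le> s" by simp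
    qed
  qed
  moreover have "L2 n y = Inf {L n a | a. a \<in> qm_mat n \<and> msnd a = y}" if y: "y \<in> qm_mat n" for n y
  proof (rule antisym)
    have "mpair (\<lambda>i j. 0) y \<in> qm_mat n" using y qm_mat_zero by (simp add: qm_mat_mpair)
    then have "{L n b | b. b \<in> qm_mat n \<and> msnd b = y} \<noteq> {}" using mpair_simps(2) by blast
    then show "L2 n y \<le> Inf {L n a | a. a \<in> qm_mat n \<and> msnd a = y}"
      by (rule cInf_greatest) (use le(2) in auto)
    show "Inf {L n a | a. a \<in> qm_mat n \<and> msnd a = y} \<le> L2 n y"
    proof (rule dense_ge)
      fix s assume "L2 n y < s"
      then obtain x where x: "x \<in> qm_mat n" "L n (mpair x y) \<le> s" using lift2[OF y] by blast
      have "Inf {L n a | a. a \<in> qm_mat n \<and> msnd a = y} \<le> L n (mpair x y)"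
        using y x(1) by (intro cInf_lower bdd CollectI exI[of _ "mpair x y"]) (simp add: qm_mat_mpair)
      with x(2) show "Inf {L n a | a. a \<in> qm_mat n \<and> msnd a = y} \<le> s" by simp
    qed
  qed
  ultimately show ?thesis using L unfolding Mset_def by blast
qed

lemma glue_in_Mset:
  assumes V1: "quantized_metric_space V1 L1" and V2: "quantized_metric_space V2 L2"
    and V3: "quantized_metric_space V3 L3"
    and M12: "L12 \<in> Mset V1 L1 V2 L2" and M23: "L23 \<in> Mset V2 L2 V3 L3"
    and s: "is_state V1 s" and f: "is_state V2 f" and u: "is_state V3 u"
  shows "glue L12 L23 \<in> Mset V1 L1 V3 L3"
proof -
  have V: "is_mou V1" "is_mou V2" "is_mou V3"
    and LN: "matrix_lip_norm V1 L1" "matrix_lip_norm V3 L3"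
    using V1 V2 V3 by (auto simp: quantized_metric_space_def)
  note LN12 = Mset_lip_norm[OF M12] and LN23 = Mset_lip_norm[OF M23]
  interpret glue_pair V1 V2 V3 L12 L23
    using V lip_norm_seminorm[OF LN12] lip_norm_seminorm[OF LN23] by unfold_locales
  let ?s = "state_tensor 1 s (\<lambda>i j. 0)" and ?f = "state_tensor 1 f (\<lambda>i j. 0)" and ?u = "state_tensor 1 u (\<lambda>i j. 0)"
  \<comment> \<open>One state per space, joined through f. Finiteness of these two distances yields
    both the null space and, through \<open>lip_norm_dsum\<close>, the topology.\<close>
  obtain d1 where d1: "DL 1 L12 (?s \<circ> fst) (?f \<circ> snd) = ereal d1" "0 \<le> d1"
    using DL_finite[OF LN12 order_refl CS_fst[OF state_tensor_CS[OF V(1) s]] CS_snd[OF state_tensor_CS[OF V(2) f]]] .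
  obtain d2 where d2: "DL 1 L23 (?f \<circ> fst) (?u \<circ> snd) = ereal d2" "0 \<le> d2"
    using DL_finite[OF LN23 order_refl CS_fst[OF state_tensor_CS[OF V(2) f]] CS_snd[OF state_tensor_CS[OF V(3) u]]] .
  note lin = state_tensor_mlin[OF s] state_tensor_mlin[OF f] state_tensor_mlin[OF u]
  have ge1: "L1 n (mfst a) \<le> L13 n a" if a: "a \<in> qm_mat n" for n a
  proof (rule L13_ge)
    fix y :: "nat \<Rightarrow> nat \<Rightarrow> 'b" assume "y \<in> qm_mat n"
    then have "L1 n (mfst (mpair (mfst a) y)) \<le> L12 n (mpair (mfst a) y)"
      by (intro Mset_le_fst[OF M12]) (simp add: qm_mat_mpair qm_mat_mfst a)
    then show "L1 n (mfst a) \<le> max (L12 n (mpair (mfst a) y)) (L23 n (mpair y (msnd a)))" by simp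
  qed
  have ge3: "L3 n (msnd a) \<le> L13 n a" if a: "a \<in> qm_mat n" for n a
  proof (rule L13_ge)
    fix y :: "nat \<Rightarrow> nat \<Rightarrow> 'b" assume "y \<in> qm_mat n"
    then have "L3 n (msnd (mpair y (msnd a))) \<le> L23 n (mpair y (msnd a))"
      by (intro Mset_le_snd[OF M23]) (simp add: qm_mat_mpair qm_mat_msnd a)
    then show "L3 n (msnd a) \<le> max (L12 n (mpair (mfst a) y)) (L23 n (mpair y (msnd a)))" by simp
  qed
  have null: "\<forall>i<n. \<forall>j<n. \<exists>c. a i j = scaleC c (munit V1, munit V3)"
    if a: "a \<in> qm_mat n" and z: "L13 n a = 0" for n a
  proof (intro allI impI)
    fix i j assume ij: "i < n" "j < n"
    have "L1 n (mfst a) = 0"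
      using ge1[OF a] z lip_nonneg[OF lip_norm_seminorm[OF LN(1)] qm_mat_mfst[OF a]] by simp
    then obtain c where c: "fst (a i j) = scaleC c (munit V1)"
      using lip_null[OF lip_norm_seminorm[OF LN(1)] qm_mat_mfst[OF a]] ij by blast
    have "L3 n (msnd a) = 0"
      using ge3[OF a] z lip_nonneg[OF lip_norm_seminorm[OF LN(2)] qm_mat_msnd[OF a]] by simp
    then obtain c' where c': "snd (a i j) = scaleC c' (munit V3)"
      using lip_null[OF lip_norm_seminorm[OF LN(2)] qm_mat_msnd[OF a]] ij by blast
    \<comment> \<open>Where L13 vanishes, \<open>L13_bound\<close> applies at every positive level,
      so s(x) and u(z) agree entrywise and the scalars in the two components coincide.\<close>
    let ?N = "cmat_norm (n * 1) (n * 1) (ampl 1 (mdiff (?s \<circ> fst) (?u \<circ> snd)) a)"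
    have "?N \<le> 0"
    proof (rule dense_ge)
      fix e :: real assume "0 < e"
      then obtain v where v: "0 < v" "(d1 + d2) * v \<le> e"
        using ex_gt_mult_le[of "d1 + d2" 0 e] d1 d2 by auto
      have "?N \<le> v * (d1 + d2)"
        using v z by (intro L13_bound[OF lin eq_refl[OF d1(1)] eq_refl[OF d2(1)] a]) auto
      with v(2) show "?N \<le> e" by (simp add: mult.commute)
    qed
    moreover have "cmod (ampl 1 (mdiff (?s \<circ> fst) (?u \<circ> snd)) a i j) \<le> ?N"
      by (rule norm_le_cmat_norm) (use ij in auto)
    ultimately have "cmod (ampl 1 (mdiff (?s \<circ> fst) (?u \<circ> snd)) a i j) \<le> 0" by linarith
    then have "ampl 1 (mdiff (?s \<circ> fst) (?u \<circ> snd)) a i j = 0" by (simp only: norm_le_zero_iff)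
    then have "s (fst (a i j)) = u (snd (a i j))"
      by (simp add: ampl_def mdiff_def state_tensor_def)
    then have "c = c'"
      unfolding c c' by (simp add: state_scale[OF s] state_scale[OF u] state_unit[OF s] state_unit[OF u])
    then show "\<exists>c. a i j = scaleC c (munit V1, munit V3)"
      using c c' by (intro exI[of _ c]) (simp add: scaleC_prod_def prod_eq_iff)
  qed
  have semi: "matrix_lip_seminorm (mou_dsum V1 V3) L13"
    by (rule L13_seminorm) (rule null)
  have fin: "DL 1 L13 (?s \<circ> fst) (?u \<circ> snd) \<le> ereal (d1 + d2)"
    using DL_L13_le[of ?s ?f ?u 1, OF lin] unfolding d1(1) d2(1) by simp
  have LN13: "matrix_lip_norm (mou_dsum V1 V3) L13"
    by (rule lip_norm_dsum[OF V(1,3) LN semi _ _ s u fin]) (rule ge1 ge3, assumption)+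
  show ?thesis
  proof (rule MsetI[OF LN13 ge1 ge3])
    fix n x s assume x: "x \<in> qm_mat n" and s: "L1 n x < s"
    \<comment> \<open>L12 dominates L2, so the lift y still satisfies the bound s and can be lifted
      once more, to z.\<close>
    obtain y where y: "y \<in> qm_mat n" "L12 n (mpair x y) < s" using Mset_lift_fst[OF M12 x s] .
    have "L2 n (msnd (mpair x y)) \<le> L12 n (mpair x y)"
      using x y by (intro Mset_le_snd[OF M12]) (simp add: qm_mat_mpair)
    then have "L2 n y < s" using y by simp
    then obtain z where z: "z \<in> qm_mat n" "L23 n (mpair y z) < s" using Mset_lift_fst[OF M23 y(1)] by blast
    have "L13 n (mpair x z) \<le> s"
      using x y z by (intro L13_le[OF _ y(1)]) (simp_all add: qm_mat_mpair)
    with z(1) show "\<exists>y\<in>qm_mat n. L13 n (mpair x y) \<le> s" by blast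
  next
    fix n z s assume z: "z \<in> qm_mat n" and s: "L3 n z < s"
    obtain y where y: "y \<in> qm_mat n" "L23 n (mpair y z) < s" using Mset_lift_snd[OF M23 z s] .
    have "L2 n (mfst (mpair y z)) \<le> L23 n (mpair y z)"
      using z y by (intro Mset_le_fst[OF M23]) (simp add: qm_mat_mpair)
    then have "L2 n y < s" using y by simp
    then obtain x where x: "x \<in> qm_mat n" "L12 n (mpair x y) < s" using Mset_lift_snd[OF M12 y(1)] by blast
    have "L13 n (mpair x z) \<le> s"
      using x y z by (intro L13_le[OF _ y(1)]) (simp_all add: qm_mat_mpair)
    with x(1) show "\<exists>x\<in>qm_mat n. L13 n (mpair x z) \<le> s" by blast
  qed
qed

subsection \<open>Spaces without states\<close>

text \<open>The coefficient of the unit in a basis containing it, averaged with its adjoint to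
  become self-adjoint.\<close>

lemma unital_functional:
  fixes V :: "'v::complex_vector mou"
  assumes V: "is_mou V" and e: "munit V \<noteq> 0"
  obtains f where "\<And>x y. f (x + y) = f x + f y" "\<And>c x. f (scaleC c x) = c * f x"
    "\<And>x. f (minv V x) = cnj (f x)" "f (munit V) = 1"
proof -
  interpret vector_space "scaleC :: complex \<Rightarrow> 'v \<Rightarrow> 'v"
    by unfold_locales (simp_all add: scaleC_add_right scaleC_add_left scaleC_scaleC scaleC_one)
  have ind: "independent {munit V}" using e by simp
  define B where "B = extend_basis {munit V}"
  have B: "independent B" "span B = UNIV" "munit V \<in> B"
    using independent_extend_basis[OF ind] span_extend_basis[OF ind] extend_basis_superset[OF ind]
    by (auto simp: B_def)
  define g where "g x = representation B x (munit V)" for x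
  have ga: "g (x + y) = g x + g y" for x y
    using B by (simp add: g_def representation_add)
  have gs: "g (scaleC c x) = c * g x" for c x
    using B by (simp add: g_def representation_scale)
  have ge: "g (munit V) = 1"
    using B by (simp add: g_def representation_basis)
  define f where "f x = (g x + cnj (g (minv V x))) / 2" for x
  show thesis
  proof (rule that[of f])
    show "f (x + y) = f x + f y" for x y
      by (simp add: f_def ga mou_inv_add[OF V] add_divide_distrib)
    show "f (scaleC c x) = c * f x" for c x
      by (simp add: f_def gs mou_inv_scale[OF V] algebra_simps)
    show "f (minv V x) = cnj (f x)" for x
      by (simp add: f_def mou_inv_inv[OF V] add.commute)
    show "f (munit V) = 1"
      by (simp add: f_def ge mou_inv_unit[OF V])
  qed
qed

text \<open>In the remaining case of \<open>mou_unit_cases\<close> only 0 is positive in V, so any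
  unital functional would be a state.\<close>

lemma no_state_unit:
  assumes V: "is_mou V" and no: "\<nexists>h. is_state V h"
  shows "as_mat1 (munit V) \<in> mpos V 1 \<or> as_mat1 (- munit V) \<in> mpos V 1"
  using V
proof (cases rule: mou_unit_cases)
  case 3
  obtain f where f: "\<And>x y. f (x + y) = f x + f y" "\<And>c x. f (scaleC c x) = c * f x" "f (munit V) = 1"
    using unital_functional[OF V 3(3)] by metis
  have "f 0 = 0" using f(2)[of 0 0] by simp
  with f 3(1) have "is_state V f" unfolding is_state_def by fastforce
  with no show ?thesis by blast
qed auto

text \<open>The values of h at (1, 0) and (0, 1) are real, because each unit is positive up to sign,
  and they add up to 1. One of them is positive, and restricting h to that summand and normalizing
  gives a state there.\<close>

lemma no_state_dsum:
  assumes V: "is_mou V" and W: "is_mou W"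
    and noV: "\<nexists>h. is_state V h" and noW: "\<nexists>h. is_state W h"
  shows "\<nexists>h. is_state (mou_dsum V W) h"
proof
  assume "\<exists>h. is_state (mou_dsum V W) h"
  then obtain h where h: "is_state (mou_dsum V W) h" by blast
  have fst0: "mfst (as_mat1 (x, 0)) = as_mat1 x" "msnd (as_mat1 (x, 0)) = (\<lambda>i j. 0)" for x :: 'a
    by (auto simp: as_mat1_def fun_eq_iff)
  have snd0: "mfst (as_mat1 (0, y)) = (\<lambda>i j. 0)" "msnd (as_mat1 (0, y)) = as_mat1 y" for y :: 'b
    by (auto simp: as_mat1_def fun_eq_iff)
  have posV: "Im (h (x, 0)) = 0 \<and> 0 \<le> Re (h (x, 0))" if "as_mat1 x \<in> mpos V 1" for x
    using that mou_zero[OF W] by (intro state_pos[OF h]) (simp add: fst0)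
  have posW: "Im (h (0, y)) = 0 \<and> 0 \<le> Re (h (0, y))" if "as_mat1 y \<in> mpos W 1" for y
    using that mou_zero[OF V] by (intro state_pos[OF h]) (simp add: snd0)
  have minus: "h (- z) = - h z" for z
    using state_scale[OF h, of "- 1" z] by (simp add: scaleC_minus_one)
  have "Im (h (munit V, 0)) = 0"
    using no_state_unit[OF V noV] posV[of "munit V"] posV[of "- munit V"] minus[of "(munit V, 0)"] by auto
  then obtain p where p: "h (munit V, 0) = complex_of_real p"
    using complex_is_Real_iff Reals_cases by metis
  have "Im (h (0, munit W)) = 0"
    using no_state_unit[OF W noW] posW[of "munit W"] posW[of "- munit W"] minus[of "(0, munit W)"] by auto
  then obtain q where q: "h (0, munit W) = complex_of_real q"
    using complex_is_Real_iff Reals_cases by metis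
  have "h (munit V, munit W) = h (munit V, 0) + h (0, munit W)"
    using state_add[OF h, of "(munit V, 0)" "(0, munit W)"] by simp
  then have "complex_of_real (p + q) = 1"
    using state_unit[OF h] p q by simp
  then have "p + q = 1" by (metis of_real_eq_1_iff)
  then consider "0 < p" | "0 < q" by linarith
  then show False
  proof cases
    case 1
    have "is_state V (\<lambda>x. h (x, 0) / complex_of_real p)"
      unfolding is_state_def
    proof (intro conjI allI impI)
      show "h (x + y, 0) / complex_of_real p = h (x, 0) / complex_of_real p + h (y, 0) / complex_of_real p" for x y
        using state_add[OF h, of "(x, 0)" "(y, 0)"] by (simp add: add_divide_distrib)
      show "h (scaleC c x, 0) / complex_of_real p = c * (h (x, 0) / complex_of_real p)" for c x
        using state_scale[OF h, of c "(x, 0)"] by (simp add: scaleC_pair)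
      show "h (munit V, 0) / complex_of_real p = 1" using 1 p by simp
    qed (use posV 1 in auto)
    with noV show False by blast
  next
    case 2
    have "is_state W (\<lambda>x. h (0, x) / complex_of_real q)"
      unfolding is_state_def
    proof (intro conjI allI impI)
      show "h (0, x + y) / complex_of_real q = h (0, x) / complex_of_real q + h (0, y) / complex_of_real q" for x y
        using state_add[OF h, of "(0, x)" "(0, y)"] by (simp add: add_divide_distrib)
      show "h (0, scaleC c x) / complex_of_real q = c * (h (0, x) / complex_of_real q)" for c x
        using state_scale[OF h, of c "(0, x)"] by (simp add: scaleC_pair)
      show "h (0, munit W) / complex_of_real q = 1" using 2 q by simp
    qed (use posW 2 in auto)
    with noW show False by blast
  qed
qed

text \<open>Without states every \<open>CS\<close> with n \<ge> 1 is empty, so the topological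
  condition is vacuous and only the seminorm and its quotients matter. The maximum of LV and LW
  alone would vanish on all pairs of scalars; the functionals f and g tie the two scalars
  together.\<close>

lemma Mset_nonempty_no_state:
  fixes V :: "'a::complex_vector mou" and W :: "'b::complex_vector mou"
  assumes V: "is_mou V" and W: "is_mou W"
    and LV: "matrix_lip_seminorm V LV" and LW: "matrix_lip_seminorm W LW"
    and no: "\<nexists>h. is_state (mou_dsum V W) h"
  shows "Mset V LV W LW \<noteq> {}"
proof -
  have "\<exists>f g. (\<forall>x y. f (x + y) = f x + f y) \<and> (\<forall>c x. f (scaleC c x) = c * f x) \<and>
      (\<forall>x. f (minv V x) = cnj (f x)) \<and>
      (\<forall>x y. g (x + y) = g x + g y) \<and> (\<forall>c x. g (scaleC c x) = c * g x) \<and>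
      (\<forall>x. g (minv W x) = cnj (g x)) \<and>
      (f (munit V) = 1 \<and> g (munit W) = 1 \<or>
       (\<forall>x. f x = 0) \<and> (\<forall>x. g x = 0) \<and> (munit V = 0 \<or> munit W = 0))"
  \<comment> \<open>If one unit is zero, every pair of scalar multiples of the units is already a
    multiple of the joint unit, and zero functionals do.\<close>
  proof (cases "munit V = 0 \<or> munit W = 0")
    case True
    then show ?thesis by (intro exI[of _ "\<lambda>x. 0"]) simp
  next
    case False
    obtain f where "\<And>x y. f (x + y) = f x + f y" "\<And>c x. f (scaleC c x) = c * f x"
      "\<And>x. f (minv V x) = cnj (f x)" "f (munit V) = 1"
      using unital_functional[OF V] False by metis
    moreover obtain g where "\<And>x y. g (x + y) = g x + g y" "\<And>c x. g (scaleC c x) = c * g x"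
      "\<And>x. g (minv W x) = cnj (g x)" "g (munit W) = 1"
      using unital_functional[OF W] False by metis
    ultimately show ?thesis by blast
  qed
  then obtain f g where f: "\<And>x y. f (x + y) = f x + f y" "\<And>c x. f (scaleC c x) = c * f x"
      "\<And>x. f (minv V x) = cnj (f x)"
    and g: "\<And>x y. g (x + y) = g x + g y" "\<And>c x. g (scaleC c x) = c * g x"
      "\<And>x. g (minv W x) = cnj (g x)"
    and unit: "f (munit V) = 1 \<and> g (munit W) = 1 \<or>
       (\<forall>x. f x = 0) \<and> (\<forall>x. g x = 0) \<and> (munit V = 0 \<or> munit W = 0)"
    by blast
  define F where "F z = f (fst z) - g (snd z)" for z
  have F_add: "F (z + w) = F z + F w" for z w by (simp add: F_def f g)
  have F_scale: "F (scaleC c z) = c * F z" for c z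
    by (simp add: F_def f g scaleC_prod_def right_diff_distrib)
  have F_inv: "F (minv (mou_dsum V W) z) = cnj (F z)" for z by (simp add: F_def f g)
  have F0: "F 0 = 0" using F_scale[of 0 0] by simp
  have F_sum: "F (\<Sum>k\<in>A. z k) = (\<Sum>k\<in>A. F (z k))" for A :: "nat set" and z
    by (induction A rule: infinite_finite_induct) (simp_all add: F0 F_add)
  define L where "L n a = max (max (LV n (mfst a)) (LW n (msnd a))) (cmat_norm n n (\<lambda>i j. F (a i j)))"
    for n and a :: "nat \<Rightarrow> nat \<Rightarrow> 'a \<times> 'b"
  note q = qm_mat_mfst qm_mat_msnd
  have LVq: "LV n (mfst a) \<le> L n a" and LWq: "LW n (msnd a) \<le> L n a"
    and Fq: "cmat_norm n n (\<lambda>i j. F (a i j)) \<le> L n a" for n a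
    by (simp_all add: L_def)
  have L_leI: "L n a \<le> t" if "LV n (mfst a) \<le> t" "LW n (msnd a) \<le> t"
    "cmat_norm n n (\<lambda>i j. F (a i j)) \<le> t" for n a t
    using that by (simp add: L_def)
  have L_nonneg: "0 \<le> L n a" for n a
    by (rule order_trans[OF cmat_norm_nonneg Fq])
  have null: "L n a = 0 \<longleftrightarrow> (\<forall>i<n. \<forall>j<n. \<exists>c. a i j = scaleC c (munit (mou_dsum V W)))"
    if a: "a \<in> qm_mat n" for n a
  proof
    assume z: "L n a = 0"
    have "LV n (mfst a) = 0" "LW n (msnd a) = 0" "cmat_norm n n (\<lambda>i j. F (a i j)) = 0"
      using LVq[of n a] LWq[of n a] Fq[of n a] z lip_nonneg[OF LV q(1)[OF a]]
        lip_nonneg[OF LW q(2)[OF a]] cmat_norm_nonneg[of n n "\<lambda>i j. F (a i j)"] by linarith+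
    note zero = this
    show "\<forall>i<n. \<forall>j<n. \<exists>c. a i j = scaleC c (munit (mou_dsum V W))"
    proof (intro allI impI)
      fix i j assume ij: "i < n" "j < n"
      obtain c where c: "fst (a i j) = scaleC c (munit V)"
        using lip_null[OF LV q(1)[OF a]] zero ij by blast
      obtain c' where c': "snd (a i j) = scaleC c' (munit W)"
        using lip_null[OF LW q(2)[OF a]] zero ij by blast
      have "F (a i j) = 0" using norm_le_cmat_norm[OF ij, of "\<lambda>i j. F (a i j)"] zero by simp
      then have cc: "c * f (munit V) = c' * g (munit W)" by (simp add: F_def c c' f g)
      consider "c = c'" | "munit V = 0" | "munit W = 0" using unit cc by auto
      then show "\<exists>c. a i j = scaleC c (munit (mou_dsum V W))"
      proof cases
        case 1
        then show ?thesis using c c' by (intro exI[of _ c]) (simp add: scaleC_pair prod_eq_iff)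
      next
        case 2
        then show ?thesis using c c' by (intro exI[of _ c']) (simp add: scaleC_pair prod_eq_iff)
      next
        case 3
        then show ?thesis using c c' by (intro exI[of _ c]) (simp add: scaleC_pair prod_eq_iff)
      qed
    qed
  next
    assume sc: "\<forall>i<n. \<forall>j<n. \<exists>c. a i j = scaleC c (munit (mou_dsum V W))"
    have "LV n (mfst a) = 0"
      using sc lip_null[OF LV q(1)[OF a]] by (auto simp: scaleC_pair) (metis fst_conv)
    moreover have "LW n (msnd a) = 0"
      using sc lip_null[OF LW q(2)[OF a]] by (auto simp: scaleC_pair) (metis snd_conv)
    \<comment> \<open>Written with a factor 0 so that \<open>cmat_norm_scale\<close> evaluates the
      norm.\<close>
    moreover have "F (a i j) = 0 * F (a i j)" if ij: "i < n" "j < n" for i j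
    proof -
      obtain c where "a i j = scaleC c (munit V, munit W)" using sc[rule_format, OF ij] by auto
      then have "F (a i j) = c * (f (munit V) - g (munit W))" by (simp add: F_scale) (simp add: F_def)
      then show ?thesis using unit by auto
    qed
    then have "cmat_norm n n (\<lambda>i j. F (a i j)) = cmat_norm n n (\<lambda>i j. 0 * F (a i j))"
      by (rule cmat_norm_cong)
    then have "cmat_norm n n (\<lambda>i j. F (a i j)) = 0" unfolding cmat_norm_scale by simp
    ultimately show "L n a = 0" by (simp add: L_def)
  qed
  have semi: "matrix_lip_seminorm (mou_dsum V W) L"
  proof (rule lip_seminormI[OF _ _ L_nonneg _ _ null])
    show "minv (mou_dsum V W) (minv (mou_dsum V W) x) = x" for x
      using V W by (simp add: mou_inv_inv)
    show "minv (mou_dsum V W) 0 = 0"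
      using V W by (simp add: mou_inv_zero zero_prod_def)
  next
    fix n and a b :: "nat \<Rightarrow> nat \<Rightarrow> 'a \<times> 'b" assume a: "a \<in> qm_mat n" and b: "b \<in> qm_mat n"
    show "L n (\<lambda>i j. a i j + b i j) \<le> L n a + L n b"
    proof (rule L_leI)
      show "LV n (mfst (\<lambda>i j. a i j + b i j)) \<le> L n a + L n b"
        using lip_add[OF LV q(1)[OF a] q(1)[OF b]] LVq[of n a] LVq[of n b] by simp
      show "LW n (msnd (\<lambda>i j. a i j + b i j)) \<le> L n a + L n b"
        using lip_add[OF LW q(2)[OF a] q(2)[OF b]] LWq[of n a] LWq[of n b] by simp
      show "cmat_norm n n (\<lambda>i j. F (a i j + b i j)) \<le> L n a + L n b"
        using cmat_norm_triangle[of n n "\<lambda>i j. F (a i j)" "\<lambda>i j. F (b i j)"] Fq[of n a] Fq[of n b]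
        by (simp add: F_add)
    qed
  next
    fix n c and a :: "nat \<Rightarrow> nat \<Rightarrow> 'a \<times> 'b" assume a: "a \<in> qm_mat n"
    show "L n (\<lambda>i j. scaleC c (a i j)) \<le> cmod c * L n a"
    proof (rule L_leI)
      show "LV n (mfst (\<lambda>i j. scaleC c (a i j))) \<le> cmod c * L n a"
        using lip_scale[OF LV q(1)[OF a], of c] mult_left_mono[OF LVq, of "cmod c" n a]
        by (simp add: scaleC_prod_def)
      show "LW n (msnd (\<lambda>i j. scaleC c (a i j))) \<le> cmod c * L n a"
        using lip_scale[OF LW q(2)[OF a], of c] mult_left_mono[OF LWq, of "cmod c" n a]
        by (simp add: scaleC_prod_def)
      show "cmat_norm n n (\<lambda>i j. F (scaleC c (a i j))) \<le> cmod c * L n a"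
        using mult_left_mono[OF Fq, of "cmod c" n a] by (simp add: F_scale cmat_norm_scale)
    qed
  next
    fix m n and a b :: "nat \<Rightarrow> nat \<Rightarrow> 'a \<times> 'b" assume a: "a \<in> qm_mat m" and b: "b \<in> qm_mat n"
    show "L (m + n) (mdsum m n a b) \<le> max (L m a) (L n b)"
    proof (rule L_leI)
      show "LV (m + n) (mfst (mdsum m n a b)) \<le> max (L m a) (L n b)"
        unfolding mfst_mdsum lip_mdsum[OF LV q(1)[OF a] q(1)[OF b]] by (intro max.mono LVq)
      show "LW (m + n) (msnd (mdsum m n a b)) \<le> max (L m a) (L n b)"
        unfolding msnd_mdsum lip_mdsum[OF LW q(2)[OF a] q(2)[OF b]] by (intro max.mono LWq)
      have "(\<lambda>i j. F (mdsum m n a b i j)) = mdsum m n (\<lambda>i j. F (a i j)) (\<lambda>i j. F (b i j))"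
        by (simp add: mdsum_def fun_eq_iff F0)
      then show "cmat_norm (m + n) (m + n) (\<lambda>i j. F (mdsum m n a b i j)) \<le> max (L m a) (L n b)"
        using order_trans[OF cmat_norm_mdsum_le max.mono[OF Fq Fq]] by simp
    qed
  next
    fix m n \<alpha> \<beta> and a :: "nat \<Rightarrow> nat \<Rightarrow> 'a \<times> 'b" assume a: "a \<in> qm_mat m"
    have mono: "cmat_norm n m \<alpha> * v * cmat_norm m n \<beta> \<le> cmat_norm n m \<alpha> * L m a * cmat_norm m n \<beta>"
      if "v \<le> L m a" for v
      using that by (intro mult_right_mono mult_left_mono) auto
    show "L n (sandw n m \<alpha> a \<beta>) \<le> cmat_norm n m \<alpha> * L m a * cmat_norm m n \<beta>"
    proof (rule L_leI)
      show "LV n (mfst (sandw n m \<alpha> a \<beta>)) \<le> cmat_norm n m \<alpha> * L m a * cmat_norm m n \<beta>"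
        unfolding mfst_sandw by (rule order_trans[OF lip_sandw[OF LV q(1)[OF a]] mono[OF LVq]])
      show "LW n (msnd (sandw n m \<alpha> a \<beta>)) \<le> cmat_norm n m \<alpha> * L m a * cmat_norm m n \<beta>"
        unfolding msnd_sandw by (rule order_trans[OF lip_sandw[OF LW q(2)[OF a]] mono[OF LWq]])
      have "cmat_norm n n (\<lambda>i j. F (sandw n m \<alpha> a \<beta> i j))
          = cmat_norm n n (\<lambda>i j. \<Sum>p<m. \<alpha> i p * (\<Sum>q<m. F (a p q) * \<beta> q j))"
        by (rule cmat_norm_cong) (simp add: sandw_def F_sum F_scale sum_distrib_left ac_simps)
      also have "\<dots> \<le> cmat_norm n m \<alpha> * cmat_norm m n (\<lambda>p j. \<Sum>q<m. F (a p q) * \<beta> q j)"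
        by (rule cmat_norm_mult)
      also have "\<dots> \<le> cmat_norm n m \<alpha> * (cmat_norm m m (\<lambda>p q. F (a p q)) * cmat_norm m n \<beta>)"
        by (intro mult_left_mono cmat_norm_mult) simp
      also have "\<dots> \<le> cmat_norm n m \<alpha> * L m a * cmat_norm m n \<beta>"
        using mono[OF Fq] by (simp add: mult.assoc)
      finally show "cmat_norm n n (\<lambda>i j. F (sandw n m \<alpha> a \<beta> i j))
        \<le> cmat_norm n m \<alpha> * L m a * cmat_norm m n \<beta>" .
    qed
  next
    fix n and a :: "nat \<Rightarrow> nat \<Rightarrow> 'a \<times> 'b" assume a: "a \<in> qm_mat n"
    have star: "mfst (mstar (mou_dsum V W) a) = mstar V (mfst a)"
      "msnd (mstar (mou_dsum V W) a) = mstar W (msnd a)"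
      by (simp_all add: mstar_def)
    show "L n (mstar (mou_dsum V W) a) \<le> L n a"
    proof (rule L_leI)
      show "LV n (mfst (mstar (mou_dsum V W) a)) \<le> L n a"
        unfolding star lip_star[OF LV q(1)[OF a]] by (rule LVq)
      show "LW n (msnd (mstar (mou_dsum V W) a)) \<le> L n a"
        unfolding star lip_star[OF LW q(2)[OF a]] by (rule LWq)
      show "cmat_norm n n (\<lambda>i j. F (mstar (mou_dsum V W) a i j)) \<le> L n a"
        unfolding mstar_def F_inv cmat_norm_adjoint[of n n "\<lambda>i j. F (a i j)"] by (rule Fq)
    qed
  qed
  have "CS (mou_dsum V W) n = {}" if "1 \<le> n" for n
    using CS_state[OF _ that] no by blast
  then have LN: "matrix_lip_norm (mou_dsum V W) L"
    unfolding lip_norm_iff using semi by simp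
  have "L \<in> Mset V LV W LW"
  proof (rule MsetI[OF LN LVq LWq])
    fix n x s assume x: "x \<in> qm_mat n" and s: "LV n x < s"
    \<comment> \<open>The lift (x, f(x) 1) lies in the kernel of F, and LW vanishes on its second
      component. For zero functionals it is (x, 0).\<close>
    let ?z = "\<lambda>i j. scaleC (f (x i j)) (munit W)"
    have f0: "f 0 = 0" using f(2)[of 0 0] by simp
    have z: "?z \<in> qm_mat n" using x by (simp add: qm_mat_def f0)
    have "LW n ?z = 0" using lip_null[OF LW z] by blast
    moreover have "F (mpair x ?z i j) = 0 * F (mpair x ?z i j)" for i j
      using unit by (auto simp: F_def mpair_def g)
    then have "cmat_norm n n (\<lambda>i j. F (mpair x ?z i j)) = cmat_norm n n (\<lambda>i j. 0 * F (mpair x ?z i j))"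
      by (rule cmat_norm_cong)
    then have "cmat_norm n n (\<lambda>i j. F (mpair x ?z i j)) = 0" unfolding cmat_norm_scale by simp
    ultimately have "L n (mpair x ?z) \<le> s"
      using s lip_nonneg[OF LV x] by (intro L_leI) simp_all
    with z show "\<exists>y\<in>qm_mat n. L n (mpair x y) \<le> s" by blast
  next
    fix n y s assume y: "y \<in> qm_mat n" and s: "LW n y < s"
    let ?z = "\<lambda>i j. scaleC (g (y i j)) (munit V)"
    have g0: "g 0 = 0" using g(2)[of 0 0] by simp
    have z: "?z \<in> qm_mat n" using y by (simp add: qm_mat_def g0)
    have "LV n ?z = 0" using lip_null[OF LV z] by blast
    moreover have "F (mpair ?z y i j) = 0 * F (mpair ?z y i j)" for i j
      using unit by (auto simp: F_def mpair_def f)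
    then have "cmat_norm n n (\<lambda>i j. F (mpair ?z y i j)) = cmat_norm n n (\<lambda>i j. 0 * F (mpair ?z y i j))"
      by (rule cmat_norm_cong)
    then have "cmat_norm n n (\<lambda>i j. F (mpair ?z y i j)) = 0" unfolding cmat_norm_scale by simp
    ultimately have "L n (mpair ?z y) \<le> s"
      using s lip_nonneg[OF LW y] by (intro L_leI) simp_all
    with z show "\<exists>x\<in>qm_mat n. L n (mpair x y) \<le> s" by blast
  qed
  then show ?thesis by blast
qed

subsection \<open>The triangle inequality\<close>

text \<open>An infimum may be minus infinity, or infinity over an empty set, so no common epsilon is
  available. A real t strictly between the two sides is split into u and v above the respective
  infima.\<close>

lemma le_INF_add_INF_ereal:
  fixes f :: "'i \<Rightarrow> ereal" and g :: "'j \<Rightarrow> ereal"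
  assumes le: "\<And>x y. x \<in> A \<Longrightarrow> y \<in> B \<Longrightarrow> d \<le> f x + g y"
  shows "d \<le> (INF x\<in>A. f x) + (INF y\<in>B. g y)"
proof (rule ccontr)
  let ?p = "INF x\<in>A. f x" and ?q = "INF y\<in>B. g y"
  assume "\<not> ?thesis"
  then have lt: "?p + ?q < d" by simp
  then obtain t where t: "?p + ?q < ereal t" "ereal t < d" using ereal_dense2 by blast
  have "?p \<noteq> \<infinity>" "?q \<noteq> \<infinity>" using t(1) by auto
  then have "\<exists>u v. ?p < ereal u \<and> ?q < ereal v \<and> u + v \<le> t"
  proof (cases ?p; cases ?q)
    fix a b assume ab: "?p = ereal a" "?q = ereal b"
    then have "a + b < t" using t(1) by simp
    then show ?thesis unfolding ab
      by (intro exI[of _ "a + (t - a - b) / 2"] exI[of _ "b + (t - a - b) / 2"]) simp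
  next
    fix a assume ab: "?p = ereal a" "?q = - \<infinity>"
    show ?thesis unfolding ab by (intro exI[of _ "a + 1"] exI[of _ "t - a - 1"]) simp
  next
    fix b assume ab: "?p = - \<infinity>" "?q = ereal b"
    show ?thesis unfolding ab by (intro exI[of _ "t - b - 1"] exI[of _ "b + 1"]) simp
  next
    assume ab: "?p = - \<infinity>" "?q = - \<infinity>"
    show ?thesis unfolding ab by (intro exI[of _ t] exI[of _ 0]) simp
  qed auto
  then obtain u v where uv: "?p < ereal u" "?q < ereal v" "u + v \<le> t" by blast
  obtain x where x: "x \<in> A" "f x < ereal u" using uv(1) unfolding INF_less_iff by blast
  obtain y where y: "y \<in> B" "g y < ereal v" using uv(2) unfolding INF_less_iff by blast
  have "f x + g y \<le> ereal u + ereal v" using x y by (intro add_mono less_imp_le)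
  also have "\<dots> \<le> ereal t" using uv(3) by simp
  finally have "f x + g y < d" using t(2) by (rule le_less_trans)
  with le[OF x(1) y(1)] show False by simp
qed

lemma SUP_INF_triangle:
  fixes d :: "'i \<Rightarrow> 'k \<Rightarrow> ereal"
  assumes "\<And>a b c. a \<in> A \<Longrightarrow> b \<in> B \<Longrightarrow> c \<in> C \<Longrightarrow> d a c \<le> p a b + q b c"
  shows "(SUP a\<in>A. INF c\<in>C. d a c) \<le> (SUP a\<in>A. INF b\<in>B. p a b) + (SUP b\<in>B. INF c\<in>C. q b c)"
proof (rule SUP_least)
  fix a assume a: "a \<in> A"
  have "(INF c\<in>C. d a c) \<le> p a b + (SUP b\<in>B. INF c\<in>C. q b c)" if b: "b \<in> B" for b
  proof -
    \<comment> \<open>The singleton index set lets the constant \<open>p a b\<close> enter as an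
      infimum.\<close>
    have "(INF c\<in>C. d a c) \<le> (INF i\<in>{()}. p a b) + (INF c\<in>C. q b c)"
      using assms[OF a b] by (intro le_INF_add_INF_ereal) (auto intro: INF_lower2)
    also have "\<dots> \<le> p a b + (SUP b\<in>B. INF c\<in>C. q b c)"
      using b by (intro add_mono SUP_upper) simp_all
    finally show ?thesis .
  qed
  then have "(INF c\<in>C. d a c) \<le> (INF b\<in>B. p a b) + (INF i\<in>{()}. SUP b\<in>B. INF c\<in>C. q b c)"
    by (intro le_INF_add_INF_ereal) simp
  also have "\<dots> \<le> (SUP a\<in>A. INF b\<in>B. p a b) + (SUP b\<in>B. INF c\<in>C. q b c)"
    using a by (intro add_mono SUP_upper) simp_all
  finally show "(INF c\<in>C. d a c) \<le> (SUP a\<in>A. INF b\<in>B. p a b) + (SUP b\<in>B. INF c\<in>C. q b c)" .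
qed

lemma hausdorff_dist_ereal_image:
  "hausdorff_dist_ereal D (f ` A) (g ` B) =
    max (SUP a\<in>A. INF b\<in>B. D (f a) (g b)) (SUP b\<in>B. INF a\<in>A. D (f a) (g b))"
  by (simp add: hausdorff_dist_ereal_def image_image)

text \<open>B has two embeddings because the middle space sits in two different direct sums: its
  maps are composed with \<open>snd\<close> in the first and with \<open>fst\<close> in the
  second.\<close>

lemma hausdorff_triangle:
  assumes tri: "\<And>a b c. a \<in> A \<Longrightarrow> b \<in> B \<Longrightarrow> c \<in> C \<Longrightarrow>
    D (f a) (f' c) \<le> P (g a) (g' b) + Q (h b) (h' c)"
  shows "hausdorff_dist_ereal D (f ` A) (f' ` C)
    \<le> hausdorff_dist_ereal P (g ` A) (g' ` B) + hausdorff_dist_ereal Q (h ` B) (h' ` C)"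
  unfolding hausdorff_dist_ereal_image
proof (rule max.boundedI)
  show "(SUP a\<in>A. INF c\<in>C. D (f a) (f' c))
    \<le> max (SUP a\<in>A. INF b\<in>B. P (g a) (g' b)) (SUP b\<in>B. INF a\<in>A. P (g a) (g' b))
    + max (SUP b\<in>B. INF c\<in>C. Q (h b) (h' c)) (SUP c\<in>C. INF b\<in>B. Q (h b) (h' c))"
    by (rule order_trans[OF SUP_INF_triangle[OF tri] add_mono]) auto
  have "(SUP c\<in>C. INF a\<in>A. D (f a) (f' c))
    \<le> (SUP c\<in>C. INF b\<in>B. Q (h b) (h' c)) + (SUP b\<in>B. INF a\<in>A. P (g a) (g' b))"
    using tri by (intro SUP_INF_triangle) (simp add: add.commute)
  also have "\<dots> = (SUP b\<in>B. INF a\<in>A. P (g a) (g' b)) + (SUP c\<in>C. INF b\<in>B. Q (h b) (h' c))"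
    by (rule add.commute)
  also have "\<dots> \<le> max (SUP a\<in>A. INF b\<in>B. P (g a) (g' b)) (SUP b\<in>B. INF a\<in>A. P (g a) (g' b))
    + max (SUP b\<in>B. INF c\<in>C. Q (h b) (h' c)) (SUP c\<in>C. INF b\<in>B. Q (h b) (h' c))"
    by (intro add_mono) auto
  finally show "(SUP c\<in>C. INF a\<in>A. D (f a) (f' c))
    \<le> max (SUP a\<in>A. INF b\<in>B. P (g a) (g' b)) (SUP b\<in>B. INF a\<in>A. P (g a) (g' b))
    + max (SUP b\<in>B. INF c\<in>C. Q (h b) (h' c)) (SUP c\<in>C. INF b\<in>B. Q (h b) (h' c))" .
qed

section \<open>The distance with and without states\<close>

lemma dist_NC_triangle_states:
  assumes V1: "quantized_metric_space V1 L1" and V2: "quantized_metric_space V2 L2"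
    and V3: "quantized_metric_space V3 L3"
    and states: "is_state V1 s" "is_state V2 f" "is_state V3 u"
  shows "dist_NC V1 L1 V3 L3 \<le> dist_NC V1 L1 V2 L2 + dist_NC V2 L2 V3 L3"
  unfolding dist_NC_def[of V1 L1 V2 L2] dist_NC_def[of V2 L2 V3 L3]
proof (rule le_INF_add_INF_ereal)
  fix L12 L23 assume M12: "L12 \<in> Mset V1 L1 V2 L2" and M23: "L23 \<in> Mset V2 L2 V3 L3"
  interpret glue_pair V1 V2 V3 L12 L23
    using V1 V2 V3 lip_norm_seminorm[OF Mset_lip_norm[OF M12]] lip_norm_seminorm[OF Mset_lip_norm[OF M23]]
    by unfold_locales (simp_all add: quantized_metric_space_def)
  let ?h12 = "\<lambda>n. hausdorff_dist_ereal (DL n L12) ((\<lambda>\<phi>. \<phi> \<circ> fst) ` CS V1 n) ((\<lambda>\<phi>. \<phi> \<circ> snd) ` CS V2 n)"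
  let ?h23 = "\<lambda>n. hausdorff_dist_ereal (DL n L23) ((\<lambda>\<phi>. \<phi> \<circ> fst) ` CS V2 n) ((\<lambda>\<phi>. \<phi> \<circ> snd) ` CS V3 n)"
  let ?h13 = "\<lambda>n. hausdorff_dist_ereal (DL n L13) ((\<lambda>\<phi>. \<phi> \<circ> fst) ` CS V1 n) ((\<lambda>\<phi>. \<phi> \<circ> snd) ` CS V3 n)"
  let ?c = "\<lambda>n::nat. ereal (1 / (real n)\<^sup>2)"
  have "dist_NC V1 L1 V3 L3 \<le> (SUP n\<in>{1..}. ?c n * ?h13 n)"
    unfolding dist_NC_def by (rule INF_lower) (rule glue_in_Mset[OF V1 V2 V3 M12 M23 states])
  also have "\<dots> \<le> (SUP n\<in>{1..}. ?c n * ?h12 n) + (SUP n\<in>{1..}. ?c n * ?h23 n)"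
  proof (rule SUP_least)
    fix n :: nat assume n: "n \<in> {1..}"
    have "?h13 n \<le> ?h12 n + ?h23 n"
      by (rule hausdorff_triangle) (intro DL_L13_le CS_mlin)
    then have "?c n * ?h13 n \<le> ?c n * (?h12 n + ?h23 n)"
      by (rule ereal_mult_left_mono) simp
    \<comment> \<open>The factor is finite and nonnegative, so it distributes over sums in
      \<open>ereal\<close>.\<close>
    also have "\<dots> = ?c n * ?h12 n + ?c n * ?h23 n"
      by (rule ereal_pos_distrib) simp_all
    also have "\<dots> \<le> (SUP n\<in>{1..}. ?c n * ?h12 n) + (SUP n\<in>{1..}. ?c n * ?h23 n)"
      using n by (intro add_mono SUP_upper)
    finally show "?c n * ?h13 n \<le> (SUP n\<in>{1..}. ?c n * ?h12 n) + (SUP n\<in>{1..}. ?c n * ?h23 n)" .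
  qed
  finally show "dist_NC V1 L1 V3 L3 \<le> (SUP n\<in>{1..}. ?c n * ?h12 n) + (SUP n\<in>{1..}. ?c n * ?h23 n)" .
qed

text \<open>At n = 1 exactly one of the two sets of states is empty; the infimum over it is
  infinity, and the outer supremum over the other set is not empty. An empty \<open>Mset\<close>
  gives infinity as well.\<close>

lemma dist_NC_eq_infinity:
  assumes V: "is_mou V" and W: "is_mou W"
    and ne: "(\<exists>h. is_state V h) \<noteq> (\<exists>h. is_state W h)"
  shows "dist_NC V LV W LW = \<infinity>"
proof -
  have "(SUP n\<in>{1..}. ereal (1 / (real n)\<^sup>2) * hausdorff_dist_ereal (DL n L)
      ((\<lambda>\<phi>. \<phi> \<circ> fst) ` CS V n) ((\<lambda>\<phi>. \<phi> \<circ> snd) ` CS W n)) = \<infinity>" (is "?S = _") for L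
  proof -
    have "hausdorff_dist_ereal (DL 1 L) ((\<lambda>\<phi>. \<phi> \<circ> fst) ` CS V 1) ((\<lambda>\<phi>. \<phi> \<circ> snd) ` CS W 1) = \<infinity>"
      using ne CS_nonempty_iff[OF V order_refl] CS_nonempty_iff[OF W order_refl]
      unfolding hausdorff_dist_ereal_image
      by (cases "CS V 1 = {}") (auto simp: top_ereal_def bot_ereal_def)
    moreover have "ereal (1 / (real 1)\<^sup>2) * hausdorff_dist_ereal (DL 1 L)
        ((\<lambda>\<phi>. \<phi> \<circ> fst) ` CS V 1) ((\<lambda>\<phi>. \<phi> \<circ> snd) ` CS W 1) \<le> ?S"
      by (rule SUP_upper) simp
    ultimately show ?thesis by simp
  qed
  then show ?thesis
    unfolding dist_NC_def
    by (cases "Mset V LV W LW = {}") (simp_all add: top_ereal_def)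
qed

text \<open>Suprema over empty sets of states are minus infinity and remain so under the positive
  factor. An admissible seminorm has to exist, since otherwise the outer infimum would be
  infinity.\<close>

lemma dist_NC_no_state:
  assumes V: "is_mou V" and W: "is_mou W"
    and LV: "matrix_lip_seminorm V LV" and LW: "matrix_lip_seminorm W LW"
    and no: "\<nexists>h. is_state V h" "\<nexists>h. is_state W h"
  shows "dist_NC V LV W LW = - \<infinity>"
proof -
  obtain L where L: "L \<in> Mset V LV W LW"
    using Mset_nonempty_no_state[OF V W LV LW no_state_dsum[OF V W no]] by blast
  have "dist_NC V LV W LW \<le> (SUP n\<in>{1..}. ereal (1 / (real n)\<^sup>2) * hausdorff_dist_ereal (DL n L)
      ((\<lambda>\<phi>. \<phi> \<circ> fst) ` CS V n) ((\<lambda>\<phi>. \<phi> \<circ> snd) ` CS W n))"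
    unfolding dist_NC_def by (rule INF_lower[OF L])
  also have "\<dots> \<le> - \<infinity>"
  proof (rule SUP_least)
    fix n :: nat assume "n \<in> {1..}"
    then have n: "1 \<le> n" by simp
    have "CS V n = {}" "CS W n = {}"
      using CS_nonempty_iff[OF V n] CS_nonempty_iff[OF W n] no by blast+
    then show "ereal (1 / (real n)\<^sup>2) * hausdorff_dist_ereal (DL n L)
      ((\<lambda>\<phi>. \<phi> \<circ> fst) ` CS V n) ((\<lambda>\<phi>. \<phi> \<circ> snd) ` CS W n) \<le> - \<infinity>"
      using n by (simp add: hausdorff_dist_ereal_def bot_ereal_def)
  qed
  finally show ?thesis by simp
qed

theorem theorem4p7:
  fixes V1 :: "'a::complex_vector mou" and V2 :: "'b::complex_vector mou"
    and V3 :: "'c::complex_vector mou"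
    and L1 :: "nat \<Rightarrow> (nat \<Rightarrow> nat \<Rightarrow> 'a) \<Rightarrow> real"
    and L2 :: "nat \<Rightarrow> (nat \<Rightarrow> nat \<Rightarrow> 'b) \<Rightarrow> real"
    and L3 :: "nat \<Rightarrow> (nat \<Rightarrow> nat \<Rightarrow> 'c) \<Rightarrow> real"
  assumes "quantized_metric_space V1 L1"
    and "quantized_metric_space V2 L2"
    and "quantized_metric_space V3 L3"
  shows "dist_NC V1 L1 V3 L3 \<le> dist_NC V1 L1 V2 L2 + dist_NC V2 L2 V3 L3"
proof -
  have V: "is_mou V1" "is_mou V2" "is_mou V3"
    and L: "matrix_lip_seminorm V1 L1" "matrix_lip_seminorm V3 L3"
    using assms by (auto simp: quantized_metric_space_def lip_norm_seminorm)
  show ?thesis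
  proof (cases "(\<exists>h. is_state V1 h) = (\<exists>h. is_state V2 h) \<and> (\<exists>h. is_state V2 h) = (\<exists>h. is_state V3 h)")
    case False
    \<comment> \<open>In \<open>ereal\<close> infinity absorbs even minus infinity, so the other
      summand may take any value.\<close>
    then have "dist_NC V1 L1 V2 L2 = \<infinity> \<or> dist_NC V2 L2 V3 L3 = \<infinity>"
      using dist_NC_eq_infinity[OF V(1,2)] dist_NC_eq_infinity[OF V(2,3)] by blast
    then show ?thesis by auto
  next
    case same: True
    show ?thesis
    proof (cases "\<exists>h. is_state V1 h")
      case True
      with same obtain s f u where "is_state V1 s" "is_state V2 f" "is_state V3 u" by blast
      then show ?thesis by (rule dist_NC_triangle_states[OF assms])
    next
      case False
      with same have "dist_NC V1 L1 V3 L3 = - \<infinity>" by (intro dist_NC_no_state V L) auto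
      then show ?thesis by simp
    qed
  qed
qed

end
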